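(* Let $0<k<1$, let $m,n$ be positive integers with $0<m<\frac n2$, and let $\lambda=\frac mn$ (so $0<\lambda<\frac12$). Let $$\Omega(u)=\frac{H(u-\lambda K)\,\Theta_1(u-\lambda K)}{H(u+\lambda K)\,\Theta_1(u+\lambda K)},\qquad z(u)=\frac{\operatorname{cn}(2u)\operatorname{cn}(2\lambda K)-1}{\operatorname{cn}(2u)-\operatorname{cn}(2\lambda K)},$$ let $\mathcal{T}_n$ be the polynomial of degree $n$ given by $$\mathcal{T}_n(z(u))=\frac12\Bigl(\Omega^n(u)+\frac1{\Omega^n(u)}\Bigr),$$ and let $$z^*=1+\frac{1}{\operatorname{dn}(2\lambda K)}\bigl(\operatorname{cn}(2\lambda K)-1+2\operatorname{sn}(2\lambda K)\operatorname{zn}(\lambda K)\bigr).$$ Let $\widetilde{a_3a_4}$ denote the Jordan arc, symmetric with respect to the real line, with endpoints $a_3=\alpha+\mathrm{i}\beta$ and $a_4=\overline{a_3}$, such that $\mathcal{T}_n^{-1}([-1,1])=[-1,1]\cup\widetilde{a_3a_4}$, where $$\alpha=\frac{\operatorname{cn}(2\lambda K)}{\operatorname{dn}^2(2\lambda K)},\qquad \beta=\frac{kk'\operatorname{sn}^2(2\lambda K)}{\operatorname{dn}^2(2\lambda K)}.$$ Then: (i) If $z^*\le 1$ (i.e. the arcs $\widetilde{a_3a_4}$ and $[-1,1]$ intersect at the point $z^*$), then $\mathcal{T}_n$ has at least $n-2m+1$ extremal points on $[-1,1]$. (ii) If $z^*>1$ (i.e. the arcs $\widetilde{a_3a_4}$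 and $[-1,1]$ are non-intersecting), then $\mathcal{T}_n$ has exactly $n-2m+1$ extremal points on $[-1,1]$ and exactly $2m+1$ extremal points on $\widetilde{a_3a_4}$.
   Context: $\operatorname{sn},\operatorname{cn},\operatorname{dn}$ are Jacobi's elliptic functions with modulus $k$; $k'=\sqrt{1-k^2}$; $K=K(k)$ and $E=E(k)$ are the complete elliptic integrals of the first and second kind, $K'=K(k')$. $\operatorname{zn}(u)=\int_0^u\operatorname{dn}^2(t)\,dt-\frac{E}{K}u$ is Jacobi's zeta function. Jacobi's theta functions with modulus $k$ and nome $q=\exp(-\pi K'/K)$ are $H(u)=\theta_1(\frac{\pi u}{2K},q)$, $H_1(u)=\theta_2(\frac{\pi u}{2K},q)$, $\Theta_1(u)=\theta_3(\frac{\pi u}{2K},q)$, $\Theta(u)=\theta_4(\frac{\pi u}{2K},q)$. $\mathcal{T}_n^{-1}([-1,1])=\{z\in\mathbb{C}:\mathcal{T}_n(z)\in[-1,1]\}$. An extremal point of $\mathcal{T}_n$ is a point $z_0\in\mathcal{T}_n^{-1}([-1,1])$ with $\mathcal{T}_n(z_0)\in\{-1,1\}$, counted without multiplicity. Known background facts: since $\lambda=\frac mn$, the formula for $\mathcal{T}_n(z(u))$ indeed defines a polynomial $\mathcal{T}_n$ of degree $n$ in $z$; there is a polynomial $\mathcal{U}_{n-2}$ of degree $n-2$ with $\mathcal{T}_n^2(z)-(z^2-1)(z-a_3)(z-a_4)\,\mathcal{U}_{n-2}^2(z)=1$, and $z^*$ satisfies $\mathcal{T}_n'(z)=\pm n(z-z^*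 )\,\mathcal{U}_{n-2}(z)$. The set $\mathcal{T}_n^{-1}([-1,1])=\{z(u):u\in\mathbb{C},\,|\Omega(u)|=1\}$ consists of $[-1,1]$ and a Jordan arc $\widetilde{a_3a_4}$ symmetric with respect to the real line with endpoints $a_3,a_4$; if $z^*\le1$ this arc crosses $[-1,1]$ at $z^*$, and if $z^*>1$ the arc and $[-1,1]$ do not intersect. *)

theory Defs
  imports "HOL-Analysis.Analysis"
begin

(* The series below are stated for a common type of real and complex arguments, so that a value
   at a real argument is literally a real number; the nome q is always real with 0 < q < 1. *)

definition theta1 :: "'a::{real_normed_field,banach} \<Rightarrow> real \<Rightarrow> 'a" where
  "theta1 z q = 2 * (\<Sum>j. (-1) ^ j * of_real (q powr ((real j + 1/2)\<^sup>2)) * sin (of_nat (2*j+1) * z))"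

definition theta2 :: "'a::{real_normed_field,banach} \<Rightarrow> real \<Rightarrow> 'a" where
  "theta2 z q = 2 * (\<Sum>j. of_real (q powr ((real j + 1/2)\<^sup>2)) * cos (of_nat (2*j+1) * z))"

definition theta3 :: "'a::{real_normed_field,banach} \<Rightarrow> real \<Rightarrow> 'a" where
  "theta3 z q = 1 + 2 * (\<Sum>j. of_real (q ^ ((j+1)\<^sup>2)) * cos (of_nat (2*(j+1)) * z))"

definition theta4 :: "'a::{real_normed_field,banach} \<Rightarrow> real \<Rightarrow> 'a" where
  "theta4 z q = 1 + 2 * (\<Sum>j. (-1) ^ (j+1) * of_real (q ^ ((j+1)\<^sup>2)) * cos (of_nat (2*(j+1)) * z))"

definition compl_modulus :: "real \<Rightarrow> real" where
  "compl_modulus k = sqrt (1 - k\<^sup>2)"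

definition ellK :: "real \<Rightarrow> real" where
  "ellK k = integral {0..pi/2} (\<lambda>t. 1 / sqrt (1 - k\<^sup>2 * (sin t)\<^sup>2))"

definition ellE :: "real \<Rightarrow> real" where
  "ellE k = integral {0..pi/2} (\<lambda>t. sqrt (1 - k\<^sup>2 * (sin t)\<^sup>2))"

definition nome :: "real \<Rightarrow> real" where
  "nome k = exp (- pi * ellK (compl_modulus k) / ellK k)"

definition jacobi_H :: "real \<Rightarrow> 'a::{real_normed_field,banach} \<Rightarrow> 'a" where
  "jacobi_H k u = theta1 (of_real (pi / (2 * ellK k)) * u) (nome k)"

definition jacobi_H1 :: "real \<Rightarrow> 'a::{real_normed_field,banach} \<Rightarrow> 'a" where
  "jacobi_H1 k u = theta2 (of_real (pi / (2 * ellK k)) * u) (nome k)"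

definition jacobi_Theta1 :: "real \<Rightarrow> 'a::{real_normed_field,banach} \<Rightarrow> 'a" where
  "jacobi_Theta1 k u = theta3 (of_real (pi / (2 * ellK k)) * u) (nome k)"

definition jacobi_Theta :: "real \<Rightarrow> 'a::{real_normed_field,banach} \<Rightarrow> 'a" where
  "jacobi_Theta k u = theta4 (of_real (pi / (2 * ellK k)) * u) (nome k)"

(* The elliptic functions as quotients of theta functions, as in DLMF 22.2.4-22.2.6.
   Their poles are the zeros of jacobi_Theta, where the quotients below have the junk value 0. *)

definition jacobi_sn :: "real \<Rightarrow> 'a::{real_normed_field,banach} \<Rightarrow> 'a" where
  "jacobi_sn k u = (jacobi_Theta1 k 0 / jacobi_H1 k 0) * (jacobi_H k u / jacobi_Theta k u)"

definition jacobi_cn :: "real \<Rightarrow> 'a::{real_normed_field,banach} \<Rightarrow> 'a" where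
  "jacobi_cn k u = (jacobi_Theta k 0 / jacobi_H1 k 0) * (jacobi_H1 k u / jacobi_Theta k u)"

definition jacobi_dn :: "real \<Rightarrow> 'a::{real_normed_field,banach} \<Rightarrow> 'a" where
  "jacobi_dn k u = (jacobi_Theta k 0 / jacobi_Theta1 k 0) * (jacobi_Theta1 k u / jacobi_Theta k u)"

definition jacobi_zn :: "real \<Rightarrow> real \<Rightarrow> real" where
  "jacobi_zn k u = (LBINT t=0..u. (jacobi_dn k t)\<^sup>2) - ellE k / ellK k * u"

definition Omega :: "real \<Rightarrow> real \<Rightarrow> complex \<Rightarrow> complex" where
  "Omega k l u =
     (jacobi_H k (u - of_real (l * ellK k)) * jacobi_Theta1 k (u - of_real (l * ellK k))) /
     (jacobi_H k (u + of_real (l * ellK k)) * jacobi_Theta1 k (u + of_real (l * ellK k)))"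

definition z_map :: "real \<Rightarrow> real \<Rightarrow> complex \<Rightarrow> complex" where
  "z_map k l u =
     (jacobi_cn k (2 * u) * of_real (jacobi_cn k (2 * l * ellK k)) - 1) /
     (jacobi_cn k (2 * u) - of_real (jacobi_cn k (2 * l * ellK k)))"

(* The points at which no division by 0 occurs in Omega, 1 / Omega and z_map
   (including the division by jacobi_Theta hidden in jacobi_cn). *)
definition regular_points :: "real \<Rightarrow> real \<Rightarrow> complex set" where
  "regular_points k l = {u.
     jacobi_Theta k (2 * u) \<noteq> 0 \<and>
     jacobi_cn k (2 * u) \<noteq> of_real (jacobi_cn k (2 * l * ellK k)) \<and>
     jacobi_H k (u - of_real (l * ellK k)) * jacobi_Theta1 k (u - of_real (l * ellK k)) \<noteq> 0 \<and>
     jacobi_H k (u + of_real (l * ellK k)) * jacobi_Theta1 k (u + of_real (l * ellK k)) \<noteq> 0}"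

definition is_T_poly :: "real \<Rightarrow> nat \<Rightarrow> nat \<Rightarrow> complex poly \<Rightarrow> bool" where
  "is_T_poly k m n T \<longleftrightarrow> degree T = n \<and>
     (\<forall>u \<in> regular_points k (real m / real n).
        poly T (z_map k (real m / real n) u) =
          (Omega k (real m / real n) u ^ n + 1 / Omega k (real m / real n) u ^ n) / 2)"

definition z_star :: "real \<Rightarrow> real \<Rightarrow> real" where
  "z_star k l = 1 + 1 / jacobi_dn k (2 * l * ellK k) *
     (jacobi_cn k (2 * l * ellK k) - 1 +
      2 * jacobi_sn k (2 * l * ellK k) * jacobi_zn k (l * ellK k))"

definition arc_alpha :: "real \<Rightarrow> real \<Rightarrow> real" where
  "arc_alpha k l = jacobi_cn k (2 * l * ellK k) / (jacobi_dn k (2 * l * ellK k))\<^sup>2"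

definition arc_beta :: "real \<Rightarrow> real \<Rightarrow> real" where
  "arc_beta k l = k * compl_modulus k * (jacobi_sn k (2 * l * ellK k))\<^sup>2 /
     (jacobi_dn k (2 * l * ellK k))\<^sup>2"

abbreviation unit_segment :: "complex set" where
  "unit_segment \<equiv> complex_of_real ` {-1..1}"

definition inverse_image :: "complex poly \<Rightarrow> complex set" where
  "inverse_image T = {z. poly T z \<in> unit_segment}"

definition extremal_points :: "complex poly \<Rightarrow> complex set" where
  "extremal_points T = {z \<in> inverse_image T. poly T z \<in> {-1, 1}}"

end

(* On the segment u in i [0, K'] the map z is an increasing bijection onto [-1, 1] and Omega = exp (i phi), so that
   T (z) = cos (n phi) there. As phi equals pi at one end and 2 pi m / n modulo 2 pi at the other, n phi runs
   through at least n - 2 m + 1 multiples of pi, which is (i). For (ii), phi' = A (z - z_star) and the differential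
   equation of z give the polynomial identity M B T'^2 = n^2 A^2 (z - z_star)^2 (T^2 - 1) with B of degree 4 having
   the simple roots 1, -1 and a nonreal conjugate pair. If z_star > 1, then phi is monotone, and comparing orders
   of vanishing shows that T^2 - 1 has exactly n + 2 roots: the four roots of B are simple and the others double.
   Hence T^{-1} ([-1, 1]) is just the segment near each point of the segment, so the connected arc avoids it.
   The identification of z_star needs zn = Theta' / Theta and therefore that the nome of k gives back the modulus k;
   this is obtained from Watson's product formula for theta series. *)

theory Submission
  imports Defs "HOL-Complex_Analysis.Complex_Analysis" "HOL-Computational_Algebra.Fundamental_Theorem_Algebra"
begin

section \<open>Theta series\<close>

text \<open>The counting rests on one fact: both the square of \<open>dv\<close> and the derivative
  of the phase are polynomials in \<open>v\<close>. By the addition formula for \<open>thf\<close>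
  they are forms in F^2 and G^2 over powers of the common denominator \<open>NN\<close>, while v - 1
  and v + 1 are multiples of G^2 / NN and F^2 / NN. Everything is therefore decided on the segment
  alone. Three gaps in the data shape the rest. The phase at the right end is known only modulo 2
  pi, and in (ii) the total count has to exclude every other branch. The differential identity says
  nothing about the order of T^2 - 1 at \<open>z_star\<close>, so a root there must be ruled out
  separately. And z(u) is undefined at a pole of cn(2 u) inside the segment, where the formula for T
  is recovered by continuity. Theta functions are taken as bilateral Gaussian sums with a real
  characteristic because a single product formula then gives all identities; its passage to the
  squared nome also gives the zeros and the Wronskians, without the triple product.\<close>

text \<open>The nome is \<open>exp (- s)\<close>; the characteristic \<open>e\<close> is \<open>0\<close> for \<open>theta3\<close>, \<open>theta4\<close> and
  \<open>1/2\<close> for \<open>theta1\<close>, \<open>theta2\<close>.\<close>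

definition th :: "real \<Rightarrow> real \<Rightarrow> complex \<Rightarrow> complex" where
  "th e s x = (\<Sum>\<^sub>\<infinity>n::int. exp (of_real (- s * (of_int n + e)\<^sup>2) + 2 * \<i> * of_real (of_int n + e) * x))"

section \<open>Absolute convergence of the bilateral series\<close>

lemma int_UNIV_split: "(UNIV :: int set) = range int \<union> range (\<lambda>n. - int n - 1)"
proof -
  have "x \<in> range int \<union> range (\<lambda>n. - int n - 1)" for x
    by (cases "x \<ge> 0") (auto simp: image_iff intro: exI[of _ "nat x"] exI[of _ "nat (- x - 1)"])
  then show ?thesis by auto
qed

lemma summable_on_int_split:
  fixes f :: "int \<Rightarrow> real"
  assumes "f summable_on range int" "f summable_on range (\<lambda>n. - int n - 1)"
  shows "f summable_on UNIV"
  unfolding int_UNIV_split by (rule summable_on_union[OF assms])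

lemma summable_exp_minus_abs_int: "(\<lambda>n::int. exp (- \<bar>real_of_int n\<bar>)) summable_on UNIV"
proof (rule summable_on_int_split)
  have s: "summable (\<lambda>n. exp (-1::real) ^ n)" by (intro summable_geometric) auto
  then have "(\<lambda>n. exp (-1::real) ^ n) summable_on UNIV"
    by (intro norm_summable_imp_summable_on) auto
  then have 1: "(\<lambda>n. exp (- real n)) summable_on UNIV"
    by (simp add: exp_of_nat_mult [symmetric])
  then show "(\<lambda>n::int. exp (- \<bar>real_of_int n\<bar>)) summable_on range int"
    by (subst summable_on_reindex) (auto simp: o_def inj_on_def)
  have "(\<lambda>n. exp (- 1) * exp (- real n)) summable_on UNIV"
    using summable_on_cmult_right[OF 1, of "exp (-1)"] by simp
  then have "(\<lambda>n. exp (- 1 - real n)) summable_on UNIV"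
    by (simp add: exp_diff exp_minus field_simps)
  then show "(\<lambda>n::int. exp (- \<bar>real_of_int n\<bar>)) summable_on range (\<lambda>n. - int n - 1)"
    by (subst summable_on_reindex) (auto simp: o_def inj_on_def)
qed

text \<open>Completing the square in |m|: a Gaussian times an exponential of any linear rate is
  dominated by a multiple of exp (- |m|). This one majorant serves both the bilateral series at
  complex arguments and the power series used for holomorphy.\<close>

lemma quadratic_exp_bound:
  fixes s b c m :: real
  assumes "s > 0"
  shows "exp (- s * m\<^sup>2 + b * m + c) \<le> exp (c + (\<bar>b\<bar> + 1)\<^sup>2 / (4 * s)) * exp (- \<bar>m\<bar>)"
proof -
  have "0 \<le> (2 * s * \<bar>m\<bar> - (\<bar>b\<bar> + 1))\<^sup>2 / (4 * s)" using assms by simp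
  also have "\<dots> = s * m\<^sup>2 - (\<bar>b\<bar> + 1) * \<bar>m\<bar> + (\<bar>b\<bar> + 1)\<^sup>2 / (4 * s)"
    using assms by (simp add: power2_eq_square field_simps)
  finally have "- s * m\<^sup>2 + \<bar>b\<bar> * \<bar>m\<bar> \<le> (\<bar>b\<bar> + 1)\<^sup>2 / (4 * s) - \<bar>m\<bar>" by (simp add: algebra_simps)
  moreover have "b * m \<le> \<bar>b\<bar> * \<bar>m\<bar>" by (metis abs_ge_self abs_mult)
  ultimately show ?thesis by (simp flip: exp_add)
qed

lemma abs_summable_th:
  assumes "s > 0"
  shows "(\<lambda>n::int. norm (exp (of_real (- s * (of_int n + e)\<^sup>2) + 2 * \<i> * of_real (of_int n + e) * x))) summable_on UNIV"
proof -
  define b where "b = - 2 * s * e - 2 * Im x"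
  define c where "c = - s * e\<^sup>2 - 2 * e * Im x"
  have n: "norm (exp (of_real (- s * (of_int n + e)\<^sup>2) + 2 * \<i> * of_real (of_int n + e) * x))
     = exp (- s * (of_int n)\<^sup>2 + b * of_int n + c)" for n :: int
    by (simp add: b_def c_def power2_eq_square algebra_simps)
  show ?thesis
    unfolding n
    by (rule summable_on_comparison_test[OF summable_on_cmult_right[OF summable_exp_minus_abs_int]])
       (use quadratic_exp_bound[OF assms] in auto)
qed

lemma th_has_sum:
  assumes "s > 0"
  shows "((\<lambda>n::int. exp (of_real (- s * (of_int n + e)\<^sup>2) + 2 * \<i> * of_real (of_int n + e) * x)) has_sum th e s x) UNIV"
  unfolding th_def
  by (intro has_sum_infsum abs_summable_summable[OF abs_summable_th[OF assms]])

lemma th_eqI: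
  assumes "s > 0" "(g has_sum L) UNIV"
    and "\<And>n::int. g n = exp (of_real (- s * (of_int n + e)\<^sup>2) + 2 * \<i> * of_real (of_int n + e) * x)"
  shows "th e s x = L"
proof -
  have "g = (\<lambda>n. exp (of_real (- s * (of_int n + e)\<^sup>2) + 2 * \<i> * of_real (of_int n + e) * x))"
    using assms(3) by blast
  with assms(2) show ?thesis using has_sum_unique[OF th_has_sum[OF assms(1), of e x]] by simp
qed

section \<open>Translations, reflection, conjugation and products\<close>

lemma has_sum_int_shift:
  fixes f :: "int \<Rightarrow> complex"
  assumes "(f has_sum S) UNIV"
  shows "((\<lambda>n. f (n + c)) has_sum S) UNIV"
  by (rule has_sum_reindex_bij_betw[of "\<lambda>n. n + c" UNIV UNIV f S, THEN iffD2])
     (use assms in \<open>auto intro!: bij_betwI[of _ _ _ "\<lambda>n. n - c"]\<close>)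

lemma th_add_int [simp]: "s > 0 \<Longrightarrow> th (e + 1) s x = th e s x"
  using has_sum_unique[OF has_sum_int_shift[OF th_has_sum[of s e x], of 1] ]
        th_has_sum[of s "e + 1" x] by (simp add: add_ac)

text \<open>Completing the square in the exponent: an imaginary translation by s d is absorbed into
  the characteristic. The case d = 1/2 exchanges the characteristics 0 and 1/2 and yields the
  quasi-periods.\<close>

lemma th_shift:
  assumes "s > 0"
  shows "th e s (x + \<i> * of_real (s * d)) = exp (of_real (s * d\<^sup>2) - 2 * \<i> * of_real d * x) * th (e + d) s x"
proof -
  have "((\<lambda>n::int. exp (of_real (s * d\<^sup>2) - 2 * \<i> * of_real d * x) *
     exp (of_real (- s * (of_int n + (e + d))\<^sup>2) + 2 * \<i> * of_real (of_int n + (e + d)) * x)) has_sum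
      exp (of_real (s * d\<^sup>2) - 2 * \<i> * of_real d * x) * th (e + d) s x) UNIV"
    by (intro has_sum_cmult_right th_has_sum assms)
  moreover have "exp (of_real (s * d\<^sup>2) - 2 * \<i> * of_real d * x) *
     exp (of_real (- s * (of_int n + (e + d))\<^sup>2) + 2 * \<i> * of_real (of_int n + (e + d)) * x)
    = exp (of_real (- s * (of_int n + e)\<^sup>2) + 2 * \<i> * of_real (of_int n + e) * (x + \<i> * of_real (s * d)))" for n :: int
    unfolding exp_add [symmetric]
    by (rule arg_cong[of _ _ exp]) (simp add: power2_eq_square algebra_simps)
  ultimately show ?thesis by (rule th_eqI[OF assms])
qed

lemma th_add_pi:
  assumes "s > 0"
  shows "th e s (x + of_real pi) = exp (2 * \<i> * of_real (pi * e)) * th e s x"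
proof -
  have "((\<lambda>n::int. exp (2 * \<i> * of_real (pi * e)) *
     exp (of_real (- s * (of_int n + e)\<^sup>2) + 2 * \<i> * of_real (of_int n + e) * x)) has_sum
      exp (2 * \<i> * of_real (pi * e)) * th e s x) UNIV"
    by (intro has_sum_cmult_right th_has_sum assms)
  moreover have "exp (2 * \<i> * of_real (pi * e)) *
     exp (of_real (- s * (of_int n + e)\<^sup>2) + 2 * \<i> * of_real (of_int n + e) * x)
    = exp (of_real (- s * (of_int n + e)\<^sup>2) + 2 * \<i> * of_real (of_int n + e) * (x + of_real pi))" for n :: int
  proof -
    have "exp (of_real (- s * (of_int n + e)\<^sup>2) + 2 * \<i> * of_real (of_int n + e) * (x + of_real pi))
      = exp (2 * \<i> * of_real (pi * e) + (of_real (- s * (of_int n + e)\<^sup>2) + 2 * \<i> * of_real (of_int n + e) * x) + 2 * of_int n * of_real pi * \<i>)"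
      by (rule arg_cong[of _ _ exp]) (simp add: power2_eq_square algebra_simps)
    also have "\<dots> = exp (2 * \<i> * of_real (pi * e) + (of_real (- s * (of_int n + e)\<^sup>2) + 2 * \<i> * of_real (of_int n + e) * x))"
      using exp_integer_2pi[of "of_int n"] by (simp add: exp_add)
    finally show ?thesis by (simp only: exp_add)
  qed
  ultimately show ?thesis by (rule th_eqI[OF assms])
qed

lemma th_minus:
  assumes "s > 0"
  shows "th e s (- x) = th (- e) s x"
proof -
  have "bij_betw (uminus :: int \<Rightarrow> int) UNIV UNIV" by (auto intro!: bij_betwI[of _ _ _ uminus])
  from has_sum_reindex_bij_betw[OF this, THEN iffD2, OF th_has_sum[OF assms, of "-e" x]]
  have "((\<lambda>n::int. exp (of_real (- s * (of_int (-n) + -e)\<^sup>2) + 2 * \<i> * of_real (of_int (-n) + -e) * x)) has_sum th (-e) s x) UNIV" .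
  moreover have "exp (of_real (- s * (of_int (-n) + -e)\<^sup>2) + 2 * \<i> * of_real (of_int (-n) + -e) * x) =
     exp (of_real (- s * (of_int n + e)\<^sup>2) + 2 * \<i> * of_real (of_int n + e) * - x)" for n
    by (rule arg_cong[of _ _ exp]) (simp add: power2_eq_square algebra_simps)
  ultimately show ?thesis by (rule th_eqI[OF assms])
qed

lemma th_cnj:
  assumes "s > 0"
  shows "th e s (cnj x) = cnj (th e s (- x))"
proof -
  have "((\<lambda>n::int. cnj (exp (of_real (- s * (of_int n + e)\<^sup>2) + 2 * \<i> * of_real (of_int n + e) * - x))) has_sum cnj (th e s (-x))) UNIV"
    using th_has_sum[OF assms, of e "-x"] by (simp only: has_sum_cnj_iff)
  moreover have "cnj (exp (of_real (- s * (of_int n + e)\<^sup>2) + 2 * \<i> * of_real (of_int n + e) * - x))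
    = exp (of_real (- s * (of_int n + e)\<^sup>2) + 2 * \<i> * of_real (of_int n + e) * cnj x)" for n
    by (simp add: exp_cnj)
  ultimately show ?thesis by (rule th_eqI[OF assms])
qed

text \<open>Split the double sum over \<open>(m, n)\<close> by the parity of \<open>m - n\<close>, substituting \<open>(p + r, p - r)\<close> or
  \<open>(p + r + 1, p - r)\<close>.\<close>

lemma th_Watson:
  assumes "s > 0"
  shows "th e s x * th d s y =
     th ((e + d) / 2) (2 * s) (x + y) * th ((e - d) / 2) (2 * s) (x - y) +
     th ((e + d + 1) / 2) (2 * s) (x + y) * th ((e - d + 1) / 2) (2 * s) (x - y)"
proof -
  define t where "t = (\<lambda>e s x (n::int). exp (of_real (- s * (of_int n + e)\<^sup>2) + 2 * \<i> * of_real (of_int n + e) * x))"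
  have hs: "(t e s x has_sum th e s x) UNIV" if "s > 0" for e s x
    using th_has_sum[OF that] by (simp add: t_def)
  have ab: "(\<lambda>n. norm (t e s x n)) summable_on UNIV" if "s > 0" for e s x
    using abs_summable_th[OF that] by (simp add: t_def)
  have prod: "((\<lambda>(m, n). t e s x m * t d s y n) has_sum th e s x * th d s y) (UNIV \<times> UNIV)"
    if "s > 0" for e d s x y
  proof -
    have 1: "(\<lambda>n. norm (t e s x m * t d s y n)) summable_on UNIV" for m
      using summable_on_cmult_right[OF ab[OF that, of d y], of "norm (t e s x m)"] by (simp add: norm_mult)
    have 2: "(\<lambda>m. norm (infsum (\<lambda>n. norm (t e s x m * t d s y n)) UNIV)) summable_on UNIV"
      using summable_on_cmult_left[OF ab[OF that, of e x], of "norm (infsum (\<lambda>n. norm (t d s y n)) UNIV)"]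
      by (simp add: norm_mult infsum_cmult_right' abs_mult)
    have "(\<lambda>p. norm (case p of (m, n) \<Rightarrow> t e s x m * t d s y n)) summable_on (UNIV \<times> UNIV)"
      using Infinite_Sum.abs_summable_on_Sigma_iff[of "\<lambda>(m, n). t e s x m * t d s y n" UNIV "\<lambda>_. UNIV"] 1 2
      by (simp del: UNIV_Times_UNIV)
    then have 3: "(\<lambda>(m, n). t e s x m * t d s y n) summable_on (UNIV \<times> UNIV)"
      by (rule abs_summable_summable)
    show ?thesis
      by (rule has_sum_SigmaI[where g = "\<lambda>m. t e s x m * th d s y"])
         (use hs[OF that] 3 in \<open>auto intro!: has_sum_cmult_right has_sum_cmult_left\<close>)
  qed
  define E where "E = (\<lambda>(p::int, r::int). (p + r, p - r))"
  define O' where "O' = (\<lambda>(p::int, r::int). (p + r + 1, p - r))"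
  have rE: "range E = {(m, n). even (m - n)}"
  proof -
    have "(m, n) \<in> range E" if "even (m - n)" for m n
      by (rule image_eqI[of _ _ "((m + n) div 2, (m - n) div 2)"])
         (use that in \<open>auto simp: E_def elim!: evenE\<close>, presburger+)
    then show ?thesis by (auto simp: E_def)
  qed
  have rO: "range O' = {(m, n). odd (m - n)}"
  proof -
    have "(m, n) \<in> range O'" if "odd (m - n)" for m n
      by (rule image_eqI[of _ _ "((m + n) div 2, (m - n) div 2)"])
         (use that in \<open>auto simp: O'_def\<close>, presburger+)
    then show ?thesis by (auto simp: O'_def)
  qed
  have inj: "inj E" "inj O'" by (auto simp: inj_def E_def O'_def)
  have s2: "2 * s > 0" using assms by simp
  have "((\<lambda>(m, n). t e s x m * t d s y n) \<circ> E has_sum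
       th ((e + d) / 2) (2 * s) (x + y) * th ((e - d) / 2) (2 * s) (x - y)) UNIV"
  proof -
    have "((\<lambda>(m, n). t e s x m * t d s y n) \<circ> E) =
       (\<lambda>(p, r). t ((e + d) / 2) (2 * s) (x + y) p * t ((e - d) / 2) (2 * s) (x - y) r)"
      by (auto simp: fun_eq_iff E_def t_def simp flip: exp_add intro!: arg_cong[of _ _ exp])
         (simp add: power2_eq_square field_simps)
    then show ?thesis using prod[OF s2] by simp
  qed
  then have 1: "((\<lambda>(m, n). t e s x m * t d s y n) has_sum
       th ((e + d) / 2) (2 * s) (x + y) * th ((e - d) / 2) (2 * s) (x - y)) (range E)"
    by (subst has_sum_reindex) (use inj in auto)
  have "((\<lambda>(m, n). t e s x m * t d s y n) \<circ> O' has_sum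
       th ((e + d + 1) / 2) (2 * s) (x + y) * th ((e - d + 1) / 2) (2 * s) (x - y)) UNIV"
  proof -
    have "((\<lambda>(m, n). t e s x m * t d s y n) \<circ> O') =
       (\<lambda>(p, r). t ((e + d + 1) / 2) (2 * s) (x + y) p * t ((e - d + 1) / 2) (2 * s) (x - y) r)"
      by (auto simp: fun_eq_iff O'_def t_def simp flip: exp_add intro!: arg_cong[of _ _ exp])
         (simp add: power2_eq_square field_simps)
    then show ?thesis using prod[OF s2] by simp
  qed
  then have 2: "((\<lambda>(m, n). t e s x m * t d s y n) has_sum
       th ((e + d + 1) / 2) (2 * s) (x + y) * th ((e - d + 1) / 2) (2 * s) (x - y)) (range O')"
    by (subst has_sum_reindex) (use inj in auto)
  have "range E \<union> range O' = UNIV \<times> UNIV" unfolding rE rO by auto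
  moreover have "range E \<inter> range O' = {}" unfolding rE rO by auto
  ultimately show ?thesis
    using has_sum_Un_disjoint[OF 1 2] has_sum_unique[OF prod[OF assms]] by metis
qed

section \<open>Holomorphy in the argument\<close>

lemma has_sum_int_split:
  fixes f :: "int \<Rightarrow> complex"
  assumes "(f has_sum S) UNIV"
  obtains A B where "(\<lambda>n. f (int n)) sums A" "(\<lambda>n. f (- int n - 1)) sums B" "S = A + B"
proof -
  have su: "f summable_on X" for X
    using assms summable_on_subset_banach[of f UNIV X] by (auto simp: summable_on_def)
  define A where "A = infsum f (range int)"
  define B where "B = infsum f (range (\<lambda>n. - int n - 1))"
  have A: "(f has_sum A) (range int)" and B: "(f has_sum B) (range (\<lambda>n. - int n - 1))"
    using su has_sum_infsum by (auto simp: A_def B_def)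
  have "(f has_sum (A + B)) (range int \<union> range (\<lambda>n. - int n - 1))"
    by (rule has_sum_Un_disjoint[OF A B]) auto
  then have "S = A + B" using assms has_sum_unique unfolding int_UNIV_split by blast
  moreover have "(\<lambda>n. f (int n)) sums A"
    using A by (subst (asm) has_sum_reindex) (auto simp: o_def intro: has_sum_imp_sums)
  moreover have "(\<lambda>n. f (- int n - 1)) sums B"
    using B by (subst (asm) has_sum_reindex) (auto simp: o_def inj_on_def intro: has_sum_imp_sums)
  ultimately show ?thesis using that by blast
qed

lemma gauss_power_series_entire:
  fixes s :: real
  assumes "s > 0"
  obtains P where "P holomorphic_on UNIV"
    and "\<And>w. (\<lambda>n. of_real (exp (- s * (real n)\<^sup>2)) * w ^ n) sums P (w :: complex)"
proof -
  have su: "summable (\<lambda>n. of_real (exp (- s * (real n)\<^sup>2)) * w ^ n)" for w :: complex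
  proof (cases "w = 0")
    case True
    then show ?thesis by (auto intro!: summable_finite[of "{0}"])
  next
    case False
    define b where "b = ln (norm w)"
    have w: "norm w = exp b" using False by (simp add: b_def)
    have g: "summable (\<lambda>n. exp (0 + (\<bar>b\<bar> + 1)\<^sup>2 / (4 * s)) * exp (-1) ^ n)"
      by (intro summable_mult summable_geometric) auto
    show ?thesis
    proof (rule summable_comparison_test'[OF g])
      fix n :: nat
      have "norm (of_real (exp (- s * (real n)\<^sup>2)) * w ^ n) = exp (- s * (real n)\<^sup>2 + b * real n + 0)"
        by (simp add: norm_mult norm_power w mult_ac flip: exp_of_nat_mult exp_add)
      also have "\<dots> \<le> exp (0 + (\<bar>b\<bar> + 1)\<^sup>2 / (4 * s)) * exp (- \<bar>real n\<bar>)"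
        by (rule quadratic_exp_bound[OF assms])
      finally show "norm (of_real (exp (- s * (real n)\<^sup>2)) * w ^ n) \<le> exp (0 + (\<bar>b\<bar> + 1)\<^sup>2 / (4 * s)) * exp (-1) ^ n"
        by (simp flip: exp_of_nat_mult)
    qed
  qed
  define P where "P w = (\<Sum>n. of_real (exp (- s * (real n)\<^sup>2)) * w ^ n)" for w :: complex
  have P: "(\<lambda>n. of_real (exp (- s * (real n)\<^sup>2)) * w ^ n) sums P w" for w
    using su by (auto simp: P_def intro: summable_sums)
  have "P holomorphic_on ball 0 r" for r
    by (rule power_series_holomorphic[of _ _ "\<lambda>n. of_real (exp (- s * (real n)\<^sup>2))"]) (use P in auto)
  then have "P field_differentiable (at w)" for w
    by (rule holomorphic_on_imp_differentiable_at[of _ "ball 0 (norm w + 1)"]) auto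
  then have "P holomorphic_on UNIV" by (simp add: holomorphic_on_def field_differentiable_at_within)
  then show ?thesis using that P by blast
qed

text \<open>With c the term of index 0 and w = exp (2 i x - 2 s e), the term of index n is c exp (-
  s n^2) w^n. The nonnegative indices give c P(w) and the negative ones c (P(1/w) - 1), where
  subtracting 1 avoids counting index 0 twice. Holomorphy is thus that of a composition with an
  entire power series.\<close>

lemma th_holomorphic:
  assumes "s > 0"
  shows "th e s holomorphic_on UNIV"
proof -
  obtain P where P: "P holomorphic_on UNIV"
    and Ps: "\<And>w. (\<lambda>n. of_real (exp (- s * (real n)\<^sup>2)) * w ^ n) sums P (w :: complex)"
    using gauss_power_series_entire[OF assms] by metis
  define w where "w = (\<lambda>x. exp (2 * \<i> * x - of_real (2 * s * e)))"
  define c where "c = (\<lambda>x. exp (2 * \<i> * of_real e * x - of_real (s * e\<^sup>2)))"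
  have eq: "th e s x = c x * (P (w x) + (P (inverse (w x)) - 1))" for x
  proof -
    define f where "f = (\<lambda>n::int. exp (of_real (- s * (of_int n + e)\<^sup>2) + 2 * \<i> * of_real (of_int n + e) * x))"
    have "(f has_sum th e s x) UNIV" using th_has_sum[OF assms] by (simp add: f_def)
    then obtain A B where A: "(\<lambda>n. f (int n)) sums A" and B: "(\<lambda>n. f (- int n - 1)) sums B"
      and AB: "th e s x = A + B"
      by (rule has_sum_int_split)
    have "(\<lambda>n. c x * (of_real (exp (- s * (real n)\<^sup>2)) * w x ^ n)) sums (c x * P (w x))"
      by (intro sums_mult Ps)
    moreover have "c x * (of_real (exp (- s * (real n)\<^sup>2)) * w x ^ n) = f (int n)" for n
      by (simp add: c_def w_def f_def exp_of_real [symmetric] flip: exp_of_nat_mult exp_add)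
         (simp add: power2_eq_square algebra_simps)
    ultimately have "A = c x * P (w x)" using A sums_unique2 by fastforce
    moreover have "(\<lambda>n. c x * (of_real (exp (- s * (real (Suc n))\<^sup>2)) * inverse (w x) ^ Suc n)) sums (c x * (P (inverse (w x)) - 1))"
      using Ps[of "inverse (w x)"] by (intro sums_mult) (subst sums_Suc_iff, simp)
    moreover have "c x * (of_real (exp (- s * (real (Suc n))\<^sup>2)) * inverse (w x) ^ Suc n) = f (- int n - 1)" for n
      by (simp only: c_def w_def f_def exp_of_real [symmetric] exp_minus [symmetric] exp_of_nat_mult [symmetric] exp_add [symmetric])
         (rule arg_cong[of _ _ exp], simp add: power2_eq_square algebra_simps)
    ultimately have "A = c x * P (w x)" "B = c x * (P (inverse (w x)) - 1)" using B sums_unique2 by fastforce+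
    then show ?thesis using AB by (simp add: algebra_simps)
  qed
  have w0: "w x \<noteq> 0" for x by (simp add: w_def)
  have "(\<lambda>x. c x * (P (w x) + (P (inverse (w x)) - 1))) holomorphic_on UNIV"
    unfolding c_def
    by (intro holomorphic_intros holomorphic_on_compose_gen[OF _ P, unfolded o_def] )
       (auto simp: w_def intro!: holomorphic_intros)
  then show ?thesis unfolding eq[abs_def] .
qed

text \<open>\<open>th1\<close> and \<open>th4\<close> are half-period translates of
  \<open>th2\<close> and \<open>th3\<close>, so that conjugation, quasi-periods and most product
  formulas are proved for the latter two and transported.\<close>

definition th1 :: "real \<Rightarrow> complex \<Rightarrow> complex" where "th1 s x = th (1/2) s (x - of_real (pi / 2))"
definition th2 :: "real \<Rightarrow> complex \<Rightarrow> complex" where "th2 s x = th (1/2) s x"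
definition th3 :: "real \<Rightarrow> complex \<Rightarrow> complex" where "th3 s x = th 0 s x"
definition th4 :: "real \<Rightarrow> complex \<Rightarrow> complex" where "th4 s x = th 0 s (x + of_real (pi / 2))"

text \<open>The indices n and - n - 1 have the same Gaussian factor and opposite exponentials, so
  each pair is one cosine term of the defining series.\<close>

lemma th_sums_pairs_half:
  assumes "s > 0"
  shows "(\<lambda>j. of_real (exp (- s) powr ((real j + 1/2)\<^sup>2)) * (2 * cos (of_nat (2*j+1) * x))) sums th2 s x"
proof -
  define f where "f = (\<lambda>n::int. exp (of_real (- s * (of_int n + 1/2)\<^sup>2) + 2 * \<i> * of_real (of_int n + 1/2) * x))"
  have "(f has_sum th2 s x) UNIV" using th_has_sum[OF assms, of "1/2" x] by (simp add: f_def th2_def)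
  then obtain A B where A: "(\<lambda>n. f (int n)) sums A" and B: "(\<lambda>n. f (- int n - 1)) sums B"
    and AB: "th2 s x = A + B"
    by (rule has_sum_int_split)
  have "f (int n) + f (- int n - 1) = of_real (exp (- s) powr ((real n + 1/2)\<^sup>2)) * (2 * cos (of_nat (2*n+1) * x))" for n
  proof -
    have "of_real (exp (- s) powr ((real n + 1/2)\<^sup>2)) = exp (of_real (- s * (real n + 1/2)\<^sup>2) :: complex)"
      by (simp add: powr_def exp_of_real [symmetric] mult_ac)
    moreover have "f (int n) = exp (of_real (- s * (real n + 1/2)\<^sup>2)) * exp (\<i> * (of_nat (2*n+1) * x))"
      unfolding f_def exp_add [symmetric] by (rule arg_cong[of _ _ exp]) (simp add: field_simps)
    moreover have "f (- int n - 1) = exp (of_real (- s * (real n + 1/2)\<^sup>2)) * exp (- (\<i> * (of_nat (2*n+1) * x)))"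
      unfolding f_def exp_add [symmetric] by (rule arg_cong[of _ _ exp]) (simp add: power2_eq_square field_simps)
    ultimately show ?thesis by (simp add: cos_exp_eq algebra_simps)
  qed
  then show ?thesis using sums_add[OF A B] AB by simp
qed

text \<open>Here n + 1 is paired with - n - 1; the unpaired index 0 is the constant 1 on the
  right.\<close>

lemma th_sums_pairs_int:
  assumes "s > 0"
  shows "(\<lambda>j. of_real (exp (- s) ^ ((j+1)\<^sup>2)) * (2 * cos (of_nat (2*(j+1)) * x))) sums (th3 s x - 1)"
proof -
  define f where "f = (\<lambda>n::int. exp (of_real (- s * (of_int n + 0)\<^sup>2) + 2 * \<i> * of_real (of_int n + 0) * x))"
  have "(f has_sum th3 s x) UNIV" using th_has_sum[OF assms, of 0 x] by (simp add: f_def th3_def)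
  then obtain A B where A: "(\<lambda>n. f (int n)) sums A" and B: "(\<lambda>n. f (- int n - 1)) sums B"
    and AB: "th3 s x = A + B"
    by (rule has_sum_int_split)
  have A': "(\<lambda>n. f (int (Suc n))) sums (A - 1)"
    using A by (subst sums_Suc_iff[of "\<lambda>n. f (int n)"]) (simp add: f_def)
  have "f (int (Suc n)) + f (- int n - 1) = of_real (exp (- s) ^ ((n+1)\<^sup>2)) * (2 * cos (of_nat (2*(n+1)) * x))" for n
  proof -
    have "of_real (exp (- s) ^ ((n+1)\<^sup>2)) = exp (of_real (- s * (real n + 1)\<^sup>2) :: complex)"
      by (simp add: exp_of_real [symmetric] add_ac mult_ac flip: exp_of_nat_mult)
    moreover have "f (int (Suc n)) = exp (of_real (- s * (real n + 1)\<^sup>2)) * exp (\<i> * (of_nat (2*(n+1)) * x))"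
      unfolding f_def exp_add [symmetric] by (rule arg_cong[of _ _ exp]) (simp add: field_simps)
    moreover have "f (- int n - 1) = exp (of_real (- s * (real n + 1)\<^sup>2)) * exp (- (\<i> * (of_nat (2*(n+1)) * x)))"
      unfolding f_def exp_add [symmetric] by (rule arg_cong[of _ _ exp]) (simp add: power2_eq_square field_simps)
    ultimately show ?thesis by (simp add: cos_exp_eq algebra_simps)
  qed
  then show ?thesis using sums_add[OF A' B] AB by (simp add: algebra_simps)
qed

lemma theta2_eq_th2: "s > 0 \<Longrightarrow> theta2 (x::complex) (exp (- s)) = th2 s x"
  using th_sums_pairs_half[of s x, THEN sums_mult, of "1/2"]
  by (simp add: theta2_def sums_iff algebra_simps)

lemma theta3_eq_th3: "s > 0 \<Longrightarrow> theta3 (x::complex) (exp (- s)) = th3 s x"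
  using th_sums_pairs_int[of s x, THEN sums_mult, of "1/2"]
  by (simp add: theta3_def sums_iff algebra_simps)

lemma cos_odd_mult_minus_pi_half: "cos (of_nat (2*j+1) * (x - of_real (pi/2))) = (-1) ^ j * sin (of_nat (2*j+1) * (x::complex))"
proof (induction j arbitrary: x)
  case 0
  then show ?case by (simp add: cos_diff cos_of_real sin_of_real flip: of_real_divide)
next
  case (Suc j)
  have e: "of_nat (2*Suc j+1) * (x - of_real (pi/2)) = (of_nat (2*Suc j+1) * x - of_real pi) - of_nat (2*j+1) * of_real (pi/2)" 
    by (simp add: algebra_simps)
  \<comment> \<open>The induction hypothesis has the same multiplier 2 j + 1 on the argument and on
    pi/2. It is therefore applied to a rescaled argument with (2 j + 1) a = (2 j + 3) x, and the
    remaining pi flips the sign.\<close>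
  define a where "a = (of_nat (2*Suc j+1) * x / of_nat (2*j+1))"
  have "of_nat (2*j+1) * a = of_nat (2*Suc j+1) * x"
    by (simp add: a_def del: of_nat_add of_nat_Suc of_nat_mult)
  then have "cos (of_nat (2*Suc j+1) * (x - of_real (pi/2))) = cos (of_nat (2*j+1) * (a - of_real (pi/2)) - of_real pi)"
    unfolding e by (simp add: algebra_simps)
  also have "\<dots> = - cos (of_nat (2*j+1) * (a - of_real (pi/2)))"
    by (simp add: cos_diff)
  also have "\<dots> = - ((-1) ^ j * sin (of_nat (2*j+1) * a))" using Suc.IH by simp
  finally show ?case using \<open>of_nat (2*j+1) * a = of_nat (2*Suc j+1) * x\<close> by simp
qed

lemma cos_even_mult_plus_pi_half: "cos (of_nat (2*j) * (x + of_real (pi/2))) = (-1) ^ j * cos (of_nat (2*j) * (x::complex))"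
proof -
  have "cos (of_nat (2*j) * (x + of_real (pi/2))) = cos (of_nat (2*j) * x + of_real (real j * pi))"
    by (rule arg_cong[of _ _ cos]) (simp add: algebra_simps)
  also have "\<dots> = cos (of_nat (2*j) * x) * of_real (cos (real j * pi)) - sin (of_nat (2*j) * x) * of_real (sin (real j * pi))"
    by (simp only: cos_add cos_of_real sin_of_real)
  also have "\<dots> = (-1) ^ j * cos (of_nat (2*j) * x)" by (simp add: cos_npi sin_npi)
  finally show ?thesis .
qed

lemma theta1_eq_th1: "s > 0 \<Longrightarrow> theta1 (x::complex) (exp (- s)) = th1 s x"
  using th_sums_pairs_half[of s "x - of_real (pi/2)", THEN sums_mult, of "1/2"]
  unfolding cos_odd_mult_minus_pi_half th2_def th1_def[symmetric]
  by (simp add: theta1_def sums_iff algebra_simps)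

lemma theta4_eq_th4: "s > 0 \<Longrightarrow> theta4 (x::complex) (exp (- s)) = th4 s x"
  using th_sums_pairs_int[of s "x + of_real (pi/2)", THEN sums_mult, of "1/2"]
  unfolding cos_even_mult_plus_pi_half th3_def th4_def[symmetric]
  by (simp add: theta4_def sums_iff algebra_simps)

section \<open>Half-period translations, parity and product formulas\<close>

lemma th_zero_half_shift: "s > 0 \<Longrightarrow> th 1 s = th 0 s" "s > 0 \<Longrightarrow> th (-1/2) s = th (1/2) s"
  using th_add_int[of s 0] th_add_int[of s "-1/2"] by (auto simp: fun_eq_iff)

lemma th2_add_pi: "s > 0 \<Longrightarrow> th2 s (x + of_real pi) = - th2 s x"
  using th_add_pi[of s "1/2" x] by (simp add: th2_def)

lemma th3_add_pi: "s > 0 \<Longrightarrow> th3 s (x + of_real pi) = th3 s x"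
  using th_add_pi[of s 0 x] by (simp add: th3_def)

lemma half_pi_twice: "x + complex_of_real pi / 2 + complex_of_real pi / 2 = x + complex_of_real pi"
  by (simp add: add.assoc)

lemma th1_eq: "th1 s x = th2 s (x - of_real (pi / 2))" and th4_eq: "th4 s x = th3 s (x + of_real (pi / 2))"
  by (simp_all add: th1_def th2_def th3_def th4_def)

lemma th1_add_half_pi: "th1 s (x + of_real (pi / 2)) = th2 s x"
  by (simp add: th1_eq)

lemma th2_add_half_pi: "s > 0 \<Longrightarrow> th2 s (x + of_real (pi / 2)) = - th1 s x"
  using th2_add_pi[of s "x - of_real (pi / 2)"] by (simp add: th1_eq field_simps)

lemma th3_add_half_pi: "th3 s (x + of_real (pi / 2)) = th4 s x"
  by (simp add: th4_eq)

lemma th4_add_half_pi: "s > 0 \<Longrightarrow> th4 s (x + of_real (pi / 2)) = th3 s x"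
  using th3_add_pi[of s x] by (simp add: th4_eq half_pi_twice)

lemma th3_diff_half_pi: "s > 0 \<Longrightarrow> th3 s (x - of_real (pi / 2)) = th4 s x"
  using th4_add_half_pi[of s "x - of_real (pi / 2)"] by simp

lemma th2_minus: "s > 0 \<Longrightarrow> th2 s (- x) = th2 s x" and th3_minus: "s > 0 \<Longrightarrow> th3 s (- x) = th3 s x"
  using th_minus[of s] th_zero_half_shift by (simp_all add: th2_def th3_def)

lemma th1_minus: "s > 0 \<Longrightarrow> th1 s (- x) = - th1 s x"
  using th2_minus[of s "x + of_real (pi / 2)"] th2_add_half_pi[of s x] by (simp add: th1_eq)

lemma th4_minus: "s > 0 \<Longrightarrow> th4 s (- x) = th4 s x"
  using th3_minus[of s "x - of_real (pi / 2)"] th3_diff_half_pi[of s x] by (simp add: th4_eq)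

lemma th1_0: "s > 0 \<Longrightarrow> th1 s 0 = 0"
  using th1_minus[of s 0] by simp

lemma th_i_cnj:
  assumes "s > 0"
  shows "th1 s (cnj x) = cnj (th1 s x)" "th2 s (cnj x) = cnj (th2 s x)"
    "th3 s (cnj x) = cnj (th3 s x)" "th4 s (cnj x) = cnj (th4 s x)"
proof -
  show 2: "th2 s (cnj x) = cnj (th2 s x)" for x
    using th_cnj[OF assms, of "1/2" x] th2_minus[OF assms, of x] by (simp add: th2_def)
  show 3: "th3 s (cnj x) = cnj (th3 s x)" for x
    using th_cnj[OF assms, of 0 x] th3_minus[OF assms, of x] by (simp add: th3_def)
  show "th1 s (cnj x) = cnj (th1 s x)"
    using 2[of "x - of_real (pi / 2)"] by (simp add: th1_eq)
  show "th4 s (cnj x) = cnj (th4 s x)"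
    using 3[of "x + of_real (pi / 2)"] by (simp add: th4_eq)
qed

text \<open>For the nome exp (i pi tau) one has pi tau = i s, so this is the translation by the
  imaginary half-period pi tau / 2.\<close>

lemma th_quasi_period:
  assumes "s > 0"
  shows "th1 s (x + \<i> * of_real (s / 2)) = \<i> * exp (of_real (s / 4) - \<i> * x) * th4 s x"
    "th2 s (x + \<i> * of_real (s / 2)) = exp (of_real (s / 4) - \<i> * x) * th3 s x"
    "th3 s (x + \<i> * of_real (s / 2)) = exp (of_real (s / 4) - \<i> * x) * th2 s x"
    "th4 s (x + \<i> * of_real (s / 2)) = \<i> * exp (of_real (s / 4) - \<i> * x) * th1 s x"
proof -
  show 2: "th2 s (x + \<i> * of_real (s / 2)) = exp (of_real (s / 4) - \<i> * x) * th3 s x" for x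
    using th_shift[OF assms, of "1/2" x "1/2"] th_zero_half_shift[OF assms]
    by (simp add: th2_def th3_def power2_eq_square)
  show 3: "th3 s (x + \<i> * of_real (s / 2)) = exp (of_real (s / 4) - \<i> * x) * th2 s x" for x
    using th_shift[OF assms, of 0 x "1/2"] by (simp add: th2_def th3_def power2_eq_square)
  have e: "exp (\<i> * of_real (pi / 2)) = \<i>" by (simp add: exp_eq_polar cis_pi_half flip: cis_conv_exp)
  have e': "exp (- (\<i> * of_real (pi / 2))) = - \<i>" using e by (simp only: exp_minus) simp
  show "th1 s (x + \<i> * of_real (s / 2)) = \<i> * exp (of_real (s / 4) - \<i> * x) * th4 s x"
  proof -
    have "th1 s (x + \<i> * of_real (s / 2)) = exp ((of_real (s / 4) - \<i> * x) + \<i> * of_real (pi / 2)) * th4 s x"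
      using 2[of "x - of_real (pi / 2)"] th3_diff_half_pi[OF assms, of x] by (simp add: th1_eq algebra_simps)
    then show ?thesis unfolding exp_add e by simp
  qed
  show "th4 s (x + \<i> * of_real (s / 2)) = \<i> * exp (of_real (s / 4) - \<i> * x) * th1 s x"
  proof -
    have "th4 s (x + \<i> * of_real (s / 2)) = exp ((of_real (s / 4) - \<i> * x) + - (\<i> * of_real (pi / 2))) * (- th1 s x)"
      using 3[of "x + of_real (pi / 2)"] th2_add_half_pi[OF assms, of x] by (simp add: th4_eq algebra_simps)
    then show ?thesis unfolding exp_add e' by simp
  qed
qed

text \<open>All cases of \<open>th_Watson\<close>: for characteristics in {0, 1/2} the averaged ones
  are again 0 or 1/2 modulo 1. Products at the nome q thus become bilinear expressions at q^2, which
  reduces later identities to plain algebra.\<close>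

lemma th_products:
  assumes "s > 0"
  shows "th1 s x * th1 s y = th3 (2 * s) (x + y) * th2 (2 * s) (x - y) - th2 (2 * s) (x + y) * th3 (2 * s) (x - y)"
    "th2 s x * th2 s y = th3 (2 * s) (x + y) * th2 (2 * s) (x - y) + th2 (2 * s) (x + y) * th3 (2 * s) (x - y)"
    "th3 s x * th3 s y = th3 (2 * s) (x + y) * th3 (2 * s) (x - y) + th2 (2 * s) (x + y) * th2 (2 * s) (x - y)"
    "th4 s x * th4 s y = th3 (2 * s) (x + y) * th3 (2 * s) (x - y) - th2 (2 * s) (x + y) * th2 (2 * s) (x - y)"
    "th2 s x * th1 s y = th1 (2 * s) (x + y) * th4 (2 * s) (x - y) - th4 (2 * s) (x + y) * th1 (2 * s) (x - y)"
    "th3 s x * th4 s y = th4 (2 * s) (x + y) * th4 (2 * s) (x - y) - th1 (2 * s) (x + y) * th1 (2 * s) (x - y)"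
proof -
  have s2: "2 * s > 0" using assms by simp
  show 2: "th2 s x * th2 s y = th3 (2 * s) (x + y) * th2 (2 * s) (x - y) + th2 (2 * s) (x + y) * th3 (2 * s) (x - y)" for x y
    using th_Watson[OF assms, of "1/2" x "1/2" y] th_zero_half_shift[OF s2]
    by (simp add: th2_def th3_def)
  show 3: "th3 s x * th3 s y = th3 (2 * s) (x + y) * th3 (2 * s) (x - y) + th2 (2 * s) (x + y) * th2 (2 * s) (x - y)" for x y
    using th_Watson[OF assms, of 0 x 0 y] by (simp add: th2_def th3_def)
  have per2: "th2 (2 * s) (x - of_real pi) = - th2 (2 * s) x" and per3: "th3 (2 * s) (x - of_real pi) = th3 (2 * s) x" for x
    using th2_add_pi[OF s2, of "x - of_real pi"] th3_add_pi[OF s2, of "x - of_real pi"] by simp_all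
  have e: "x - of_real (pi/2) + (y - of_real (pi/2)) = x + y - of_real pi"
    "x + of_real (pi/2) + (y + of_real (pi/2)) = x + y + of_real pi" by (simp_all add: field_simps)
  show "th1 s x * th1 s y = th3 (2 * s) (x + y) * th2 (2 * s) (x - y) - th2 (2 * s) (x + y) * th3 (2 * s) (x - y)"
    using 2[of "x - of_real (pi/2)" "y - of_real (pi/2)"] unfolding e per2 per3 by (simp add: th1_eq)
  show "th4 s x * th4 s y = th3 (2 * s) (x + y) * th3 (2 * s) (x - y) - th2 (2 * s) (x + y) * th2 (2 * s) (x - y)"
    using 3[of "x + of_real (pi/2)" "y + of_real (pi/2)"] unfolding e th2_add_pi[OF s2] th3_add_pi[OF s2] by (simp add: th4_eq)
  have e1: "x + (y - of_real (pi/2)) = (x + y) - of_real (pi/2)" "x - (y - of_real (pi/2)) = (x - y) + of_real (pi/2)"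
    "x + (y + of_real (pi/2)) = (x + y) + of_real (pi/2)" "x - (y + of_real (pi/2)) = (x - y) - of_real (pi/2)"
    by simp_all
  show "th2 s x * th1 s y = th1 (2 * s) (x + y) * th4 (2 * s) (x - y) - th4 (2 * s) (x + y) * th1 (2 * s) (x - y)"
    using 2[of x "y - of_real (pi/2)"] unfolding e1 th3_add_half_pi th2_add_half_pi[OF s2] th3_diff_half_pi[OF s2]
      th1_eq[symmetric] by simp
  show "th3 s x * th4 s y = th4 (2 * s) (x + y) * th4 (2 * s) (x - y) - th1 (2 * s) (x + y) * th1 (2 * s) (x - y)"
    using 3[of x "y + of_real (pi/2)"] unfolding e1 th3_add_half_pi th2_add_half_pi[OF s2] th3_diff_half_pi[OF s2]
      th1_eq[symmetric] th4_eq[symmetric] by simp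
qed

section \<open>Zeros of the theta functions\<close>

text \<open>Every term of the series is a positive real number on the imaginary axis, so the term of
  index 0 is a lower bound.\<close>

lemma th_imaginary_pos:
  assumes "s > 0"
  shows "0 < Re (th e s (\<i> * of_real t))" "Im (th e s (\<i> * of_real t)) = 0"
proof -
  define f where "f n = exp (- s * (real_of_int n + e)\<^sup>2 - 2 * (real_of_int n + e) * t)" for n
  have f: "exp (of_real (- s * (of_int n + e)\<^sup>2) + 2 * \<i> * of_real (of_int n + e) * (\<i> * of_real t)) = complex_of_real (f n)" for n
    unfolding f_def exp_of_real [symmetric] by (rule arg_cong[of _ _ exp]) (simp add: algebra_simps)
  have hs: "((\<lambda>n. complex_of_real (f n)) has_sum th e s (\<i> * of_real t)) UNIV"
    using th_has_sum[OF assms, of e "\<i> * of_real t"] unfolding f .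
  have "((\<lambda>n. f n) has_sum Re (th e s (\<i> * of_real t))) UNIV"
    using has_sum_Re[OF hs] by simp
  from finite_sum_le_has_sum[OF this, of "{0}"] have "f 0 \<le> Re (th e s (\<i> * of_real t))"
    by (simp add: f_def)
  then show "0 < Re (th e s (\<i> * of_real t))" by (smt (verit) f_def exp_gt_zero)
  have "((\<lambda>n. 0) has_sum Im (th e s (\<i> * of_real t))) (UNIV :: int set)"
    using has_sum_Im[OF hs] by simp
  then show "Im (th e s (\<i> * of_real t)) = 0" by (metis has_sum_0 has_sum_unique)
qed

text \<open>For a small nome the constant term 1 dominates: since s (j + 1)^2 >= s (j + 1), the rest
  is bounded by a geometric series of sum 2 r / (1 - r). The threshold 2 comes from exp t >= 1 + t,
  which gives r < 1/3 and hence a sum below 1.\<close>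

lemma th4_near_one:
  assumes "s - 2 * \<bar>Im x\<bar> > 2"
  shows "th4 s x \<noteq> 0"
proof -
  have s: "s > 0" using assms by linarith
  define y where "y = x + of_real (pi / 2)"
  have Im: "Im y = Im x" by (simp add: y_def)
  define r where "r = exp (- (s - 2 * \<bar>Im x\<bar>))"
  have r: "0 < r" "r < 1 / 3"
  proof -
    have "3 < exp (s - 2 * \<bar>Im x\<bar>)" using exp_ge_add_one_self[of "s - 2 * \<bar>Im x\<bar>"] assms by linarith
    then show "r < 1 / 3" unfolding r_def exp_minus by (simp add: field_simps)
  qed (simp add: r_def)
  have gs: "(\<lambda>j. 2 * r * r ^ j) sums (2 * r * (1 / (1 - r)))"
    using r by (intro sums_mult geometric_sums) auto
  have b: "norm (of_real (exp (- s) ^ ((j+1)\<^sup>2)) * (2 * cos (of_nat (2*(j+1)) * y))) \<le> 2 * r * r ^ j" for j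
  proof -
    have "norm (2 * cos (of_nat (2*(j+1)) * y)) \<le> norm (exp (\<i> * (of_nat (2*(j+1)) * y))) + norm (exp (- (\<i> * (of_nat (2*(j+1)) * y))))"
    proof -
      have "2 * cos z = exp (\<i> * z) + exp (- (\<i> * z))" for z :: complex by (simp add: cos_exp_eq)
      then show ?thesis by (metis norm_triangle_ineq)
    qed
    also have "\<dots> \<le> 2 * exp (2 * (real j + 1) * \<bar>Im x\<bar>)"
    proof -
      have "exp (- (2 * (real j + 1) * Im x)) \<le> exp (2 * (real j + 1) * \<bar>Im x\<bar>)" 
        by (auto simp: abs_if)
      moreover have "exp (2 * (real j + 1) * Im x) \<le> exp (2 * (real j + 1) * \<bar>Im x\<bar>)"
        by (auto simp: abs_if)
      moreover have "norm (exp (\<i> * (of_nat (2*(j+1)) * y))) = exp (- (2 * (real j + 1) * Im x))"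
        "norm (exp (- (\<i> * (of_nat (2*(j+1)) * y)))) = exp (2 * (real j + 1) * Im x)"
        by (simp_all add: Im algebra_simps)
      ultimately show ?thesis by linarith
    qed
    finally have "norm (of_real (exp (- s) ^ ((j+1)\<^sup>2)) * (2 * cos (of_nat (2*(j+1)) * y))) \<le>
       exp (- s) ^ ((j+1)\<^sup>2) * (2 * exp (2 * (real j + 1) * \<bar>Im x\<bar>))"
      unfolding norm_mult[of "of_real _"] by (intro mult_mono) (auto simp: norm_power)
    also have "\<dots> = 2 * exp (- s * (real j + 1)\<^sup>2 + 2 * (real j + 1) * \<bar>Im x\<bar>)"
      by (simp add: add_ac mult_ac flip: exp_of_nat_mult exp_add)
    also have "\<dots> \<le> 2 * exp (- (real j + 1) * (s - 2 * \<bar>Im x\<bar>))"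
    proof -
      have "0 \<le> real j * (real j + 1) * s" using s by simp
      then show ?thesis by (simp add: power2_eq_square algebra_simps)
    qed
    also have "\<dots> = 2 * (r * r ^ j)"
      unfolding r_def exp_of_nat_mult [symmetric] exp_add [symmetric]
      by (intro arg_cong[of _ _ "\<lambda>x. 2 * exp x"]) (simp add: algebra_simps)
    finally show ?thesis by simp
  qed
  have "norm (th3 s y - 1) \<le> 2 * r * (1 / (1 - r))"
  proof -
    have "summable (\<lambda>j. norm (of_real (exp (- s) ^ ((j+1)\<^sup>2)) * (2 * cos (of_nat (2*(j+1)) * y))))"
      by (rule summable_comparison_test'[OF sums_summable[OF gs], of 0]) (use b in simp)
    then have "norm (\<Sum>j. of_real (exp (- s) ^ ((j+1)\<^sup>2)) * (2 * cos (of_nat (2*(j+1)) * y)))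
       \<le> (\<Sum>j. norm (of_real (exp (- s) ^ ((j+1)\<^sup>2)) * (2 * cos (of_nat (2*(j+1)) * y))))"
      by (rule summable_norm)
    also have "\<dots> \<le> (\<Sum>j. 2 * r * r ^ j)"
      by (rule suminf_le[OF b \<open>summable _\<close> sums_summable[OF gs]])
    finally show ?thesis using sums_unique[OF th_sums_pairs_int[OF s, of y]] sums_unique[OF gs] by simp
  qed
  also have "\<dots> < 1" using r by (simp add: field_simps)
  finally show ?thesis by (auto simp: th4_eq y_def)
qed

lemma pow2_mult_exceeds:
  fixes d :: real
  assumes "d > 0"
  obtains N where "C < 2 ^ N * d"
proof -
  obtain N where "C / d < 2 ^ N" using real_arch_pow[of 2 "C / d"] by auto
  then show ?thesis using that assms by (simp add: field_simps)
qed

text \<open>The doubling step: x and s are doubled together, so the strip |Im x| < s / 2 is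
  preserved while the nome tends to 0. The other term of the product formula contains the factor th1
  at 0, which vanishes.\<close>

lemma th3_mult_th4: "s > 0 \<Longrightarrow> th3 s x * th4 s x = th4 (2 * s) (2 * x) * th4 (2 * s) 0"
  using th_products(6)[of s x x] th1_0[of "2 * s"] by simp

text \<open>A zero at \<open>x\<close> for the nome \<open>exp (- s)\<close> gives one at \<open>2 ^ N * x\<close> for \<open>exp (- 2 ^ N * s)\<close>, which is absurd
  for large \<open>N\<close>.\<close>

lemma th4_nonzero:
  assumes "s > 0" "\<bar>Im x\<bar> < s / 2"
  shows "th4 s x \<noteq> 0"
proof -
  have z: "th4 s 0 \<noteq> 0" if "s > 0" for s
  proof
    assume 0: "th4 s 0 = 0"
    have "th4 (2 ^ N * s) 0 = 0" for N
    proof (induction N)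
      case (Suc N)
      then show ?case using th3_mult_th4[of "2 ^ N * s" 0] that by (simp add: mult_ac)
    qed (use 0 in simp)
    moreover obtain N where "2 < 2 ^ N * s" using pow2_mult_exceeds[OF \<open>s > 0\<close>] .
    ultimately show False using th4_near_one[of "2 ^ N * s" 0] by simp
  qed
  show ?thesis
  proof
    assume 0: "th4 s x = 0"
    have "th4 (2 ^ N * s) (2 ^ N * x) = 0" for N
    proof (induction N)
      case (Suc N)
      then show ?case using th3_mult_th4[of "2 ^ N * s" "2 ^ N * x"] z[of "2 * (2 ^ N * s)"] assms(1) by (simp add: mult_ac)
    qed (use 0 in simp)
    moreover obtain N where "2 < 2 ^ N * (s - 2 * \<bar>Im x\<bar>)" using pow2_mult_exceeds[of "s - 2 * \<bar>Im x\<bar>"] assms by auto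
    then have "th4 (2 ^ N * s) (2 ^ N * x) \<noteq> 0"
    proof (intro th4_near_one)
      have "2 ^ N * x = of_real (2 ^ N) * x" by simp
      then have "\<bar>Im (2 ^ N * x)\<bar> = 2 ^ N * \<bar>Im x\<bar>" by (simp only: Im_complex_of_real Re_complex_of_real times_complex.sel) (simp add: abs_mult)
      then show "2 < 2 ^ N * s - 2 * \<bar>Im (2 ^ N * x)\<bar>" using \<open>2 < 2 ^ N * (s - 2 * \<bar>Im x\<bar>)\<close> by (simp add: algebra_simps)
    qed
    ultimately show False by simp
  qed
qed

text \<open>A second doubling step, which keeps x fixed while s doubles. It carries a real zero of
  \<open>th1\<close> to arbitrarily small nomes, because the other factor \<open>th4\<close> has no
  real zeros.\<close>

lemma th1_mult_th2_0: "s > 0 \<Longrightarrow> th1 s x * th2 s 0 = 2 * th1 (2 * s) x * th4 (2 * s) x"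
  using th_products(5)[of s 0 x] by (simp add: th1_minus th4_minus mult_ac)

lemma th2_mult_th2_0: "s > 0 \<Longrightarrow> th2 s x * th2 s 0 = 2 * th2 (2 * s) x * th3 (2 * s) x"
  using th_products(2)[of s x 0] by (simp add: mult_ac)

lemma th2_0_pos: "s > 0 \<Longrightarrow> 0 < Re (th2 s 0)" and th2_0_nonzero: "s > 0 \<Longrightarrow> th2 s 0 \<noteq> 0"
  using th_imaginary_pos[of s "1/2" 0] by (auto simp: th2_def)

lemma th3_0_pos: "s > 0 \<Longrightarrow> 0 < Re (th3 s 0)"
  using th_imaginary_pos[of s 0 0] by (auto simp: th3_def)

text \<open>The leading term q^(1/4) sin x exceeds the sum of all others, which is at most q^(1/4) q
  / (1 - q) because (j + 3/2)^2 >= 1/4 + 1 + j.\<close>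

lemma th1_real_nonzero_large:
  fixes x :: real
  assumes s: "s > 0" and x: "sin x > 0" and big: "exp (- s) / (1 - exp (- s)) < sin x"
  shows "th1 s (of_real x) \<noteq> 0"
proof
  assume 0: "th1 s (of_real x) = 0"
  define q where "q = exp (- s)"
  have q: "0 < q" "q < 1" using s by (auto simp: q_def)
  define f where "f j = (-1) ^ j * q powr ((real j + 1/2)\<^sup>2) * sin (real (2*j+1) * x)" for j
  have "(\<lambda>j. of_real (exp (- s) powr ((real j + 1/2)\<^sup>2)) * (2 * cos (of_nat (2*j+1) * (of_real x - of_real (pi/2))))) sums (0 :: complex)"
    using th_sums_pairs_half[OF s, of "of_real x - of_real (pi/2)"] 0 by (simp add: th1_eq)
  then have "(\<lambda>j. of_real (2 * f j)) sums (0 :: complex)"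
    unfolding cos_odd_mult_minus_pi_half
    by (simp add: f_def q_def mult_ac flip: sin_of_real)
  then have "(\<lambda>j. 2 * f j) sums 0" by (metis of_real_0 sums_of_real_iff)
  then have f: "f sums 0" using sums_mult[of "\<lambda>j. 2 * f j" 0 "1/2"] by simp
  have "(\<lambda>j. f (Suc j)) sums (0 - f 0)" using f by (subst sums_Suc_iff) simp
  moreover have gs: "(\<lambda>j. q powr (1/4) * q * q ^ j) sums (q powr (1/4) * q * (1 / (1 - q)))"
    using q by (intro sums_mult geometric_sums) auto
  moreover have "- f (Suc j) \<le> q powr (1/4) * q * q ^ j" for j
  proof -
    have "- f (Suc j) \<le> \<bar>f (Suc j)\<bar>" by simp
    also have "\<dots> \<le> q powr ((real (Suc j) + 1/2)\<^sup>2) * 1"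
      unfolding f_def abs_mult by (intro mult_mono) (auto simp: power_abs abs_mult)
    also have "\<dots> \<le> q powr (1/4 + 1 + real j)"
      using q by (simp add: powr_mono' power2_eq_square field_simps)
    also have "\<dots> = q powr (1/4) * q * q ^ j"
      using q by (simp only: powr_add powr_realpow powr_one)
    finally show ?thesis .
  qed
  ultimately have "f 0 \<le> q powr (1/4) * q * (1 / (1 - q))"
    using sums_le[OF _ sums_minus[of "\<lambda>j. f (Suc j)" "0 - f 0"]] by fastforce
  moreover have "f 0 = q powr (1/4) * sin x" by (simp add: f_def power2_eq_square)
  ultimately have "q powr (1/4) * sin x \<le> q powr (1/4) * (q / (1 - q))" by simp
  moreover have "q powr (1/4) * (q / (1 - q)) < q powr (1/4) * sin x"
    using big q by (intro mult_strict_left_mono) (auto simp: q_def)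
  ultimately show False by linarith
qed

lemma th1_real_nonzero:
  fixes x :: real
  assumes s: "s > 0" and x: "0 < x" "x < pi"
  shows "th1 s (of_real x) \<noteq> 0"
proof
  assume 0: "th1 s (of_real x) = 0"
  have *: "th1 (2 ^ N * s) (of_real x) = 0" for N
  proof (induction N)
    case (Suc N)
    then show ?case using th1_mult_th2_0[of "2 ^ N * s" "of_real x"] th4_nonzero[of "2 * (2 ^ N * s)" "of_real x"] s by (simp add: mult_ac)
  qed (use 0 in simp)
  have sx: "sin x > 0" using x by (simp add: sin_gt_zero)
  obtain N where N: "1 / sin x + 1 < 2 ^ N * s" using pow2_mult_exceeds[OF s] .
  define t where "t = 2 ^ N * s"
  have t: "t > 0" using s by (simp add: t_def)
  have "1 / sin x < exp t - 1" using N exp_ge_add_one_self[of t] unfolding t_def[symmetric] by linarith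
  moreover have "exp (- t) / (1 - exp (- t)) = 1 / (exp t - 1)"
    using t by (simp add: exp_minus field_simps)
  moreover have "exp t - 1 > 0" using t by simp
  moreover have "1 / (exp t - 1) < sin x \<longleftrightarrow> 1 / sin x < exp t - 1"
    using sx \<open>exp t - 1 > 0\<close> by (simp add: divide_less_eq mult.commute)
  ultimately have "exp (- t) / (1 - exp (- t)) < sin x" by simp
  from th1_real_nonzero_large[OF t sx this] show False using *[of N] by (simp add: t_def)
qed

section \<open>Algebraic identities and Wronskians\<close>

text \<open>All quadratic and quartic identities follow by expressing both sides through \<open>th2\<close> and \<open>th3\<close>
  with the nome squared.\<close>

lemma th_sum_diff_products:
  assumes "s > 0"
  shows "th1 s (x + y) * th1 s (x - y) = th3 (2 * s) (2 * x) * th2 (2 * s) (2 * y) - th2 (2 * s) (2 * x) * th3 (2 * s) (2 * y)"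
    "th2 s (x + y) * th2 s (x - y) = th3 (2 * s) (2 * x) * th2 (2 * s) (2 * y) + th2 (2 * s) (2 * x) * th3 (2 * s) (2 * y)"
    "th3 s (x + y) * th3 s (x - y) = th3 (2 * s) (2 * x) * th3 (2 * s) (2 * y) + th2 (2 * s) (2 * x) * th2 (2 * s) (2 * y)"
    "th4 s (x + y) * th4 s (x - y) = th3 (2 * s) (2 * x) * th3 (2 * s) (2 * y) - th2 (2 * s) (2 * x) * th2 (2 * s) (2 * y)"
  using th_products(1-4)[OF assms, of "x + y" "x - y"] by simp_all

lemma th_squares_doubled:
  assumes "s > 0"
  shows "(th1 s x)\<^sup>2 = th3 (2 * s) (2 * x) * th2 (2 * s) 0 - th2 (2 * s) (2 * x) * th3 (2 * s) 0"
    "(th2 s x)\<^sup>2 = th3 (2 * s) (2 * x) * th2 (2 * s) 0 + th2 (2 * s) (2 * x) * th3 (2 * s) 0"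
    "(th3 s x)\<^sup>2 = th3 (2 * s) (2 * x) * th3 (2 * s) 0 + th2 (2 * s) (2 * x) * th2 (2 * s) 0"
    "(th4 s x)\<^sup>2 = th3 (2 * s) (2 * x) * th3 (2 * s) 0 - th2 (2 * s) (2 * x) * th2 (2 * s) 0"
  using th_sum_diff_products[OF assms, of x 0] by (simp_all add: power2_eq_square)

lemma th_duplication_doubled:
  assumes "s > 0"
  shows "th2 s (2 * x) * th2 s 0 = 2 * th3 (2 * s) (2 * x) * th2 (2 * s) (2 * x)"
    "th3 s (2 * x) * th3 s 0 = (th3 (2 * s) (2 * x))\<^sup>2 + (th2 (2 * s) (2 * x))\<^sup>2"
    "th4 s (2 * x) * th4 s 0 = (th3 (2 * s) (2 * x))\<^sup>2 - (th2 (2 * s) (2 * x))\<^sup>2"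
  using th_sum_diff_products[OF assms, of x x] by (simp_all add: power2_eq_square)

lemma th_square_relations:
  assumes "s > 0"
  shows "(th4 s x)\<^sup>2 * (th3 s 0)\<^sup>2 = (th1 s x)\<^sup>2 * (th2 s 0)\<^sup>2 + (th3 s x)\<^sup>2 * (th4 s 0)\<^sup>2"
    "(th4 s x)\<^sup>2 * (th2 s 0)\<^sup>2 = (th1 s x)\<^sup>2 * (th3 s 0)\<^sup>2 + (th2 s x)\<^sup>2 * (th4 s 0)\<^sup>2"
    "(th2 s x)\<^sup>2 * (th3 s 0)\<^sup>2 = (th3 s x)\<^sup>2 * (th2 s 0)\<^sup>2 - (th1 s x)\<^sup>2 * (th4 s 0)\<^sup>2"
  unfolding th_squares_doubled[OF assms] by (simp_all add: algebra_simps)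

text \<open>The first square relation at pi/2, where \<open>th1\<close>, \<open>th3\<close>,
  \<open>th4\<close> take the values of \<open>th2\<close>, \<open>th4\<close>, \<open>th3\<close>
  at 0. It expresses that the squares of the modulus and its complement add up to 1.\<close>

lemma th_quartic: "s > 0 \<Longrightarrow> (th3 s 0) ^ 4 = (th2 s 0) ^ 4 + (th4 s 0) ^ 4"
  using th_square_relations(1)[of s "of_real (pi/2)"]
    th1_add_half_pi[of s 0] th2_add_half_pi[of s 0] th3_add_half_pi[of s 0] th4_add_half_pi[of s 0] th1_0[of s]
  by (simp add: power4_eq_xxxx power2_eq_square algebra_simps)

lemma th4_addition: 
  assumes "s > 0"
  shows "th4 s (x + y) * th4 s (x - y) * (th4 s 0)\<^sup>2 = (th4 s x)\<^sup>2 * (th4 s y)\<^sup>2 - (th1 s x)\<^sup>2 * (th1 s y)\<^sup>2"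
  unfolding th_sum_diff_products[OF assms] th_squares_doubled[OF assms] by (simp add: algebra_simps)

text \<open>The product H Theta1 from which Omega is formed. Its translate by pi/2 is
  \<open>thg\<close>, and its translate by the imaginary half-period is \<open>thg\<close> up to an
  exponential factor.\<close>

definition thf :: "real \<Rightarrow> complex \<Rightarrow> complex" where "thf s x = th1 s x * th3 s x"
definition thg :: "real \<Rightarrow> complex \<Rightarrow> complex" where "thg s x = th2 s x * th4 s x"

text \<open>The central identity of the uniformization: with x on the imaginary axis and y real it
  evaluates the product of numerator and denominator of Omega, and its derivative in y gives the
  logarithmic derivative of Omega.\<close>

lemma th_f_addition:
  assumes "s > 0"
  shows "thf s (x + y) * thf s (x - y) * (thg s 0)\<^sup>2 = (thf s x)\<^sup>2 * (thg s y)\<^sup>2 - (thg s x)\<^sup>2 * (thf s y)\<^sup>2"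
proof -
  have eq: "thf s (x + y) * thf s (x - y) = (th1 s (x + y) * th1 s (x - y)) * (th3 s (x + y) * th3 s (x - y))"
    by (simp add: thf_def)
  show ?thesis
    unfolding eq unfolding thf_def thg_def power_mult_distrib th_sum_diff_products[OF assms] th_squares_doubled[OF assms]
    by (simp add: power2_eq_square algebra_simps)
qed

text \<open>The quotient of the two identities is the half-argument formula cn(2 x) = (g^2 - f^2) /
  (g^2 + f^2), through which z becomes rational in f^2 and g^2.\<close>

lemma thfg_sum_squares: "s > 0 \<Longrightarrow> (thg s x)\<^sup>2 + (thf s x)\<^sup>2 = (th2 s 0)\<^sup>2 * th4 s 0 * th4 s (2 * x)"
  and thfg_diff_squares: "s > 0 \<Longrightarrow> (thg s x)\<^sup>2 - (thf s x)\<^sup>2 = (th4 s 0)\<^sup>2 * th2 s 0 * th2 s (2 * x)"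
proof -
  assume s: "s > 0"
  have "(th2 s 0)\<^sup>2 * th4 s 0 * th4 s (2 * x) = (th2 s 0)\<^sup>2 * (th4 s (2 * x) * th4 s 0)" by simp
  then show "(thg s x)\<^sup>2 + (thf s x)\<^sup>2 = (th2 s 0)\<^sup>2 * th4 s 0 * th4 s (2 * x)"
    unfolding th_duplication_doubled[OF s]
    unfolding thf_def thg_def power_mult_distrib th_squares_doubled[OF s] by (simp add: power2_eq_square algebra_simps)
  have "(th4 s 0)\<^sup>2 * th2 s 0 * th2 s (2 * x) = (th4 s 0)\<^sup>2 * (th2 s (2 * x) * th2 s 0)" by simp
  then show "(thg s x)\<^sup>2 - (thf s x)\<^sup>2 = (th4 s 0)\<^sup>2 * th2 s 0 * th2 s (2 * x)"
    unfolding th_duplication_doubled[OF s]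
    unfolding thf_def thg_def power_mult_distrib th_squares_doubled[OF s] by (simp add: power2_eq_square algebra_simps)
qed

lemma th3_duplication: "s > 0 \<Longrightarrow> (th2 s x)\<^sup>2 * (th3 s x)\<^sup>2 + (th1 s x)\<^sup>2 * (th4 s x)\<^sup>2 = (th2 s 0)\<^sup>2 * th3 s 0 * th3 s (2 * x)"
proof -
  assume s: "s > 0"
  have "(th2 s 0)\<^sup>2 * th3 s 0 * th3 s (2 * x) = (th2 s 0)\<^sup>2 * (th3 s (2 * x) * th3 s 0)" by simp
  then show ?thesis
    unfolding th_duplication_doubled[OF s] th_squares_doubled[OF s] by (simp add: power2_eq_square algebra_simps)
qed

text \<open>The expression squared on the left is the Wronskian of \<open>thf\<close> and
  \<open>thg\<close> up to a constant. The identity is dn^2 = k'^2 + k^2 cn^2 at 2 x with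
  denominators cleared; it is the source of the differential equation for z.\<close>

lemma th_f_wronskian_square:
  assumes "s > 0"
  shows "((th2 s x)\<^sup>2 * (th3 s x)\<^sup>2 + (th1 s x)\<^sup>2 * (th4 s x)\<^sup>2)\<^sup>2 * (th4 s 0) ^ 4
    = (th4 s 0) ^ 4 * ((thg s x)\<^sup>2 + (thf s x)\<^sup>2)\<^sup>2 + (th2 s 0) ^ 4 * ((thg s x)\<^sup>2 - (thf s x)\<^sup>2)\<^sup>2"
proof -
  have 4: "(z::complex) ^ 4 = (z\<^sup>2)\<^sup>2" for z by simp
  show ?thesis
    unfolding thf_def thg_def power_mult_distrib 4 th_squares_doubled[OF assms] by (simp add: power2_eq_square algebra_simps)
qed

text \<open>At the nome with half the parameter, the product of th1(x), th2(x) and th2(0)^2 can be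
  grouped in two ways, and each grouping is known at the nome exp (- s).\<close>

lemma th1_duplication:
  assumes "s > 0"
  shows "th1 s (2 * x) * th2 s 0 * th3 s 0 * th4 s 0 = 2 * th1 s x * th2 s x * th3 s x * th4 s x"
proof -
  define h where "h = s / 2"
  have h: "h > 0" "2 * h = s" using assms by (auto simp: h_def)
  have 1: "th1 h x * th2 h x = th1 s (2 * x) * th4 s 0"
    using th_products(5)[OF h(1), of x x, unfolded h(2)] th1_0[OF assms] by (simp add: mult.commute)
  have 2: "th1 h x * th2 h 0 = 2 * th1 s x * th4 s x" "th2 h x * th2 h 0 = 2 * th2 s x * th3 s x"
      "th2 h 0 * th2 h 0 = 2 * th2 s 0 * th3 s 0"
    using th1_mult_th2_0[OF h(1), of x, unfolded h(2)] th2_mult_th2_0[OF h(1), of x, unfolded h(2)] th2_mult_th2_0[OF h(1), of 0, unfolded h(2)] by simp_all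
  have "2 * (th1 s (2 * x) * th2 s 0 * th3 s 0 * th4 s 0) = (th1 h x * th2 h x) * (th2 h 0 * th2 h 0)"
    unfolding 1 2 by simp
  also have "\<dots> = (th1 h x * th2 h 0) * (th2 h x * th2 h 0)" by simp
  also have "\<dots> = 2 * (2 * th1 s x * th2 s x * th3 s x * th4 s x)" unfolding 2 by simp
  finally show ?thesis by (simp add: mult_ac)
qed

lemma th_holomorphic_i:
  assumes "s > 0"
  shows "th1 s holomorphic_on UNIV" "th2 s holomorphic_on UNIV" "th3 s holomorphic_on UNIV" "th4 s holomorphic_on UNIV"
proof -
  show "th2 s holomorphic_on UNIV" "th3 s holomorphic_on UNIV"
    using th_holomorphic[OF assms] by (auto simp: th2_def[abs_def] th3_def[abs_def])
  have "(\<lambda>x. th (1/2) s (x - of_real (pi / 2))) holomorphic_on UNIV" "(\<lambda>x. th 0 s (x + of_real (pi / 2))) holomorphic_on UNIV"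
    by (intro holomorphic_on_compose_gen[OF _ th_holomorphic[OF assms], unfolded o_def]; auto intro!: holomorphic_intros)+
  then show "th1 s holomorphic_on UNIV" "th4 s holomorphic_on UNIV"
    by (simp_all add: th1_def[abs_def] th4_def[abs_def])
qed

lemma th_DERIV:
  assumes "s > 0"
  shows "(th1 s has_field_derivative deriv (th1 s) x) (at x)" "(th2 s has_field_derivative deriv (th2 s) x) (at x)"
    "(th3 s has_field_derivative deriv (th3 s) x) (at x)" "(th4 s has_field_derivative deriv (th4 s) x) (at x)"
  using th_holomorphic_i[OF assms] by (auto intro: holomorphic_derivI[of _ UNIV])

text \<open>Differentiating the product formula for \<open>th2 h x * th1 h y\<close> at y = 0 turns
  its right side into twice the Wronskian of \<open>th1\<close> and \<open>th4\<close> and its left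
  side into a constant times th2 h x, itself a multiple of th2 s x th3 s x. The second Wronskian is
  the first one translated by pi/2.\<close>

lemma th_wronskians:
  assumes "s > 0"
  obtains c where "\<And>x. deriv (th1 s) x * th4 s x - th1 s x * deriv (th4 s) x = c * (th2 s x * th3 s x)"
    "\<And>x. deriv (th2 s) x * th3 s x - th2 s x * deriv (th3 s) x = - c * (th1 s x * th4 s x)"
proof -
  define h where "h = s / 2"
  have h: "h > 0" "2 * h = s" using assms by (auto simp: h_def)
  define c where "c = deriv (th1 h) 0 / th2 h 0"
  have 1: "deriv (th1 s) x * th4 s x - th1 s x * deriv (th4 s) x = c * (th2 s x * th3 s x)" for x
  proof -
    have "((\<lambda>y. th2 h x * th1 h y) has_field_derivative th2 h x * deriv (th1 h) 0) (at 0)"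
      by (rule DERIV_cmult[OF th_DERIV(1)[OF h(1)]])
    moreover have "((\<lambda>y. th1 s (x + y) * th4 s (x - y) - th4 s (x + y) * th1 s (x - y)) has_field_derivative
         2 * (deriv (th1 s) x * th4 s x - th1 s x * deriv (th4 s) x)) (at 0)"
      by (rule derivative_eq_intros DERIV_chain2[OF th_DERIV(1)[OF assms]] DERIV_chain2[OF th_DERIV(4)[OF assms]] refl | simp)+
    moreover have "(\<lambda>y. th2 h x * th1 h y) = (\<lambda>y. th1 s (x + y) * th4 s (x - y) - th4 s (x + y) * th1 s (x - y))"
      using th_products(5)[OF h(1), unfolded h(2)] by simp
    ultimately have "th2 h x * deriv (th1 h) 0 = 2 * (deriv (th1 s) x * th4 s x - th1 s x * deriv (th4 s) x)"
      using DERIV_unique by simp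
    moreover have "th2 h x * th2 h 0 = 2 * th2 s x * th3 s x"
      using th2_mult_th2_0[OF h(1), of x, unfolded h(2)] by simp
    then have "th2 h x = 2 * th2 s x * th3 s x / th2 h 0"
      using th2_0_nonzero[OF h(1)] by (simp add: eq_divide_eq)
    ultimately have "2 * (c * (th2 s x * th3 s x)) = 2 * (deriv (th1 s) x * th4 s x - th1 s x * deriv (th4 s) x)"
      using th2_0_nonzero[OF h(1)] by (simp add: c_def field_simps)
    then show ?thesis by (simp only: mult_cancel_left) simp
  qed
  have d: "deriv (th2 s) x = deriv (th1 s) (x + of_real (pi / 2))" "deriv (th3 s) x = deriv (th4 s) (x + of_real (pi / 2))" for x
  proof -
    have "th2 s = (\<lambda>x. th1 s (x + of_real (pi / 2)))" "th3 s = (\<lambda>x. th4 s (x + of_real (pi / 2)))"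
      using th1_add_half_pi[of s] th4_add_half_pi[OF assms] by auto
    moreover have "((\<lambda>x. th1 s (x + of_real (pi / 2))) has_field_derivative deriv (th1 s) (x + of_real (pi / 2))) (at x)"
      "((\<lambda>x. th4 s (x + of_real (pi / 2))) has_field_derivative deriv (th4 s) (x + of_real (pi / 2))) (at x)"
      using th_DERIV(1)[OF assms, of "x + of_real (pi / 2)"] th_DERIV(4)[OF assms, of "x + of_real (pi / 2)"]
      by (simp_all only: DERIV_shift)
    ultimately show "deriv (th2 s) x = deriv (th1 s) (x + of_real (pi / 2))" "deriv (th3 s) x = deriv (th4 s) (x + of_real (pi / 2))"
      by (auto intro!: DERIV_imp_deriv)
  qed
  have "deriv (th2 s) x * th3 s x - th2 s x * deriv (th3 s) x = - c * (th1 s x * th4 s x)" for x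
    using 1[of "x + of_real (pi / 2)"]
    unfolding d[symmetric] th1_add_half_pi th4_add_half_pi[OF assms] th3_add_half_pi th2_add_half_pi[OF assms] by simp
  with 1 that show ?thesis by blast
qed

section \<open>Derivatives along the real and imaginary axes\<close>

lemma has_real_derivative_of_real_axis:
  fixes f :: "complex \<Rightarrow> complex"
  assumes "(f has_field_derivative D) (at (of_real x))" "\<And>y. Im (f (of_real y)) = 0"
  shows "((\<lambda>y. Re (f (of_real y))) has_real_derivative Re D) (at x)" "Im D = 0"
proof -
  have v: "((\<lambda>y. f (of_real y)) has_vector_derivative D) (at x)"
    by (rule has_vector_derivative_real_field[OF assms(1)])
  from bounded_linear.has_vector_derivative[OF bounded_linear_Re this]
  show "((\<lambda>y. Re (f (of_real y))) has_real_derivative Re D) (at x)"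
    by (simp add: has_real_derivative_iff_has_vector_derivative)
  from bounded_linear.has_vector_derivative[OF bounded_linear_Im v]
  have "((\<lambda>y. 0::real) has_vector_derivative Im D) (at x)" by (simp add: assms(2))
  then show "Im D = 0" 
    using vector_derivative_unique_at has_vector_derivative_const by blast
qed

lemma has_vector_derivative_imaginary_axis:
  fixes f :: "complex \<Rightarrow> complex"
  assumes "(f has_field_derivative D) (at (\<i> * of_real t))"
  shows "((\<lambda>t. f (\<i> * of_real t)) has_vector_derivative \<i> * D) (at t)"
proof -
  have "((\<lambda>z. f (\<i> * z)) has_field_derivative D * \<i>) (at (of_real t))"
    by (rule DERIV_chain2[where f = f and g = "\<lambda>z. \<i> * z", OF assms]) (auto intro!: derivative_eq_intros)
  from has_vector_derivative_real_field[OF this] show ?thesis by (simp add: mult.commute)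
qed

section \<open>Complete elliptic integrals and the nome\<close>

lemma modulus_sin_less_1: "0 < k \<Longrightarrow> k < 1 \<Longrightarrow> k\<^sup>2 * (sin t)\<^sup>2 < (1::real)"
proof -
  assume k: "0 < k" "k < 1"
  have "k\<^sup>2 * (sin t)\<^sup>2 \<le> k\<^sup>2 * 1" by (intro mult_left_mono) (auto simp: abs_square_le_1)
  also have "\<dots> < 1" using k by (simp add: abs_square_less_1)
  finally show ?thesis .
qed

text \<open>The substitution of arcsin (S t) with S, C, D in the roles of sn, cn, dn. Stated
  abstractly because it is applied twice: on the real axis for the modulus \<open>kk\<close>, and on
  the imaginary axis for its complement.\<close>

lemma elliptic_substitution:
  fixes S C D :: "real \<Rightarrow> real"
  assumes "0 < k" "k < 1" and c: "c > 0" "X > 0"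
    and cont: "continuous_on {0..X} S"
    and S0: "S 0 = 0" and SX: "S X = 1"
    and Cpos: "\<And>t. 0 < t \<Longrightarrow> t < X \<Longrightarrow> C t > 0"
    and deriv: "\<And>t. 0 < t \<Longrightarrow> t < X \<Longrightarrow> (S has_real_derivative c * C t * D t) (at t)"
    and SC: "\<And>t. 0 \<le> t \<Longrightarrow> t \<le> X \<Longrightarrow> (S t)\<^sup>2 + (C t)\<^sup>2 = 1"
    and DS: "\<And>t. 0 \<le> t \<Longrightarrow> t \<le> X \<Longrightarrow> (D t)\<^sup>2 = 1 - k\<^sup>2 * (S t)\<^sup>2"
    and Dpos: "\<And>t. 0 \<le> t \<Longrightarrow> t \<le> X \<Longrightarrow> D t > 0"
  shows "ellK k = c * X" "((\<lambda>t. c * (D t)\<^sup>2) has_integral ellE k) {0..X}"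
proof -
  have S1: "\<bar>S t\<bar> \<le> 1" if "0 \<le> t" "t \<le> X" for t
    using SC[OF that] by (metis abs_square_le_1 le_add_same_cancel1 zero_le_power2)
  define g where "g t = arcsin (S t)" for t
  have sg: "sin (g t) = S t" if "0 \<le> t" "t \<le> X" for t
    using S1[OF that] by (simp add: g_def abs_le_iff)
  have g0: "g 0 = 0" and gX: "g X = pi / 2" by (simp_all add: g_def S0 SX)
  have gc: "continuous_on {0..X} g"
    unfolding g_def using S1 by (intro continuous_on_arcsin cont) (auto simp: abs_le_iff minus_le_iff)
  have gd: "(g has_real_derivative c * D t) (at t within {0..X})" if "t \<in> {0..X} - {0, X}" for t
  proof -
    have t: "0 < t" "t < X" using that by auto
    have ct: "C t > 0" using Cpos[OF t] .
    have 1: "(S t)\<^sup>2 < 1" using SC[of t] t ct by (smt (verit) zero_less_power2 less_imp_neq)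
    then have "\<bar>S t\<bar> < 1" by (simp add: abs_square_less_1)
    then have "(arcsin has_real_derivative inverse (sqrt (1 - (S t)\<^sup>2))) (at (S t))"
      by (intro DERIV_arcsin) auto
    from DERIV_chain2[OF this deriv[OF t]]
    have "(g has_real_derivative inverse (sqrt (1 - (S t)\<^sup>2)) * (c * C t * D t)) (at t)" by (simp add: g_def[abs_def])
    moreover have "sqrt (1 - (S t)\<^sup>2) = C t" using SC[of t] t ct by (intro real_sqrt_unique) auto
    ultimately have "(g has_real_derivative c * D t) (at t)" using ct by (simp add: field_simps)
    then show ?thesis by (rule has_field_derivative_at_within)
  qed
  have range: "g t \<in> {- pi / 2..pi / 2}" if "t \<in> {0..X}" for t
    using S1[of t] that arcsin_bounded[of "S t"] by (auto simp: g_def abs_le_iff)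
  have rt: "1 - k\<^sup>2 * (sin t)\<^sup>2 > 0" for t
    using modulus_sin_less_1[OF assms(1,2), of t] by simp
  have subst: "((\<lambda>t. (c * D t) *\<^sub>R f (g t)) has_integral integral {0..pi/2} f) {0..X}"
    if "continuous_on {- pi / 2..pi / 2} f" for f :: "real \<Rightarrow> real"
  proof -
    \<comment> \<open>The end X must be exceptional: S X = 1 there, where arcsin is not
      differentiable.\<close>
    have "((\<lambda>t. (c * D t) *\<^sub>R f (g t)) has_integral (integral {g 0..g X} f - integral {g X..g 0} f)) {0..X}"
      by (rule has_integral_substitution_general[of "{0, X}" _ _ _ "- pi / 2" "pi / 2"]) (use c range gc gd that in auto)
    then show ?thesis by (simp add: g0 gX)
  qed
  have D: "sqrt (1 - k\<^sup>2 * (S t)\<^sup>2) = D t" if "0 \<le> t" "t \<le> X" for t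
    using DS[OF that] Dpos[OF that] by (intro real_sqrt_unique) auto
  have "((\<lambda>t. (c * D t) *\<^sub>R (1 / sqrt (1 - k\<^sup>2 * (sin (g t))\<^sup>2))) has_integral ellK k) {0..X}"
    unfolding ellK_def using rt by (intro subst continuous_intros) (auto simp: less_imp_neq[symmetric] intro: less_imp_neq)
  moreover have "(c * D t) *\<^sub>R (1 / sqrt (1 - k\<^sup>2 * (sin (g t))\<^sup>2)) = c" if "t \<in> {0..X}" for t
    using that D[of t] sg[of t] Dpos[of t] by simp
  ultimately have "((\<lambda>t. c) has_integral ellK k) {0..X}"
    by (rule has_integral_eq[rotated])
  then show "ellK k = c * X"
    using has_integral_const_real[of c 0 X] c by (auto dest: has_integral_unique)
  have "((\<lambda>t. (c * D t) *\<^sub>R (sqrt (1 - k\<^sup>2 * (sin (g t))\<^sup>2))) has_integral ellE k) {0..X}"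
    unfolding ellE_def by (intro subst continuous_intros)
  moreover have "(c * D t) *\<^sub>R (sqrt (1 - k\<^sup>2 * (sin (g t))\<^sup>2)) = c * (D t)\<^sup>2" if "t \<in> {0..X}" for t
    using that D[of t] sg[of t] by (simp add: power2_eq_square)
  ultimately show "((\<lambda>t. c * (D t)\<^sup>2) has_integral ellE k) {0..X}"
    by (rule has_integral_eq[rotated])
qed

lemma ellK_strict_mono:
  assumes "0 < k" "k < l" "l < 1"
  shows "ellK k < ellK l"
  unfolding ellK_def
proof (rule integral_less_real)
  have c: "continuous_on {0..pi/2} (\<lambda>t. 1 / sqrt (1 - m\<^sup>2 * (sin t)\<^sup>2))" if "0 < m" "m < 1" for m
    using modulus_sin_less_1[OF that] by (intro continuous_intros) (auto simp: less_imp_neq)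
  show "continuous_on {0..pi/2} (\<lambda>t. 1 / sqrt (1 - k\<^sup>2 * (sin t)\<^sup>2))" "continuous_on {0..pi/2} (\<lambda>t. 1 / sqrt (1 - l\<^sup>2 * (sin t)\<^sup>2))"
    using c assms by auto
  fix t assume t: "t \<in> {0<..<pi/2}"
  then have "(sin t)\<^sup>2 > 0" using sin_gt_zero[of t] by auto
  moreover have "k\<^sup>2 < l\<^sup>2" using assms by (intro power_strict_mono) auto
  ultimately have "k\<^sup>2 * (sin t)\<^sup>2 < l\<^sup>2 * (sin t)\<^sup>2" by simp
  then show "1 / sqrt (1 - k\<^sup>2 * (sin t)\<^sup>2) < 1 / sqrt (1 - l\<^sup>2 * (sin t)\<^sup>2)"
    using modulus_sin_less_1[of l t] assms by (intro divide_strict_left_mono) auto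
next
  show "{0<..<pi/2} \<noteq> {}" by (simp add: not_le)
qed

lemma ellK_pos: "0 < k \<Longrightarrow> k < 1 \<Longrightarrow> 0 < ellK k"
proof -
  assume k: "0 < k" "k < 1"
  \<comment> \<open>Comparison with a smaller modulus makes strict positivity a consequence of
    strict monotonicity.\<close>
  have "0 \<le> ellK (k/2)" unfolding ellK_def
  proof (intro integral_nonneg integrable_continuous_real continuous_intros ballI)
    fix t :: real
    have "(k/2)\<^sup>2 * (sin t)\<^sup>2 < 1" using modulus_sin_less_1[of "k/2" t] k by simp
    then show "sqrt (1 - (k/2)\<^sup>2 * (sin t)\<^sup>2) \<noteq> 0" "0 \<le> 1 / sqrt (1 - (k/2)\<^sup>2 * (sin t)\<^sup>2)" by simp_all
  qed
  also have "\<dots> < ellK k" using k by (intro ellK_strict_mono) auto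
  finally show ?thesis .
qed

lemma continuous_nonzero_pos:
  fixes f :: "real \<Rightarrow> real"
  assumes "continuous_on S f" "connected S" "\<And>x. x \<in> S \<Longrightarrow> f x \<noteq> 0" "c \<in> S" "f c > 0" "x \<in> S"
  shows "f x > 0"
proof (rule ccontr)
  assume "\<not> f x > 0"
  then have x: "f x \<le> 0" by simp
  have "connected (f ` S)" by (rule connected_continuous_image[OF assms(1,2)])
  from connectedD_interval[OF this, of "f x" "f c" 0] have "0 \<in> f ` S"
    using assms x by auto
  then show False using assms(3) by force
qed

text \<open>\<open>R1\<close>, \<dots>, \<open>R4\<close> are the theta functions on the real axis; \<open>J1\<close>, \<dots>, \<open>J4\<close> below are those on the
  imaginary axis. \<open>kk\<close> is the modulus belonging to the nome \<open>exp (- s)\<close>, and \<open>kap\<close> turns out to be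
  \<open>2 K / pi\<close>.\<close>

locale theta_nome =
  fixes s :: real
  assumes s_pos: "s > 0"
begin

definition "R1 x = Re (th1 s (of_real x))"
definition "R2 x = Re (th2 s (of_real x))"
definition "R3 x = Re (th3 s (of_real x))"
definition "R4 x = Re (th4 s (of_real x))"
definition "D1 x = Re (deriv (th1 s) (of_real x))"
definition "D2 x = Re (deriv (th2 s) (of_real x))"
definition "D3 x = Re (deriv (th3 s) (of_real x))"
definition "D4 x = Re (deriv (th4 s) (of_real x))"
definition "DD4 x = Re (deriv (deriv (th4 s)) (of_real x))"
abbreviation "c2 \<equiv> R2 0"
abbreviation "c3 \<equiv> R3 0"
abbreviation "c4 \<equiv> R4 0"

lemma R_of_real:
  "th1 s (of_real x) = of_real (R1 x)" "th2 s (of_real x) = of_real (R2 x)"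
  "th3 s (of_real x) = of_real (R3 x)" "th4 s (of_real x) = of_real (R4 x)"
  using th_i_cnj[OF s_pos, of "of_real x"] by (auto simp: R1_def R2_def R3_def R4_def complex_eq_iff)

lemma c_of_real: "th2 s 0 = of_real c2" "th3 s 0 = of_real c3" "th4 s 0 = of_real c4"
  using R_of_real[of 0] by simp_all

lemma R_DERIV:
  "(R1 has_real_derivative D1 x) (at x)" "(R2 has_real_derivative D2 x) (at x)"
  "(R3 has_real_derivative D3 x) (at x)" "(R4 has_real_derivative D4 x) (at x)"
  using has_real_derivative_of_real_axis(1)[OF th_DERIV(1)[OF s_pos]] has_real_derivative_of_real_axis(1)[OF th_DERIV(2)[OF s_pos]]
    has_real_derivative_of_real_axis(1)[OF th_DERIV(3)[OF s_pos]] has_real_derivative_of_real_axis(1)[OF th_DERIV(4)[OF s_pos]]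
  unfolding R1_def R2_def R3_def R4_def D1_def D2_def D3_def D4_def by (simp_all add: R_of_real)

lemma D_of_real:
  "deriv (th1 s) (of_real x) = of_real (D1 x)" "deriv (th2 s) (of_real x) = of_real (D2 x)"
  "deriv (th3 s) (of_real x) = of_real (D3 x)" "deriv (th4 s) (of_real x) = of_real (D4 x)"
  using has_real_derivative_of_real_axis(2)[OF th_DERIV(1)[OF s_pos]] has_real_derivative_of_real_axis(2)[OF th_DERIV(2)[OF s_pos]]
    has_real_derivative_of_real_axis(2)[OF th_DERIV(3)[OF s_pos]] has_real_derivative_of_real_axis(2)[OF th_DERIV(4)[OF s_pos]]
  unfolding D1_def D2_def D3_def D4_def by (auto simp: complex_eq_iff R_of_real)

lemma D4_DERIV: "(D4 has_real_derivative DD4 x) (at x)"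
proof -
  have "deriv (th4 s) holomorphic_on UNIV" using th_holomorphic_i(4)[OF s_pos] by (intro holomorphic_deriv) auto
  then have "(deriv (th4 s) has_field_derivative deriv (deriv (th4 s)) (of_real x)) (at (of_real x))"
    by (auto intro: holomorphic_derivI)
  from has_real_derivative_of_real_axis(1)[OF this] show ?thesis
    unfolding D4_def DD4_def by (simp add: D_of_real)
qed

lemma R_cont:
  "continuous_on S R1" "continuous_on S R2" "continuous_on S R3" "continuous_on S R4"
  using R_DERIV[THEN DERIV_isCont] by (auto intro!: continuous_at_imp_continuous_on)

lemma R_shift:
  "R1 (x + pi / 2) = R2 x" "R2 (x + pi / 2) = - R1 x" "R3 (x + pi / 2) = R4 x" "R4 (x + pi / 2) = R3 x"
  using th1_add_half_pi[of s "of_real x"] th2_add_half_pi[OF s_pos, of "of_real x"] th3_add_half_pi[of s "of_real x"] th4_add_half_pi[OF s_pos, of "of_real x"]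
  unfolding of_real_add [symmetric] R_of_real of_real_minus [symmetric] of_real_eq_iff by simp_all

lemma R_minus: "R1 (- x) = - R1 x" "R2 (- x) = R2 x" "R3 (- x) = R3 x" "R4 (- x) = R4 x"
  using th1_minus[OF s_pos, of "of_real x"] th2_minus[OF s_pos, of "of_real x"] th3_minus[OF s_pos, of "of_real x"] th4_minus[OF s_pos, of "of_real x"]
  unfolding R_of_real of_real_minus [symmetric] of_real_eq_iff by simp_all

lemma R1_0 [simp]: "R1 0 = 0" using R_minus(1)[of 0] by simp

lemma c_pos: "c2 > 0" "c3 > 0"
  using th2_0_pos[OF s_pos] th3_0_pos[OF s_pos] by (simp_all add: R2_def R3_def)

lemma R34_pos: "R3 x > 0" "R4 x > 0"
proof -
  have nz: "R4 x \<noteq> 0" for x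
    using th4_nonzero[OF s_pos, of "of_real x"] s_pos by (simp add: R_of_real)
  have "R4 x > 0" for x
    by (rule continuous_nonzero_pos[of UNIV R4 "pi / 2"]) (use R_cont nz R_shift(4)[of 0] c_pos in auto)
  then show "R3 x > 0" "R4 x > 0" using R_shift(3)[of "x - pi / 2"] R_shift(4)[of x] by simp_all
qed

lemma c4_pos: "c4 > 0" using R34_pos by blast

lemma R1_pos: "0 < x \<Longrightarrow> x < pi \<Longrightarrow> R1 x > 0"
proof -
  assume x: "0 < x" "x < pi"
  have nz: "R1 x \<noteq> 0" if "x \<in> {0<..<pi}" for x
    using th1_real_nonzero[OF s_pos, of x] that by (simp add: R_of_real)
  show ?thesis
    by (rule continuous_nonzero_pos[of "{0<..<pi}" R1 "pi / 2"]) (use R_cont nz R_shift(1)[of 0] c_pos x in auto)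
qed

lemma R2_pos: "\<bar>x\<bar> < pi / 2 \<Longrightarrow> R2 x > 0"
  using R1_pos[of "x + pi / 2"] by (auto simp: R_shift)

lemma R_square_relations:
  "(R4 x)\<^sup>2 * c3\<^sup>2 = (R1 x)\<^sup>2 * c2\<^sup>2 + (R3 x)\<^sup>2 * c4\<^sup>2"
  "(R4 x)\<^sup>2 * c2\<^sup>2 = (R1 x)\<^sup>2 * c3\<^sup>2 + (R2 x)\<^sup>2 * c4\<^sup>2"
  using th_square_relations(1,2)[OF s_pos, of "of_real x"]
  unfolding R_of_real c_of_real of_real_power [symmetric] of_real_mult [symmetric] of_real_add [symmetric] of_real_eq_iff
  by simp_all

lemma c_quartic: "c3 ^ 4 = c2 ^ 4 + c4 ^ 4"
  using th_quartic[OF s_pos]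
  unfolding c_of_real of_real_power [symmetric] of_real_mult [symmetric] of_real_add [symmetric] of_real_eq_iff .

text \<open>The constant of all Wronskians, read off at 0. It stays an unknown positive number,
  which avoids proving Jacobi's derivative formula for \<open>D1 0\<close>.\<close>

definition "mu = D1 0 * c4 / (c2 * c3)"

lemma th_wronskian:
  "deriv (th1 s) x * th4 s x - th1 s x * deriv (th4 s) x = of_real mu * (th2 s x * th3 s x)"
  "deriv (th2 s) x * th3 s x - th2 s x * deriv (th3 s) x = - of_real mu * (th1 s x * th4 s x)"
proof -
  obtain c where c: "\<And>x. deriv (th1 s) x * th4 s x - th1 s x * deriv (th4 s) x = c * (th2 s x * th3 s x)"
    "\<And>x. deriv (th2 s) x * th3 s x - th2 s x * deriv (th3 s) x = - c * (th1 s x * th4 s x)"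
    using th_wronskians[OF s_pos] by blast
  have "c = of_real mu"
    using c(1)[of 0] D_of_real(1)[of 0] R_of_real[of 0] c_pos by (simp add: mu_def field_simps)
  then show "deriv (th1 s) x * th4 s x - th1 s x * deriv (th4 s) x = of_real mu * (th2 s x * th3 s x)"
    "deriv (th2 s) x * th3 s x - th2 s x * deriv (th3 s) x = - of_real mu * (th1 s x * th4 s x)"
    using c by simp_all
qed

lemma R_wronskian: "D1 x * R4 x - R1 x * D4 x = mu * (R2 x * R3 x)"
  "D2 x * R3 x - R2 x * D3 x = - mu * (R1 x * R4 x)"
  using th_wronskian[of "of_real x"]
  unfolding R_of_real D_of_real of_real_mult [symmetric] of_real_diff [symmetric] of_real_minus [symmetric] of_real_eq_iff
  by simp_all

text \<open>R1 / R4 rises from 0 to a positive value on [0, pi/2], and its derivative is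
  \<open>mu\<close> times a positive function, so the mean value theorem fixes the sign.\<close>

lemma mu_pos: "mu > 0"
proof -
  have "((\<lambda>x. R1 x / R4 x) has_real_derivative (D1 x * R4 x - R1 x * D4 x) / (R4 x * R4 x)) (at x)" for x
    using R34_pos(2)[of x] by (intro DERIV_divide R_DERIV) simp
  then have "((\<lambda>x. R1 x / R4 x) has_real_derivative mu * (R2 x * R3 x / (R4 x)\<^sup>2)) (at x)" for x
    unfolding R_wronskian by (simp add: power2_eq_square)
  from MVT2[of 0 "pi / 2" "\<lambda>x. R1 x / R4 x", OF _ this]
  obtain z where z: "0 < z" "z < pi / 2" "R1 (pi / 2) / R4 (pi / 2) = pi / 2 * (mu * (R2 z * R3 z / (R4 z)\<^sup>2))"
    by auto
  have "R1 (pi / 2) / R4 (pi / 2) > 0" using R1_pos[of "pi / 2"] R34_pos by simp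
  moreover have "R2 z * R3 z / (R4 z)\<^sup>2 > 0" using R2_pos[of z] z R34_pos[of z] by simp
  ultimately show ?thesis using z(3) by (metis mult_less_0_iff not_less pi_half_gt_zero zero_less_mult_iff mult_le_0_iff less_le_not_le)
qed

definition "kap = mu * c3\<^sup>2 / c4\<^sup>2"
definition "kk = c2\<^sup>2 / c3\<^sup>2"

lemma kap_pos: "kap > 0" using mu_pos c_pos c4_pos by (simp add: kap_def)

lemma kk_bounds: "0 < kk" "kk < 1"
proof -
  show "0 < kk" using c_pos by (simp add: kk_def)
  have "c2 ^ 4 < c3 ^ 4" using c_quartic c4_pos by simp
  then have "c2 < c3" using c_pos by (simp add: power_less_imp_less_base)
  then show "kk < 1" using c_pos by (simp add: kk_def power_strict_mono)
qed

lemma compl_kk: "compl_modulus kk = c4\<^sup>2 / c3\<^sup>2"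
proof -
  have "1 - kk\<^sup>2 = (c4\<^sup>2 / c3\<^sup>2)\<^sup>2"
  proof -
    have "kk\<^sup>2 + (c4\<^sup>2 / c3\<^sup>2)\<^sup>2 = (c2 ^ 4 + c4 ^ 4) / c3 ^ 4" by (simp add: kk_def power_divide add_divide_distrib)
    also have "\<dots> = 1" unfolding c_quartic[symmetric] using c_pos by simp
    finally show ?thesis by simp
  qed
  then show ?thesis using c_pos by (simp add: compl_modulus_def)
qed

text \<open>The Jacobi functions in the theta variable: their usual argument is kap x.\<close>

definition "sn x = c3 / c2 * (R1 x / R4 x)"
definition "cn x = c4 / c2 * (R2 x / R4 x)"
definition "dn x = c4 / c3 * (R3 x / R4 x)"

lemma sn_cn: "(sn x)\<^sup>2 + (cn x)\<^sup>2 = 1"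
proof -
  have "(sn x)\<^sup>2 + (cn x)\<^sup>2 = ((R1 x)\<^sup>2 * c3\<^sup>2 + (R2 x)\<^sup>2 * c4\<^sup>2) / ((R4 x)\<^sup>2 * c2\<^sup>2)"
    by (simp add: sn_def cn_def power_mult_distrib power_divide add_divide_distrib mult_ac)
  then show ?thesis
    unfolding R_square_relations(2)[symmetric] using R34_pos[of x] c_pos by simp
qed

lemma dn_sn: "(dn x)\<^sup>2 = 1 - kk\<^sup>2 * (sn x)\<^sup>2"
proof -
  have "kk\<^sup>2 * (sn x)\<^sup>2 = (R1 x)\<^sup>2 * c2\<^sup>2 / ((R4 x)\<^sup>2 * c3\<^sup>2)"
    using c_pos by (simp add: sn_def kk_def power_mult_distrib power_divide field_simps power2_eq_square)
  then have "(dn x)\<^sup>2 + kk\<^sup>2 * (sn x)\<^sup>2 = ((R1 x)\<^sup>2 * c2\<^sup>2 + (R3 x)\<^sup>2 * c4\<^sup>2) / ((R4 x)\<^sup>2 * c3\<^sup>2)"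
    by (simp add: dn_def power_mult_distrib power_divide add_divide_distrib mult_ac)
  also have "\<dots> = 1"
    unfolding R_square_relations(1)[symmetric] using R34_pos[of x] c_pos by simp
  finally show ?thesis by simp
qed

lemma dn_pos: "dn x > 0" using R34_pos[of x] c_pos c4_pos by (simp add: dn_def)

lemma sn_DERIV: "(sn has_real_derivative kap * cn x * dn x) (at x)"
proof -
  have "(sn has_real_derivative c3 / c2 * ((D1 x * R4 x - R1 x * D4 x) / (R4 x * R4 x))) (at x)"
    unfolding sn_def[abs_def] using R34_pos(2)[of x] by (intro DERIV_cmult DERIV_divide R_DERIV) simp
  then show ?thesis unfolding R_wronskian using c_pos c4_pos
    by (simp add: cn_def dn_def kap_def field_simps power2_eq_square)
qed

lemma ellK_kk: "ellK kk = kap * (pi / 2)" and ellE_kk: "((\<lambda>t. kap * (dn t)\<^sup>2) has_integral ellE kk) {0..pi/2}"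
proof -
  have sn: "sn 0 = 0" "sn (pi / 2) = 1"
    using R_shift(1)[of 0] R_shift(4)[of 0] c_pos by (simp_all add: sn_def)
  have cnp: "cn t > 0" if "0 < t" "t < pi / 2" for t
    using R2_pos[of t] R34_pos[of t] that c_pos c4_pos by (simp add: cn_def)
  have cont: "continuous_on {0..pi/2} sn"
    using sn_DERIV[THEN DERIV_isCont] by (auto intro!: continuous_at_imp_continuous_on)
  show "ellK kk = kap * (pi / 2)"
    by (rule elliptic_substitution(1)[OF kk_bounds kap_pos _ cont sn cnp sn_DERIV sn_cn dn_sn dn_pos]) auto
  show "((\<lambda>t. kap * (dn t)\<^sup>2) has_integral ellE kk) {0..pi/2}"
    by (rule elliptic_substitution(2)[OF kk_bounds kap_pos _ cont sn cnp sn_DERIV sn_cn dn_sn dn_pos]) auto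
qed

end

section \<open>Agreement of the real series with the complex ones\<close>

lemma real_theta1_eq: "s > 0 \<Longrightarrow> complex_of_real (theta1 x (exp (- s))) = th1 s (of_real x)"
proof -
  assume s: "s > 0"
  interpret theta_nome s using s by unfold_locales
  have "(\<lambda>j. complex_of_real (2 * ((-1) ^ j * (exp (- s) powr ((real j + 1/2)\<^sup>2)) * sin (of_nat (2*j+1) * x)))) sums of_real (R1 x)"
    using th_sums_pairs_half[OF s, of "of_real x - of_real (pi/2)"]
    unfolding cos_odd_mult_minus_pi_half th1_eq[symmetric] R_of_real
    by (simp add: mult_ac flip: sin_of_real)
  then have "(\<lambda>j. 2 * ((-1) ^ j * (exp (- s) powr ((real j + 1/2)\<^sup>2)) * sin (of_nat (2*j+1) * x))) sums R1 x"
    by (simp only: sums_of_real_iff)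
  from sums_mult[OF this, of "1/2"] have "theta1 x (exp (- s)) = R1 x"
    by (simp add: theta1_def sums_iff)
  then show ?thesis by (simp add: R_of_real)
qed

lemma real_theta2_eq: "s > 0 \<Longrightarrow> complex_of_real (theta2 x (exp (- s))) = th2 s (of_real x)"
proof -
  assume s: "s > 0"
  interpret theta_nome s using s by unfold_locales
  have "(\<lambda>j. complex_of_real (2 * ((exp (- s) powr ((real j + 1/2)\<^sup>2)) * cos (of_nat (2*j+1) * x)))) sums of_real (R2 x)"
    using th_sums_pairs_half[OF s, of "of_real x"]
    unfolding R_of_real by (simp add: mult_ac flip: cos_of_real)
  then have "(\<lambda>j. 2 * ((exp (- s) powr ((real j + 1/2)\<^sup>2)) * cos (of_nat (2*j+1) * x))) sums R2 x"
    by (simp only: sums_of_real_iff)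
  from sums_mult[OF this, of "1/2"] have "theta2 x (exp (- s)) = R2 x"
    by (simp add: theta2_def sums_iff)
  then show ?thesis by (simp add: R_of_real)
qed

lemma real_theta3_eq: "s > 0 \<Longrightarrow> complex_of_real (theta3 x (exp (- s))) = th3 s (of_real x)"
proof -
  assume s: "s > 0"
  interpret theta_nome s using s by unfold_locales
  have "(\<lambda>j. complex_of_real (2 * ((exp (- s) ^ ((j+1)\<^sup>2)) * cos (of_nat (2*(j+1)) * x)))) sums of_real (R3 x - 1)"
    using th_sums_pairs_int[OF s, of "of_real x"]
    unfolding R_of_real by (simp add: mult_ac flip: cos_of_real)
  then have "(\<lambda>j. 2 * ((exp (- s) ^ ((j+1)\<^sup>2)) * cos (of_nat (2*(j+1)) * x))) sums (R3 x - 1)"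
    by (simp only: sums_of_real_iff)
  from sums_mult[OF this, of "1/2"] have "theta3 x (exp (- s)) = R3 x"
    by (simp add: theta3_def sums_iff)
  then show ?thesis by (simp add: R_of_real)
qed

lemma real_theta4_eq: "s > 0 \<Longrightarrow> complex_of_real (theta4 x (exp (- s))) = th4 s (of_real x)"
proof -
  assume s: "s > 0"
  interpret theta_nome s using s by unfold_locales
  have "(\<lambda>j. complex_of_real (2 * ((-1) ^ (j+1) * (exp (- s) ^ ((j+1)\<^sup>2)) * cos (of_nat (2*(j+1)) * x)))) sums of_real (R4 x - 1)"
    using th_sums_pairs_int[OF s, of "of_real x + of_real (pi/2)"]
    unfolding cos_even_mult_plus_pi_half th4_eq[symmetric] R_of_real by (simp add: mult_ac flip: cos_of_real)
  then have "(\<lambda>j. 2 * ((-1) ^ (j+1) * (exp (- s) ^ ((j+1)\<^sup>2)) * cos (of_nat (2*(j+1)) * x))) sums (R4 x - 1)"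
    by (simp only: sums_of_real_iff)
  from sums_mult[OF this, of "1/2"] have "theta4 x (exp (- s)) = R4 x"
    by (simp add: theta4_def sums_iff)
  then show ?thesis by (simp add: R_of_real)
qed

text \<open>The second hypothesis is half the derivative of the first. Together with one known
  Wronskian these relations determine the other two up to the factor t2, which is cancelled at the
  end.\<close>

lemma wronskian_from_squares:
  fixes t1 t2 t3 t4 d1 d2 d4 c2 c3 c4 m :: "'a :: field"
  assumes "t4\<^sup>2 * c2\<^sup>2 = t1\<^sup>2 * c3\<^sup>2 + t2\<^sup>2 * c4\<^sup>2" "t4 * d4 * c2\<^sup>2 = t1 * d1 * c3\<^sup>2 + t2 * d2 * c4\<^sup>2"
    and "d1 * t4 - t1 * d4 = m * (t2 * t3)" "t2 \<noteq> 0"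
  shows "c4\<^sup>2 * (d1 * t2 - t1 * d2) = c2\<^sup>2 * m * (t3 * t4)"
    and "c4\<^sup>2 * (d2 * t4 - t2 * d4) = - (c3\<^sup>2 * m * (t1 * t3))"
proof -
  have "t2 * (c4\<^sup>2 * (d1 * t2 - t1 * d2)) = t2 * (c2\<^sup>2 * m * (t3 * t4))" using assms(1-3) by algebra
  then show "c4\<^sup>2 * (d1 * t2 - t1 * d2) = c2\<^sup>2 * m * (t3 * t4)" using assms(4) mult_left_cancel by blast
  have "t2 * (c4\<^sup>2 * (d2 * t4 - t2 * d4)) = t2 * (- (c3\<^sup>2 * m * (t1 * t3)))" using assms(1-3) by algebra
  then show "c4\<^sup>2 * (d2 * t4 - t2 * d4) = - (c3\<^sup>2 * m * (t1 * t3))" using assms(4) mult_left_cancel by blast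
qed

section \<open>Further Wronskians, the imaginary axis and the zeta function\<close>

context theta_nome begin

lemma th_wronskian_more:
  assumes "th2 s x \<noteq> 0"
  shows "of_real (c4\<^sup>2) * (deriv (th1 s) x * th2 s x - th1 s x * deriv (th2 s) x) = of_real (c2\<^sup>2 * mu) * (th3 s x * th4 s x)"
    and "of_real (c4\<^sup>2) * (deriv (th2 s) x * th4 s x - th2 s x * deriv (th4 s) x) = - of_real (c3\<^sup>2 * mu) * (th1 s x * th3 s x)"
proof -
  note rel = th_square_relations(2)[OF s_pos]
  have "((\<lambda>x. (th4 s x)\<^sup>2 * (th2 s 0)\<^sup>2) has_field_derivative 2 * (th4 s x * deriv (th4 s) x * (th2 s 0)\<^sup>2)) (at x)"
    by (rule derivative_eq_intros th_DERIV[OF s_pos] refl | simp)+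
  moreover have "((\<lambda>x. (th1 s x)\<^sup>2 * (th3 s 0)\<^sup>2 + (th2 s x)\<^sup>2 * (th4 s 0)\<^sup>2) has_field_derivative
     2 * (th1 s x * deriv (th1 s) x * (th3 s 0)\<^sup>2 + th2 s x * deriv (th2 s) x * (th4 s 0)\<^sup>2)) (at x)"
    by (rule derivative_eq_intros th_DERIV[OF s_pos] refl | simp add: algebra_simps)+
  ultimately have "2 * (th4 s x * deriv (th4 s) x * (th2 s 0)\<^sup>2) = 2 * (th1 s x * deriv (th1 s) x * (th3 s 0)\<^sup>2 + th2 s x * deriv (th2 s) x * (th4 s 0)\<^sup>2)"
    unfolding rel by (rule DERIV_unique)
  then have d: "th4 s x * deriv (th4 s) x * (th2 s 0)\<^sup>2 = th1 s x * deriv (th1 s) x * (th3 s 0)\<^sup>2 + th2 s x * deriv (th2 s) x * (th4 s 0)\<^sup>2"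
    by (simp only: mult_cancel_left) simp
  from wronskian_from_squares[OF rel d th_wronskian(1) assms]
  show "of_real (c4\<^sup>2) * (deriv (th1 s) x * th2 s x - th1 s x * deriv (th2 s) x) = of_real (c2\<^sup>2 * mu) * (th3 s x * th4 s x)"
    and "of_real (c4\<^sup>2) * (deriv (th2 s) x * th4 s x - th2 s x * deriv (th4 s) x) = - of_real (c3\<^sup>2 * mu) * (th1 s x * th3 s x)"
    by (simp_all add: c_of_real)
qed

text \<open>\<open>th1\<close> is odd and commutes with conjugation, hence purely imaginary on this
  axis; the other three are even and therefore real.\<close>

definition "J1 t = Im (th1 s (\<i> * of_real t))"
definition "J2 t = Re (th2 s (\<i> * of_real t))"
definition "J3 t = Re (th3 s (\<i> * of_real t))"
definition "J4 t = Re (th4 s (\<i> * of_real t))"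

lemma J_eq:
  "th1 s (\<i> * of_real t) = \<i> * of_real (J1 t)" "th2 s (\<i> * of_real t) = of_real (J2 t)"
  "th3 s (\<i> * of_real t) = of_real (J3 t)" "th4 s (\<i> * of_real t) = of_real (J4 t)"
proof -
  have c: "cnj (\<i> * of_real t) = - (\<i> * of_real t)" by simp
  show "th1 s (\<i> * of_real t) = \<i> * of_real (J1 t)" "th2 s (\<i> * of_real t) = of_real (J2 t)"
  "th3 s (\<i> * of_real t) = of_real (J3 t)" "th4 s (\<i> * of_real t) = of_real (J4 t)"
    using th_i_cnj[OF s_pos, of "\<i> * of_real t"]
    unfolding c th1_minus[OF s_pos] th2_minus[OF s_pos] th3_minus[OF s_pos] th4_minus[OF s_pos]
    by (auto simp: complex_eq_iff J1_def J2_def J3_def J4_def)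
qed

lemma J23_pos: "J2 t > 0" "J3 t > 0"
  using th_imaginary_pos(1)[OF s_pos] by (simp_all add: J2_def J3_def th2_def th3_def)

lemma J_cont: "continuous_on S J1" "continuous_on S J2" "continuous_on S J3" "continuous_on S J4"
proof -
  have *: "continuous_on S (\<lambda>t. f (\<i> * complex_of_real t))" if "f holomorphic_on UNIV" for f
    by (rule continuous_on_compose2[OF holomorphic_on_imp_continuous_on[OF that]]) (auto intro!: continuous_intros)
  note *[OF th_holomorphic_i(1)[OF s_pos]] *[OF th_holomorphic_i(2)[OF s_pos]]
    *[OF th_holomorphic_i(3)[OF s_pos]] *[OF th_holomorphic_i(4)[OF s_pos]]
  from this[THEN continuous_on_Re] this[THEN continuous_on_Im] show "continuous_on S J1" "continuous_on S J2" "continuous_on S J3" "continuous_on S J4"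
    unfolding J1_def[abs_def] J2_def[abs_def] J3_def[abs_def] J4_def[abs_def]
    by - assumption+
qed

lemma J4_pos: "\<bar>t\<bar> < s / 2 \<Longrightarrow> J4 t > 0"
proof -
  assume t: "\<bar>t\<bar> < s / 2"
  have nz: "J4 t \<noteq> 0" if "t \<in> {-s/2<..<s/2}" for t
  proof -
    have "\<bar>t\<bar> < s / 2" using that by (auto simp: abs_if)
    then show ?thesis using th4_nonzero[OF s_pos, of "\<i> * of_real t"] by (auto simp: J_eq)
  qed
  have "J4 0 > 0" using c4_pos by (simp add: J4_def R4_def)
  have "0 \<in> {-s/2<..<s/2}" "t \<in> {-s/2<..<s/2}" using t s_pos by (auto simp: abs_if split: if_splits)
  from continuous_nonzero_pos[OF J_cont(4) _ nz this(1) \<open>J4 0 > 0\<close> this(2)]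
  show ?thesis by simp
qed

text \<open>The imaginary half-period carries \<open>J1\<close> on (0, s) to \<open>J4\<close> on (-
  s / 2, s / 2), up to a positive exponential.\<close>

lemma J1_pos: "0 < t \<Longrightarrow> t < s \<Longrightarrow> J1 t > 0"
proof -
  assume t: "0 < t" "t < s"
  have "th1 s (\<i> * of_real t) = \<i> * exp (of_real (s / 4) - \<i> * (\<i> * of_real (t - s / 2))) * th4 s (\<i> * of_real (t - s / 2))"
    using th_quasi_period(1)[OF s_pos, of "\<i> * of_real (t - s / 2)"] by (simp add: algebra_simps)
  also have "exp (of_real (s / 4) - \<i> * (\<i> * of_real (t - s / 2))) = complex_of_real (exp (t - s / 4))"
    unfolding exp_of_real [symmetric] by (rule arg_cong[of _ _ exp]) (simp add: algebra_simps)
  finally have "J1 t = exp (t - s / 4) * J4 (t - s / 2)"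
    unfolding J_eq by (simp add: complex_eq_iff)
  moreover have "\<bar>t - s / 2\<bar> < s / 2" using t by (auto simp: abs_less_iff field_simps)
  ultimately show ?thesis using J4_pos[of "t - s / 2"] by simp
qed

lemma J_half_period: "J4 (s / 2) = 0" "J1 (s / 2) = exp (s / 4) * c4" "J2 (s / 2) = exp (s / 4) * c3"
proof -
  have e: "exp (complex_of_real (s / 4)) = of_real (exp (s / 4))" by (rule exp_of_real)
  show "J4 (s / 2) = 0" "J1 (s / 2) = exp (s / 4) * c4" "J2 (s / 2) = exp (s / 4) * c3"
    using th_quasi_period[OF s_pos, of 0] th1_0[OF s_pos]
    unfolding J1_def J2_def J4_def by (simp_all add: c_of_real e del: of_real_divide)
qed

lemma J_square_relations:
  "(J4 t)\<^sup>2 * c2\<^sup>2 = - (J1 t)\<^sup>2 * c3\<^sup>2 + (J2 t)\<^sup>2 * c4\<^sup>2"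
  "(J2 t)\<^sup>2 * c3\<^sup>2 = (J3 t)\<^sup>2 * c2\<^sup>2 + (J1 t)\<^sup>2 * c4\<^sup>2"
proof -
  have "complex_of_real ((J4 t)\<^sup>2 * c2\<^sup>2) = of_real (- (J1 t)\<^sup>2 * c3\<^sup>2 + (J2 t)\<^sup>2 * c4\<^sup>2)"
    "complex_of_real ((J2 t)\<^sup>2 * c3\<^sup>2) = of_real ((J3 t)\<^sup>2 * c2\<^sup>2 + (J1 t)\<^sup>2 * c4\<^sup>2)"
    using th_square_relations(2,3)[OF s_pos, of "\<i> * of_real t"] unfolding J_eq c_of_real
    by (simp_all add: power_mult_distrib)
  then show "(J4 t)\<^sup>2 * c2\<^sup>2 = - (J1 t)\<^sup>2 * c3\<^sup>2 + (J2 t)\<^sup>2 * c4\<^sup>2"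
    "(J2 t)\<^sup>2 * c3\<^sup>2 = (J3 t)\<^sup>2 * c2\<^sup>2 + (J1 t)\<^sup>2 * c4\<^sup>2"
    by (simp_all only: of_real_eq_iff)
qed

lemma J12_DERIV: "((\<lambda>t. J1 t / J2 t) has_real_derivative c2\<^sup>2 / c4\<^sup>2 * mu * (J3 t * J4 t) / (J2 t)\<^sup>2) (at t)"
proof -
  have nz: "th2 s (\<i> * of_real t) \<noteq> 0" using J23_pos[of t] by (simp add: J_eq)
  let ?x = "\<i> * of_real t"
  have "((\<lambda>x. th1 s x / th2 s x) has_field_derivative 
     (deriv (th1 s) ?x * th2 s ?x - th1 s ?x * deriv (th2 s) ?x) / (th2 s ?x * th2 s ?x)) (at ?x)"
    by (intro DERIV_divide th_DERIV s_pos nz)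
  moreover have "deriv (th1 s) ?x * th2 s ?x - th1 s ?x * deriv (th2 s) ?x = of_real (c2\<^sup>2 * mu) * (th3 s ?x * th4 s ?x) / of_real (c4\<^sup>2)"
    using th_wronskian_more(1)[OF nz] c4_pos by (simp add: field_simps)
  ultimately have "((\<lambda>x. th1 s x / th2 s x) has_field_derivative of_real (c2\<^sup>2 / c4\<^sup>2 * mu * (J3 t * J4 t) / (J2 t)\<^sup>2)) (at ?x)"
    unfolding J_eq by (simp add: power2_eq_square)
  from bounded_linear.has_vector_derivative[OF bounded_linear_Im has_vector_derivative_imaginary_axis[OF this]]
  show ?thesis
    unfolding J_eq by (simp add: has_real_derivative_iff_has_vector_derivative)
qed

text \<open>Jacobi's imaginary transformation: on the imaginary axis \<open>sn / cn\<close> plays the role of \<open>sn\<close> for the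
  complementary modulus.\<close>

lemma ellK_compl_kk: "ellK (compl_modulus kk) = kap * (s / 2)"
proof (rule elliptic_substitution(1)[where S = "\<lambda>t. c3 / c4 * (J1 t / J2 t)" and C = "\<lambda>t. c2 / c4 * (J4 t / J2 t)"
      and D = "\<lambda>t. c2 / c3 * (J3 t / J2 t)"])
  show "0 < compl_modulus kk" "compl_modulus kk < 1" 
    using c_pos c4_pos c_quartic power_less_imp_less_base[of c4 4 c3] by (auto simp: compl_kk power_strict_mono)
  show "continuous_on {0..s / 2} (\<lambda>t. c3 / c4 * (J1 t / J2 t))"
    using J23_pos by (intro continuous_intros J_cont) (auto simp: less_imp_neq[symmetric] intro: less_imp_neq)
  show "c3 / c4 * (J1 0 / J2 0) = 0" by (simp add: J1_def th1_0 s_pos)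
  show "c3 / c4 * (J1 (s/2) / J2 (s/2)) = 1" using c_pos c4_pos by (simp add: J_half_period)
  show "0 < c2 / c4 * (J4 t / J2 t)" if "0 < t" "t < s / 2" for t
    using J4_pos[of t] J23_pos[of t] that c_pos c4_pos by simp
  show "((\<lambda>t. c3 / c4 * (J1 t / J2 t)) has_real_derivative
            kap * (c2 / c4 * (J4 t / J2 t)) * (c2 / c3 * (J3 t / J2 t))) (at t)" for t
    using DERIV_cmult[OF J12_DERIV[of t], of "c3 / c4"] c_pos c4_pos J23_pos[of t]
    by (simp add: kap_def field_simps power2_eq_square)
  show "(c3 / c4 * (J1 t / J2 t))\<^sup>2 + (c2 / c4 * (J4 t / J2 t))\<^sup>2 = 1" for t
  proof -
    have "(c3 / c4 * (J1 t / J2 t))\<^sup>2 + (c2 / c4 * (J4 t / J2 t))\<^sup>2 = ((J1 t)\<^sup>2 * c3\<^sup>2 + (J4 t)\<^sup>2 * c2\<^sup>2) / ((J2 t)\<^sup>2 * c4\<^sup>2)"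
      by (simp add: power_mult_distrib power_divide add_divide_distrib mult_ac)
    then show ?thesis using J_square_relations(1)[of t] c4_pos J23_pos[of t] by simp
  qed
  show "(c2 / c3 * (J3 t / J2 t))\<^sup>2 = 1 - (compl_modulus kk)\<^sup>2 * (c3 / c4 * (J1 t / J2 t))\<^sup>2" for t
  proof -
    have "(compl_modulus kk)\<^sup>2 * (c3 / c4 * (J1 t / J2 t))\<^sup>2 = (J1 t)\<^sup>2 * c4\<^sup>2 / ((J2 t)\<^sup>2 * c3\<^sup>2)"
      using c_pos c4_pos by (simp add: compl_kk power_mult_distrib power_divide field_simps power2_eq_square)
    then have "(c2 / c3 * (J3 t / J2 t))\<^sup>2 + (compl_modulus kk)\<^sup>2 * (c3 / c4 * (J1 t / J2 t))\<^sup>2 = ((J3 t)\<^sup>2 * c2\<^sup>2 + (J1 t)\<^sup>2 * c4\<^sup>2) / ((J2 t)\<^sup>2 * c3\<^sup>2)"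
      by (simp add: power_mult_distrib power_divide add_divide_distrib mult_ac)
    also have "\<dots> = 1" unfolding J_square_relations(2)[symmetric] using c_pos J23_pos[of t] by simp
    finally show ?thesis by simp
  qed
  show "0 < c2 / c3 * (J3 t / J2 t)" for t using J23_pos[of t] c_pos by simp
qed (use kap_pos s_pos in auto)

definition "Z x = D4 x / R4 x"

lemma DERIV_reflect_zero:
  fixes f :: "real \<Rightarrow> real"
  assumes "(f has_real_derivative d) (at a)" "\<And>x. f (2 * a - x) = f x"
  shows "d = 0"
proof -
  have "((\<lambda>x. 2 * a - x) has_real_derivative -1) (at a)" by (auto intro!: derivative_eq_intros)
  from DERIV_chain2[of f d "\<lambda>x. 2 * a - x", OF _ this] have "(f has_real_derivative - d) (at a)"
    using assms by simp
  from DERIV_unique[OF assms(1) this] show ?thesis by simp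
qed

lemma D4_0: "D4 0 = 0" "D4 (pi / 2) = 0"
proof -
  show "D4 0 = 0" by (rule DERIV_reflect_zero[OF R_DERIV(4)]) (simp add: R_minus)
  have "R4 (pi - x) = R4 x" for x
    using R_shift(4)[of "pi/2 - x"] R_shift(3)[of "-x"] R_minus(4)[of x] by (simp add: algebra_simps)
  then show "D4 (pi / 2) = 0" by (intro DERIV_reflect_zero[OF R_DERIV(4)]) simp
qed

lemma R4_addition: "R4 (x + y) * R4 (x - y) * c4\<^sup>2 = (R4 x)\<^sup>2 * (R4 y)\<^sup>2 - (R1 x)\<^sup>2 * (R1 y)\<^sup>2"
  using th4_addition[OF s_pos, of "of_real x" "of_real y"]
  unfolding of_real_add [symmetric] of_real_diff [symmetric] R_of_real c_of_real of_real_power [symmetric] of_real_mult [symmetric] of_real_eq_iff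
  by (simp only: of_real_diff [symmetric] of_real_eq_iff)

text \<open>The second derivative of \<open>R4_addition\<close> in y at y = 0; divided by the square
  of R4 it computes the derivative of the logarithmic derivative of R4.\<close>

lemma R4_second_derivative: "c4\<^sup>2 * (R4 x * DD4 x - (D4 x)\<^sup>2) = (R4 x)\<^sup>2 * c4 * DD4 0 - (R1 x)\<^sup>2 * (D1 0)\<^sup>2"
proof -
  have 1: "((\<lambda>y. R4 (x + y) * R4 (x - y) * c4\<^sup>2) has_real_derivative
      (D4 (x + y) * R4 (x - y) - R4 (x + y) * D4 (x - y)) * c4\<^sup>2) (at y)" for y
    by (rule derivative_eq_intros DERIV_chain2[OF R_DERIV(4)] refl | simp)+
  have 2: "((\<lambda>y. (R4 x)\<^sup>2 * (R4 y)\<^sup>2 - (R1 x)\<^sup>2 * (R1 y)\<^sup>2) has_real_derivative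
      2 * (R4 x)\<^sup>2 * R4 y * D4 y - 2 * (R1 x)\<^sup>2 * R1 y * D1 y) (at y)" for y
    by (rule derivative_eq_intros R_DERIV refl | simp)+
  have "(D4 (x + y) * R4 (x - y) - R4 (x + y) * D4 (x - y)) * c4\<^sup>2 = 2 * (R4 x)\<^sup>2 * R4 y * D4 y - 2 * (R1 x)\<^sup>2 * R1 y * D1 y" for y
    using DERIV_unique[OF 1[of y, unfolded R4_addition] 2] .
  then have eq: "(\<lambda>y. (D4 (x + y) * R4 (x - y) - R4 (x + y) * D4 (x - y)) * c4\<^sup>2) = (\<lambda>y. 2 * (R4 x)\<^sup>2 * (R4 y * D4 y) - 2 * (R1 x)\<^sup>2 * (R1 y * D1 y))"
    by (simp add: mult_ac)
  have 3: "((\<lambda>y. (D4 (x + y) * R4 (x - y) - R4 (x + y) * D4 (x - y)) * c4\<^sup>2) has_real_derivative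
       2 * (R4 x * DD4 x - (D4 x)\<^sup>2) * c4\<^sup>2) (at 0)"
    by (rule derivative_eq_intros DERIV_chain2[OF R_DERIV(4)] DERIV_chain2[OF D4_DERIV] refl | simp add: power2_eq_square)+
  have D1': "((\<lambda>y. R1 y * D1 y) has_real_derivative (D1 0)\<^sup>2) (at 0)"
  proof -
    have "deriv (th1 s) holomorphic_on UNIV" using th_holomorphic_i(1)[OF s_pos] by (intro holomorphic_deriv) auto
    then have "(deriv (th1 s) has_field_derivative deriv (deriv (th1 s)) (of_real 0)) (at (of_real 0))"
      by (auto intro: holomorphic_derivI)
    from has_real_derivative_of_real_axis(1)[OF this]
    have "(D1 has_real_derivative Re (deriv (deriv (th1 s)) (of_real 0))) (at 0)"
      unfolding D1_def by (simp add: D_of_real)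
    from DERIV_mult[OF R_DERIV(1)[of 0] this] show ?thesis by (simp add: power2_eq_square)
  qed
  have D4': "((\<lambda>y. R4 y * D4 y) has_real_derivative c4 * DD4 0) (at 0)"
    using DERIV_mult[OF R_DERIV(4)[of 0] D4_DERIV[of 0]] by (simp add: D4_0 mult.commute)
  have "((\<lambda>y. 2 * (R4 x)\<^sup>2 * (R4 y * D4 y) - 2 * (R1 x)\<^sup>2 * (R1 y * D1 y)) has_real_derivative
      2 * (R4 x)\<^sup>2 * (c4 * DD4 0) - 2 * (R1 x)\<^sup>2 * (D1 0)\<^sup>2) (at 0)"
    by (intro DERIV_diff DERIV_cmult D1' D4')
  from DERIV_unique[OF 3[unfolded eq] this] show ?thesis by (simp add: algebra_simps)
qed

lemma Z_DERIV:
  obtains b where "\<And>x. (Z has_real_derivative kap\<^sup>2 * (dn x)\<^sup>2 + b) (at x)"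
proof -
  define b where "b = DD4 0 / c4 - mu\<^sup>2 * c3 ^ 4 / c4 ^ 4"
  have "(Z has_real_derivative kap\<^sup>2 * (dn x)\<^sup>2 + b) (at x)" for x
  proof -
    have "(Z has_real_derivative (DD4 x * R4 x - D4 x * D4 x) / (R4 x * R4 x)) (at x)"
      unfolding Z_def[abs_def] using R34_pos(2)[of x] by (intro DERIV_divide R_DERIV D4_DERIV) simp
    moreover have "(DD4 x * R4 x - D4 x * D4 x) / (R4 x * R4 x) = kap\<^sup>2 * (dn x)\<^sup>2 + b"
    proof -
      have D1: "D1 0 = mu * c2 * c3 / c4" using c_pos c4_pos by (simp add: mu_def)
      have r: "(R1 x)\<^sup>2 = ((R4 x)\<^sup>2 * c3\<^sup>2 - (R3 x)\<^sup>2 * c4\<^sup>2) / c2\<^sup>2"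
        using R_square_relations(1)[of x] c_pos by (simp add: field_simps)
      have "DD4 x * R4 x - D4 x * D4 x = ((R4 x)\<^sup>2 * c4 * DD4 0 - (R1 x)\<^sup>2 * (D1 0)\<^sup>2) / c4\<^sup>2"
        using R4_second_derivative[of x] c4_pos by (simp add: field_simps power2_eq_square)
      also have "\<dots> = (R4 x)\<^sup>2 * (DD4 0 / c4) - ((R4 x)\<^sup>2 * c3\<^sup>2 - (R3 x)\<^sup>2 * c4\<^sup>2) * mu\<^sup>2 * c3\<^sup>2 / c4 ^ 4"
        unfolding r D1 using c_pos c4_pos by (simp add: field_simps power2_eq_square power4_eq_xxxx)
      also have "\<dots> = (R4 x)\<^sup>2 * (kap\<^sup>2 * (dn x)\<^sup>2 + b)"
        using c_pos c4_pos R34_pos[of x] by (simp add: kap_def dn_def b_def field_simps power2_eq_square power4_eq_xxxx)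
      finally show ?thesis using R34_pos(2)[of x] by (simp add: power2_eq_square)
    qed
    ultimately show ?thesis by simp
  qed
  then show ?thesis using that by blast
qed

text \<open>The constant b left open in \<open>Z_DERIV\<close> is fixed by integrating over a
  quarter period: Z vanishes at 0 and at pi/2, while the integral of dn^2 is E / kap. This is how E
  / K enters.\<close>

lemma Z_DERIV_E: "(Z has_real_derivative kap\<^sup>2 * ((dn x)\<^sup>2 - ellE kk / ellK kk)) (at x)"
proof -
  obtain b where b: "\<And>x. (Z has_real_derivative kap\<^sup>2 * (dn x)\<^sup>2 + b) (at x)" using Z_DERIV by blast
  have "((\<lambda>x. kap\<^sup>2 * (dn x)\<^sup>2 + b) has_integral (Z (pi/2) - Z 0)) {0..pi/2}"
    by (rule fundamental_theorem_of_calculus)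
       (auto simp flip: has_real_derivative_iff_has_vector_derivative intro: b has_field_derivative_at_within)
  then have 0: "((\<lambda>x. kap\<^sup>2 * (dn x)\<^sup>2 + b) has_integral 0) {0..pi/2}" by (simp add: Z_def D4_0)
  have "((\<lambda>x. kap * (kap * (dn x)\<^sup>2) + b) has_integral (kap * ellE kk + b * (pi / 2))) {0..pi/2}"
    using has_integral_add[OF has_integral_mult_right[OF ellE_kk, of kap] has_integral_const_real[of b 0 "pi/2"]]
    by (simp add: mult_ac)
  then have "kap * ellE kk + b * (pi / 2) = 0"
    using has_integral_unique[OF 0] by (simp add: power2_eq_square mult_ac)
  then have "b = - kap\<^sup>2 * (ellE kk / ellK kk)"
    using kap_pos by (simp add: ellK_kk field_simps power2_eq_square)
  then show ?thesis using b[of x] by (simp add: algebra_simps)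
qed

end

section \<open>Injectivity of the nome as a function of the modulus\<close>

lemma compl_modulus_bounds: "0 < k \<Longrightarrow> k < 1 \<Longrightarrow> 0 < compl_modulus k" "0 < k \<Longrightarrow> k < 1 \<Longrightarrow> compl_modulus k < 1"
  by (auto simp: compl_modulus_def abs_square_less_1)

lemma compl_modulus_antimono: "0 < k \<Longrightarrow> k < l \<Longrightarrow> l < 1 \<Longrightarrow> compl_modulus l < compl_modulus k"
  by (simp add: compl_modulus_def power_strict_mono)

text \<open>\<open>kk\<close> and \<open>k\<close> have the same ratio of complete integrals, and this ratio is strictly monotone.\<close>

lemma modulus_of_nome:
  assumes k: "0 < k" "k < 1"
  defines "s \<equiv> pi * ellK (compl_modulus k) / ellK k"
  shows "s > 0" "nome k = exp (- s)" "theta_nome.kk s = k"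
proof -
  have K: "ellK k > 0" "ellK (compl_modulus k) > 0" using ellK_pos compl_modulus_bounds k by auto
  show s: "s > 0" using K by (simp add: s_def)
  show "nome k = exp (- s)" by (simp add: nome_def s_def)
  interpret theta_nome s using s by unfold_locales
  have r: "ellK (compl_modulus kk) * ellK k = ellK (compl_modulus k) * ellK kk"
  proof -
    have "ellK (compl_modulus kk) * ellK k = kap / 2 * (s * ellK k)" by (simp add: ellK_compl_kk)
    also have "s * ellK k = pi * ellK (compl_modulus k)" using K by (simp add: s_def)
    finally show ?thesis by (simp add: ellK_kk)
  qed
  have K': "ellK kk > 0" "ellK (compl_modulus kk) > 0" using ellK_pos compl_modulus_bounds kk_bounds by auto
  show "kk = k"
  proof (rule ccontr)
    assume "kk \<noteq> k"
    then consider "kk < k" | "k < kk" by linarith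
    then show False
    proof cases
      case 1
      have "ellK kk < ellK k" using 1 kk_bounds k by (intro ellK_strict_mono) auto
      moreover have "ellK (compl_modulus k) < ellK (compl_modulus kk)"
        using 1 kk_bounds k by (intro ellK_strict_mono compl_modulus_antimono compl_modulus_bounds) auto
      ultimately have "ellK (compl_modulus k) * ellK kk < ellK (compl_modulus kk) * ellK k"
        using K K' by (intro mult_strict_mono) auto
      then show False using r by simp
    next
      case 2
      have "ellK k < ellK kk" using 2 kk_bounds k by (intro ellK_strict_mono) auto
      moreover have "ellK (compl_modulus kk) < ellK (compl_modulus k)"
        using 2 kk_bounds k by (intro ellK_strict_mono compl_modulus_antimono compl_modulus_bounds) auto
      ultimately have "ellK (compl_modulus kk) * ellK k < ellK (compl_modulus k) * ellK kk"
        using K K' by (intro mult_strict_mono) auto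
      then show False using r by simp
    qed
  qed
qed

section \<open>The uniformization on the imaginary axis\<close>

lemma axis_double: "2 * (\<i> * complex_of_real t) = \<i> * of_real (2 * t)" and real_double: "2 * complex_of_real x = of_real (2 * x)"
  by simp_all

lemma ii_mult: "\<i> * x * (\<i> * y) = - (x * y)" for x y :: complex
proof -
  have "\<i> * x * (\<i> * y) = (\<i> * \<i>) * (x * y)" by (simp only: mult_ac)
  then show ?thesis by simp
qed

context theta_nome begin

definition "df x = deriv (th1 s) x * th3 s x + th1 s x * deriv (th3 s) x"
definition "dg x = deriv (th2 s) x * th4 s x + th2 s x * deriv (th4 s) x"

lemma thf_DERIV: "(thf s has_field_derivative df x) (at x)"
  unfolding thf_def[abs_def] df_def using DERIV_mult[OF th_DERIV(1)[OF s_pos] th_DERIV(3)[OF s_pos]]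
  by (simp add: algebra_simps)

lemma thg_DERIV: "(thg s has_field_derivative dg x) (at x)"
  unfolding thg_def[abs_def] dg_def using DERIV_mult[OF th_DERIV(2)[OF s_pos] th_DERIV(4)[OF s_pos]]
  by (simp add: algebra_simps)

lemma thfg_wronskian: "df x * thg s x - thf s x * dg x = of_real mu * ((th2 s x)\<^sup>2 * (th3 s x)\<^sup>2 + (th1 s x)\<^sup>2 * (th4 s x)\<^sup>2)"
proof -
  have "df x * thg s x - thf s x * dg x =
     (th2 s x * th3 s x) * (deriv (th1 s) x * th4 s x - th1 s x * deriv (th4 s) x)
     - (th1 s x * th4 s x) * (deriv (th2 s) x * th3 s x - th2 s x * deriv (th3 s) x)"
    unfolding df_def dg_def thf_def thg_def by (simp add: algebra_simps)
  then show ?thesis unfolding th_wronskian by (simp add: power2_eq_square algebra_simps)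
qed

lemma thf_minus: "thf s (- x) = - thf s x" and thg_minus: "thg s (- x) = thg s x"
  by (simp_all add: thf_def thg_def th1_minus th2_minus th3_minus th4_minus s_pos)

text \<open>\<open>thf\<close> is odd and \<open>thg\<close> even, so along i t they equal i F and G
  with real F and G. W is the Wronskian of F and G divided by \<open>mu\<close>.\<close>

definition "F t = J1 t * J3 t"
definition "G t = J2 t * J4 t"
definition "dF t = Re (df (\<i> * of_real t))"
definition "dG t = - Im (dg (\<i> * of_real t))"
definition "W t = (J2 t)\<^sup>2 * (J3 t)\<^sup>2 - (J1 t)\<^sup>2 * (J4 t)\<^sup>2"

lemma thfg_axis: "thf s (\<i> * of_real t) = \<i> * of_real (F t)" "thg s (\<i> * of_real t) = of_real (G t)"
  by (simp_all add: thf_def thg_def F_def G_def J_eq)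

lemma FG_DERIV:
  "(F has_real_derivative dF t) (at t)" "(G has_real_derivative dG t) (at t)"
  "df (\<i> * of_real t) = of_real (dF t)" "dg (\<i> * of_real t) = - \<i> * of_real (dG t)"
proof -
  note vf = has_vector_derivative_imaginary_axis[OF thf_DERIV, of t, unfolded thfg_axis]
  note vg = has_vector_derivative_imaginary_axis[OF thg_DERIV, of t, unfolded thfg_axis]
  from bounded_linear.has_vector_derivative[OF bounded_linear_Im vf]
  show "(F has_real_derivative dF t) (at t)" by (simp add: dF_def has_real_derivative_iff_has_vector_derivative)
  from bounded_linear.has_vector_derivative[OF bounded_linear_Re vg]
  show "(G has_real_derivative dG t) (at t)" by (simp add: dG_def has_real_derivative_iff_has_vector_derivative)
  from bounded_linear.has_vector_derivative[OF bounded_linear_Re vf]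
  have "((\<lambda>t. 0 :: real) has_vector_derivative - Im (df (\<i> * of_real t))) (at t)" by simp
  then have "Im (df (\<i> * of_real t)) = 0" using vector_derivative_unique_at[OF has_vector_derivative_const] by fastforce
  then show "df (\<i> * of_real t) = of_real (dF t)" by (simp add: dF_def complex_eq_iff)
  from bounded_linear.has_vector_derivative[OF bounded_linear_Im vg]
  have "((\<lambda>t. 0 :: real) has_vector_derivative Re (dg (\<i> * of_real t))) (at t)" by simp
  then have "Re (dg (\<i> * of_real t)) = 0" using vector_derivative_unique_at[OF has_vector_derivative_const] by fastforce
  then show "dg (\<i> * of_real t) = - \<i> * of_real (dG t)" by (simp add: dG_def complex_eq_iff)
qed

lemma FG_wronskian: "dF t * G t - F t * dG t = mu * W t"
proof -
  have "complex_of_real (dF t * G t - F t * dG t) = of_real (mu * W t)"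
    using thfg_wronskian[of "\<i> * of_real t"] unfolding thfg_axis FG_DERIV J_eq W_def
    by (simp add: power_mult_distrib ii_mult)
  then show ?thesis by (simp only: of_real_eq_iff)
qed

text \<open>The difference defining W is, by duplication, a positive multiple of J3 at 2 t.\<close>

lemma W_pos: "W t > 0"
proof -
  have "complex_of_real (W t) = of_real (c2\<^sup>2 * c3 * J3 (2 * t))"
    using th3_duplication[OF s_pos, of "\<i> * of_real t"] unfolding axis_double J_eq W_def c_of_real
    by (simp add: power_mult_distrib mult_ac)
  then have "W t = c2\<^sup>2 * c3 * J3 (2 * t)" by (simp only: of_real_eq_iff)
  then show ?thesis using c_pos J23_pos by simp
qed

lemma W_square: "(W t)\<^sup>2 = ((G t)\<^sup>2 - (F t)\<^sup>2)\<^sup>2 + (c2 / c4) ^ 4 * ((G t)\<^sup>2 + (F t)\<^sup>2)\<^sup>2"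
proof -
  have "complex_of_real ((W t)\<^sup>2 * c4 ^ 4) = of_real (c4 ^ 4 * ((G t)\<^sup>2 - (F t)\<^sup>2)\<^sup>2 + c2 ^ 4 * ((G t)\<^sup>2 + (F t)\<^sup>2)\<^sup>2)"
    using th_f_wronskian_square[OF s_pos, of "\<i> * of_real t"] unfolding thfg_axis J_eq W_def c_of_real
    by (simp add: power_mult_distrib)
  then have "(W t)\<^sup>2 * c4 ^ 4 = c4 ^ 4 * ((G t)\<^sup>2 - (F t)\<^sup>2)\<^sup>2 + c2 ^ 4 * ((G t)\<^sup>2 + (F t)\<^sup>2)\<^sup>2" by (simp only: of_real_eq_iff)
  then show ?thesis using c4_pos by (simp add: power_divide field_simps)
qed

lemma FG_sum_squares: "(G t)\<^sup>2 - (F t)\<^sup>2 = c2\<^sup>2 * c4 * J4 (2 * t)" "(G t)\<^sup>2 + (F t)\<^sup>2 = c4\<^sup>2 * c2 * J2 (2 * t)"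
proof -
  have "complex_of_real ((G t)\<^sup>2 - (F t)\<^sup>2) = of_real (c2\<^sup>2 * c4 * J4 (2 * t))"
    "complex_of_real ((G t)\<^sup>2 + (F t)\<^sup>2) = of_real (c4\<^sup>2 * c2 * J2 (2 * t))"
    using thfg_sum_squares[OF s_pos, of "\<i> * of_real t"] thfg_diff_squares[OF s_pos, of "\<i> * of_real t"]
    unfolding axis_double J_eq thfg_axis c_of_real
    by (simp_all add: power_mult_distrib mult_ac)
  then show "(G t)\<^sup>2 - (F t)\<^sup>2 = c2\<^sup>2 * c4 * J4 (2 * t)" "(G t)\<^sup>2 + (F t)\<^sup>2 = c4\<^sup>2 * c2 * J2 (2 * t)"
    by (simp_all only: of_real_eq_iff)
qed

lemma F_pos: "0 < t \<Longrightarrow> t \<le> s / 2 \<Longrightarrow> F t > 0" and G_pos: "0 \<le> t \<Longrightarrow> t < s / 2 \<Longrightarrow> G t > 0"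
  using J1_pos[of t] J4_pos[of t] J23_pos[of t] s_pos by (auto simp: F_def G_def)

lemma F_0: "F 0 = 0" and G_end: "G (s / 2) = 0"
  by (simp_all add: F_def G_def J_half_period J1_def th1_0 s_pos)

end

text \<open>With \<open>a = pi * \<lambda> / 2\<close>, \<open>v t\<close> is the value of \<open>z_map\<close> and \<open>Om t = exp (\<i> * ph t)\<close> that of \<open>Omega\<close> at the
  point \<open>\<i> * t\<close> of the variable \<open>pi * u / (2 * K)\<close>; \<open>g1\<close> and \<open>g2\<close> are logarithmic derivatives at \<open>a\<close>.\<close>

locale theta_point = theta_nome +
  fixes a :: real
  assumes a_bounds: "0 < a" "a < pi / 4"
begin

definition "fa = R1 a * R3 a"
definition "ga = R2 a * R4 a"
definition "g1 = D1 a / R1 a + D3 a / R3 a"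
definition "g2 = D2 a / R2 a + D4 a / R4 a"
text \<open>Up to sign and the factor \<open>(thg s 0)^2\<close>, this is the product of the
  numerator and the denominator of \<open>Om\<close>; its positivity keeps both from vanishing on
  the segment.\<close>

definition "NN t = (F t)\<^sup>2 * ga\<^sup>2 + (G t)\<^sup>2 * fa\<^sup>2"
definition "v t = ((F t)\<^sup>2 * ga\<^sup>2 - (G t)\<^sup>2 * fa\<^sup>2) / NN t"
definition "dv t = 4 * fa\<^sup>2 * ga\<^sup>2 * (F t * G t) * (mu * W t) / (NN t)\<^sup>2"
text \<open>i om is the logarithmic derivative of \<open>Om\<close> in t. Writing it as an affine
  function of v exhibits the only value of v at which the phase can be stationary.\<close>

definition "om t = (g1 - g2) * v t - (g1 + g2)"
definition "Om t = thf s (\<i> * of_real t - of_real a) / thf s (\<i> * of_real t + of_real a)"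
text \<open>Starts at pi because \<open>Om 0 = -1\<close>.\<close>

definition "ph t = pi + integral {0..t} om"

lemma R_a_pos: "R1 a > 0" "R2 a > 0" "R1 (2 * a) > 0"
  using a_bounds R1_pos[of a] R2_pos[of a] R1_pos[of "2 * a"] by (auto simp: abs_less_iff)

lemma fga_pos: "fa > 0" "ga > 0"
  using R_a_pos R34_pos by (simp_all add: fa_def ga_def)

lemma thfg_a: "thf s (of_real a) = of_real fa" "thg s (of_real a) = of_real ga"
  "df (of_real a) = of_real (fa * g1)" "dg (of_real a) = of_real (ga * g2)"
  using R_a_pos R34_pos[of a]
  by (auto simp: thf_def thg_def df_def dg_def fa_def ga_def g1_def g2_def R_of_real D_of_real field_simps)

lemma NN_pos: "0 \<le> t \<Longrightarrow> t \<le> s / 2 \<Longrightarrow> NN t > 0"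
proof -
  assume t: "0 \<le> t" "t \<le> s / 2"
  show ?thesis
  proof (cases "t = s / 2")
    case True
    then have "F t > 0" using F_pos[of t] s_pos by simp
    then show ?thesis unfolding NN_def using fga_pos by (intro add_pos_nonneg) auto
  next
    case False
    then have "G t > 0" using G_pos[of t] t by simp
    then show ?thesis unfolding NN_def using fga_pos by (intro add_nonneg_pos) auto
  qed
qed

lemma v_ends: "v 0 = -1" "v (s / 2) = 1"
proof -
  have "NN 0 > 0" "NN (s / 2) > 0" using NN_pos s_pos by auto
  then show "v 0 = -1" "v (s / 2) = 1" by (auto simp: v_def NN_def F_0 G_end)
qed

lemma v_DERIV: "NN t \<noteq> 0 \<Longrightarrow> (v has_real_derivative dv t) (at t)"
proof -
  assume N: "NN t \<noteq> 0"
  have 1: "((\<lambda>t. (F t)\<^sup>2 * ga\<^sup>2 - (G t)\<^sup>2 * fa\<^sup>2) has_real_derivative 2 * F t * dF t * ga\<^sup>2 - 2 * G t * dG t * fa\<^sup>2) (at t)"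
    by (rule derivative_eq_intros FG_DERIV refl | simp)+
  have 2: "(NN has_real_derivative 2 * F t * dF t * ga\<^sup>2 + 2 * G t * dG t * fa\<^sup>2) (at t)"
    unfolding NN_def[abs_def] by (rule derivative_eq_intros FG_DERIV refl | simp)+
  have "(2 * F t * dF t * ga\<^sup>2 - 2 * G t * dG t * fa\<^sup>2) * NN t - ((F t)\<^sup>2 * ga\<^sup>2 - (G t)\<^sup>2 * fa\<^sup>2) * (2 * F t * dF t * ga\<^sup>2 + 2 * G t * dG t * fa\<^sup>2)
     = 4 * fa\<^sup>2 * ga\<^sup>2 * (F t * G t) * (dF t * G t - F t * dG t)"
    unfolding NN_def by (simp add: power2_eq_square algebra_simps)
  then show ?thesis
    using DERIV_divide[OF 1 2 N] unfolding FG_wronskian v_def[abs_def, symmetric] by (simp add: dv_def power2_eq_square)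
qed

lemma v_cont: "continuous_on {0..s / 2} v"
  using v_DERIV NN_pos by (intro continuous_at_imp_continuous_on) (force intro: DERIV_isCont)

lemma dv_pos: "0 < t \<Longrightarrow> t < s / 2 \<Longrightarrow> dv t > 0"
  using F_pos[of t] G_pos[of t] NN_pos[of t] W_pos[of t] mu_pos fga_pos by (simp add: dv_def)

text \<open>Since v - 1 and v + 1 are multiples of G^2 / NN and F^2 / NN, every factor on the right
  is a form in F^2 and G^2, and \<open>W_square\<close> supplies W^2. The ratio (c2 / c4)^4 is (k /
  k')^2.\<close>

lemma dv_square:
  assumes "NN t \<noteq> 0"
  shows "(dv t)\<^sup>2 = (mu\<^sup>2 * ga\<^sup>2 / fa\<^sup>2) * (1 - (v t)\<^sup>2) *
    ((v t - 1 + (fa\<^sup>2 / ga\<^sup>2) * (v t + 1))\<^sup>2 + (c2 / c4) ^ 4 * (v t - 1 - (fa\<^sup>2 / ga\<^sup>2) * (v t + 1))\<^sup>2)"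
proof -
  have m: "v t - 1 = - 2 * (G t)\<^sup>2 * fa\<^sup>2 / NN t"
  proof -
    have "v t - 1 = ((F t)\<^sup>2 * ga\<^sup>2 - (G t)\<^sup>2 * fa\<^sup>2 - NN t) / NN t" using assms by (simp add: v_def diff_divide_distrib)
    also have "(F t)\<^sup>2 * ga\<^sup>2 - (G t)\<^sup>2 * fa\<^sup>2 - NN t = - 2 * (G t)\<^sup>2 * fa\<^sup>2" by (simp add: NN_def)
    finally show ?thesis .
  qed
  have p: "v t + 1 = 2 * (F t)\<^sup>2 * ga\<^sup>2 / NN t"
  proof -
    have "v t + 1 = ((F t)\<^sup>2 * ga\<^sup>2 - (G t)\<^sup>2 * fa\<^sup>2 + NN t) / NN t" using assms by (simp add: v_def add_divide_distrib)
    also have "(F t)\<^sup>2 * ga\<^sup>2 - (G t)\<^sup>2 * fa\<^sup>2 + NN t = 2 * (F t)\<^sup>2 * ga\<^sup>2" by (simp add: NN_def)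
    finally show ?thesis .
  qed
  have q: "(fa\<^sup>2 / ga\<^sup>2) * (v t + 1) = 2 * (F t)\<^sup>2 * fa\<^sup>2 / NN t"
    unfolding p using fga_pos by simp
  have e: "1 - (v t)\<^sup>2 = - ((v t - 1) * (v t + 1))" by (simp add: power2_eq_square algebra_simps)
  have e: "1 - (v t)\<^sup>2 = 4 * (F t)\<^sup>2 * (G t)\<^sup>2 * fa\<^sup>2 * ga\<^sup>2 / (NN t)\<^sup>2"
    unfolding e m p by (simp add: power2_eq_square)
  have b: "(v t - 1 + (fa\<^sup>2 / ga\<^sup>2) * (v t + 1))\<^sup>2 + (c2 / c4) ^ 4 * (v t - 1 - (fa\<^sup>2 / ga\<^sup>2) * (v t + 1))\<^sup>2
     = 4 * fa ^ 4 * (W t)\<^sup>2 / (NN t)\<^sup>2"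
  proof -
    have x: "v t - 1 + (fa\<^sup>2 / ga\<^sup>2) * (v t + 1) = - 2 * fa\<^sup>2 * ((G t)\<^sup>2 - (F t)\<^sup>2) / NN t"
      "v t - 1 - (fa\<^sup>2 / ga\<^sup>2) * (v t + 1) = - 2 * fa\<^sup>2 * ((G t)\<^sup>2 + (F t)\<^sup>2) / NN t"
      unfolding q unfolding m by (simp_all add: field_simps diff_divide_distrib add_divide_distrib)
    have sq: "(- 2 * fa\<^sup>2 * X / NN t)\<^sup>2 = 4 * fa ^ 4 * X\<^sup>2 / (NN t)\<^sup>2" for X
      by (simp add: power_mult_distrib power_divide flip: power_mult)
    show ?thesis unfolding x sq W_square by (simp add: distrib_left add_divide_distrib mult_ac)
  qed
  have "(mu\<^sup>2 * ga\<^sup>2 / fa\<^sup>2) * (4 * (F t)\<^sup>2 * (G t)\<^sup>2 * fa\<^sup>2 * ga\<^sup>2 / (NN t)\<^sup>2) * (4 * fa ^ 4 * (W t)\<^sup>2 / (NN t)\<^sup>2) = (dv t)\<^sup>2"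
    using fga_pos assms by (simp add: dv_def power_mult_distrib power_divide field_simps flip: power_mult)
  then show ?thesis unfolding b e by simp
qed

lemma om_eq: "NN t \<noteq> 0 \<Longrightarrow> om t = - (2 * (F t)\<^sup>2 * ga\<^sup>2 * g2 + 2 * (G t)\<^sup>2 * fa\<^sup>2 * g1) / NN t"
  unfolding om_def v_def by (simp add: field_simps) (simp add: NN_def algebra_simps)

lemma thf_norm:
  "thf s (\<i> * of_real t + of_real a) * thf s (\<i> * of_real t - of_real a) * (thg s 0)\<^sup>2 = - of_real (NN t)"
  using th_f_addition[OF s_pos, of "\<i> * of_real t" "of_real a"] unfolding thfg_axis thfg_a
  by (simp add: NN_def power_mult_distrib)

lemma thf_shift_nonzero: "NN t \<noteq> 0 \<Longrightarrow> thf s (\<i> * of_real t + of_real a) \<noteq> 0" "NN t \<noteq> 0 \<Longrightarrow> thf s (\<i> * of_real t - of_real a) \<noteq> 0"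
  using thf_norm[of t] by auto

text \<open>The derivative of \<open>th_f_addition\<close> with respect to y at y = a:
  differentiating in the second variable produces exactly the numerator of the logarithmic
  derivative of Omega in the first.\<close>

lemma thf_log_derivative:
  "(df (\<i> * of_real t + of_real a) * thf s (\<i> * of_real t - of_real a) - thf s (\<i> * of_real t + of_real a) * df (\<i> * of_real t - of_real a)) * (thg s 0)\<^sup>2
   = - of_real (2 * (F t)\<^sup>2 * ga\<^sup>2 * g2 + 2 * (G t)\<^sup>2 * fa\<^sup>2 * g1)"
proof -
  let ?x = "\<i> * complex_of_real t" and ?a = "complex_of_real a"
  have 1: "((\<lambda>y. thf s (?x + y) * thf s (?x - y) * (thg s 0)\<^sup>2) has_field_derivative
     (df (?x + ?a) * thf s (?x - ?a) - thf s (?x + ?a) * df (?x - ?a)) * (thg s 0)\<^sup>2) (at ?a)"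
    by (rule derivative_eq_intros DERIV_chain2[OF thf_DERIV] refl | simp)+
  have 2: "((\<lambda>y. (thf s ?x)\<^sup>2 * (thg s y)\<^sup>2 - (thg s ?x)\<^sup>2 * (thf s y)\<^sup>2) has_field_derivative
     2 * (thf s ?x)\<^sup>2 * thg s ?a * dg ?a - 2 * (thg s ?x)\<^sup>2 * thf s ?a * df ?a) (at ?a)"
    by (rule derivative_eq_intros thf_DERIV thg_DERIV refl | simp)+
  have "(df (?x + ?a) * thf s (?x - ?a) - thf s (?x + ?a) * df (?x - ?a)) * (thg s 0)\<^sup>2
     = 2 * (thf s ?x)\<^sup>2 * thg s ?a * dg ?a - 2 * (thg s ?x)\<^sup>2 * thf s ?a * df ?a"
    using DERIV_unique[OF 1[unfolded th_f_addition[OF s_pos]] 2] .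
  then show ?thesis unfolding thfg_axis thfg_a by (simp add: power_mult_distrib power2_eq_square algebra_simps)
qed

lemma Om_DERIV:
  assumes N: "NN t \<noteq> 0"
  shows "(Om has_vector_derivative \<i> * of_real (om t) * Om t) (at t)"
proof -
  let ?x = "\<i> * complex_of_real t" and ?a = "complex_of_real a"
  let ?p = "thf s (?x + ?a)" and ?m = "thf s (?x - ?a)"
  note nz = thf_shift_nonzero[OF N]
  have "((\<lambda>x. thf s (x - ?a) / thf s (x + ?a)) has_field_derivative
     (df (?x - ?a) * ?p - ?m * df (?x + ?a)) / (?p * ?p)) (at ?x)"
  proof (intro DERIV_divide)
    show "((\<lambda>x. thf s (x - ?a)) has_field_derivative df (?x - ?a)) (at ?x)"
      using DERIV_shift[of "thf s" _ ?x "- ?a"] thf_DERIV[of "?x - ?a"] by simp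
    show "((\<lambda>x. thf s (x + ?a)) has_field_derivative df (?x + ?a)) (at ?x)"
      using DERIV_shift[of "thf s" _ ?x ?a] thf_DERIV[of "?x + ?a"] by simp
  qed (rule nz)
  from has_vector_derivative_imaginary_axis[OF this]
  have d: "(Om has_vector_derivative \<i> * ((df (?x - ?a) * ?p - ?m * df (?x + ?a)) / (?p * ?p))) (at t)"
    by (simp add: Om_def[abs_def])
  have g0: "thg s 0 \<noteq> 0" using thf_norm[of t] N by auto
  have "(df (?x - ?a) * ?p - ?m * df (?x + ?a)) / (?p * ?p) = ((df (?x - ?a) * ?p - ?m * df (?x + ?a)) * (thg s 0)\<^sup>2) / (?p * ?m * (thg s 0)\<^sup>2) * Om t"
    unfolding Om_def using nz g0 by (simp add: field_simps)
  also have "(df (?x - ?a) * ?p - ?m * df (?x + ?a)) * (thg s 0)\<^sup>2 = of_real (2 * (F t)\<^sup>2 * ga\<^sup>2 * g2 + 2 * (G t)\<^sup>2 * fa\<^sup>2 * g1)"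
    using thf_log_derivative[of t] by (simp add: algebra_simps)
  also have "of_real (2 * (F t)\<^sup>2 * ga\<^sup>2 * g2 + 2 * (G t)\<^sup>2 * fa\<^sup>2 * g1) / (?p * ?m * (thg s 0)\<^sup>2) = complex_of_real (om t)"
    unfolding thf_norm om_eq[OF N] by (simp only: of_real_divide of_real_minus divide_minus_right minus_divide_left)
  finally show ?thesis using d by (simp add: mult.assoc)
qed

lemma om_cont: "continuous_on {0..s / 2} om"
  unfolding om_def by (intro continuous_intros v_cont)

lemma ph_DERIV_within: "t \<in> {0..s / 2} \<Longrightarrow> (ph has_real_derivative om t) (at t within {0..s / 2})"
  unfolding ph_def[abs_def] using integral_has_real_derivative[OF om_cont, of t]
  by (auto intro!: derivative_eq_intros)

lemma ph_DERIV: "0 < t \<Longrightarrow> t < s / 2 \<Longrightarrow> (ph has_real_derivative om t) (at t)"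
  using ph_DERIV_within[of t] at_within_Icc_at[of 0 t "s / 2"] by simp

lemma ph_cont: "continuous_on {0..s / 2} ph"
  using ph_DERIV_within by (rule DERIV_continuous_on)

lemma ph_0: "ph 0 = pi" by (simp add: ph_def)

lemma Om_0: "Om 0 = -1"
proof -
  have "NN 0 \<noteq> 0" using NN_pos[of 0] s_pos by simp
  then show ?thesis using thf_shift_nonzero[of 0] thf_minus[of "of_real a"] by (simp add: Om_def)
qed

text \<open>\<open>Om\<close> times exp (- i ph) has zero derivative and equals 1 at t = 0.\<close>

lemma Om_eq_exp: "t \<in> {0..s / 2} \<Longrightarrow> Om t = exp (\<i> * of_real (ph t))"
proof -
  assume t: "t \<in> {0..s / 2}"
  have "((\<lambda>t. Om t * exp (- (\<i> * of_real (ph t)))) has_vector_derivative 0) (at u within {0..s / 2})" if u: "u \<in> {0..s / 2}" for u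
  proof -
    have N: "NN u \<noteq> 0" using NN_pos[of u] u by simp
    have "((\<lambda>t. - (\<i> * complex_of_real (ph t))) has_vector_derivative - (\<i> * of_real (om u))) (at u within {0..s / 2})"
      by (intro has_vector_derivative_minus has_vector_derivative_mult_right has_vector_derivative_of_real ph_DERIV_within u)
    from field_vector_diff_chain_within[OF this DERIV_subset[OF DERIV_exp, OF subset_UNIV]]
    have 2: "((\<lambda>t. exp (- (\<i> * complex_of_real (ph t)))) has_vector_derivative - (\<i> * of_real (om u)) * exp (- (\<i> * of_real (ph u)))) (at u within {0..s / 2})"
      by (simp add: o_def)
    have 1: "(Om has_vector_derivative \<i> * of_real (om u) * Om u) (at u within {0..s / 2})"
      by (rule has_vector_derivative_at_within[OF Om_DERIV[OF N]])
    from has_vector_derivative_mult[OF 1 2] show ?thesis by (simp add: algebra_simps)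
  qed
  then obtain c where c: "\<And>u. u \<in> {0..s / 2} \<Longrightarrow> Om u * exp (- (\<i> * of_real (ph u))) = c"
    using has_vector_derivative_zero_constant[of "{0..s / 2}"] by auto
  have "Om 0 * exp (- (\<i> * of_real (ph 0))) = 1" by (simp add: Om_0 ph_0 exp_minus)
  then have "c = 1" using c[of 0] s_pos by simp
  then show ?thesis using c[OF t] by (simp add: exp_minus field_simps)
qed

lemma Om_end: "Om (s / 2) = exp (\<i> * of_real (4 * a))"
proof -
  \<comment> \<open>At this end both arguments are translated by the imaginary half-period. This
    turns \<open>thf\<close> into the even function \<open>thg\<close>, which cancels in the
    quotient and leaves the exponential factors only.\<close>
  have f: "thf s (x + \<i> * of_real (s / 2)) = \<i> * exp (of_real (s / 2) - 2 * \<i> * x) * thg s x" for x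
  proof -
    have "thf s (x + \<i> * of_real (s / 2)) = \<i> * (exp (of_real (s / 4) - \<i> * x) * exp (of_real (s / 4) - \<i> * x)) * thg s x"
      unfolding thf_def thg_def th_quasi_period[OF s_pos] by simp
    also have "exp (of_real (s / 4) - \<i> * x) * exp (of_real (s / 4) - \<i> * x) = exp (of_real (s / 2) - 2 * \<i> * x)"
      unfolding exp_add [symmetric] by (rule arg_cong[of _ _ exp]) (simp add: field_simps)
    finally show ?thesis .
  qed
  have "Om (s / 2) = exp (of_real (s / 2) + 2 * \<i> * of_real a) / exp (of_real (s / 2) - 2 * \<i> * of_real a)"
    unfolding Om_def using f[of "of_real a"] f[of "- of_real a"] thg_minus[of "of_real a"] thfg_a(2) fga_pos
    by (simp add: add.commute)
  also have "\<dots> = exp (\<i> * of_real (4 * a))"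
    unfolding exp_diff [symmetric] by (rule arg_cong[of _ _ exp]) (simp add: algebra_simps)
  finally show ?thesis .
qed

lemma ph_end: "\<exists>j::int. ph (s / 2) = 4 * a + 2 * pi * j"
proof -
  have "exp (\<i> * of_real (ph (s / 2))) = exp (\<i> * of_real (4 * a))"
    using Om_eq_exp[of "s / 2"] Om_end s_pos by simp
  then obtain n :: int where "\<i> * of_real (ph (s / 2)) = \<i> * of_real (4 * a) + (of_int (2 * n) * pi) * \<i>"
    unfolding exp_eq by blast
  then have "ph (s / 2) = 4 * a + of_int (2 * n) * pi" by (simp add: complex_eq_iff)
  then show ?thesis by (intro exI[of _ n]) simp
qed

lemma v_strict:
  assumes "0 \<le> x" "x < y" "y \<le> s / 2"
  shows "v x < v y"
proof (rule DERIV_pos_imp_increasing_open[OF assms(2)])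
  show "\<exists>d. (v has_real_derivative d) (at t) \<and> d > 0" if "x < t" "t < y" for t
    using v_DERIV[of t] dv_pos[of t] NN_pos[of t] assms that by auto
  show "continuous_on {x..y} v" using assms by (auto intro: continuous_on_subset[OF v_cont])
qed

text \<open>g1 - g2 is the Wronskian of \<open>thf\<close> and \<open>thg\<close> at a divided by fa
  ga; duplication turns its numerator into theta3 and its denominator into theta1, both at 2
  a.\<close>

lemma g_diff: "g1 - g2 = 2 * kap * (dn (2 * a) / sn (2 * a))"
proof -
  have "complex_of_real (fa * ga * (g1 - g2)) = of_real (mu * (c2\<^sup>2 * c3 * R3 (2 * a)))"
    using thfg_wronskian[of "of_real a"] unfolding th3_duplication[OF s_pos]
    unfolding real_double R_of_real c_of_real thfg_a
    by (simp add: algebra_simps)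
  then have 1: "fa * ga * (g1 - g2) = mu * (c2\<^sup>2 * c3 * R3 (2 * a))" by (simp only: of_real_eq_iff)
  have "complex_of_real (R1 (2 * a) * c2 * c3 * c4) = of_real (2 * (fa * ga))"
    using th1_duplication[OF s_pos, of "of_real a"] unfolding real_double R_of_real c_of_real
    by (simp add: fa_def ga_def mult_ac)
  then have 2: "fa * ga = R1 (2 * a) * c2 * c3 * c4 / 2" by (simp only: of_real_eq_iff)
  have "R1 (2 * a) * c2 * c3 * c4 / 2 \<noteq> 0" using R_a_pos c_pos c4_pos by simp
  then have "g1 - g2 = mu * (c2\<^sup>2 * c3 * R3 (2 * a)) / (R1 (2 * a) * c2 * c3 * c4 / 2)"
    using 1 unfolding 2 by (metis nonzero_mult_div_cancel_left)
  also have "\<dots> = 2 * kap * (dn (2 * a) / sn (2 * a))"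
    using R_a_pos R34_pos[of "2 * a"] c_pos c4_pos
    by (simp add: kap_def dn_def sn_def field_simps power2_eq_square)
  finally show ?thesis .
qed

lemma g_diff_pos: "g1 - g2 > 0"
proof -
  have "sn (2 * a) > 0" using R_a_pos R34_pos[of "2 * a"] c_pos by (simp add: sn_def)
  then show ?thesis unfolding g_diff using kap_pos dn_pos[of "2 * a"] by simp
qed

lemma R_fg_squares: "ga\<^sup>2 + fa\<^sup>2 = c2\<^sup>2 * c4 * R4 (2 * a)" "ga\<^sup>2 - fa\<^sup>2 = c4\<^sup>2 * c2 * R2 (2 * a)"
proof -
  have "complex_of_real (ga\<^sup>2 + fa\<^sup>2) = of_real (c2\<^sup>2 * c4 * R4 (2 * a))"
    "complex_of_real (ga\<^sup>2 - fa\<^sup>2) = of_real (c4\<^sup>2 * c2 * R2 (2 * a))"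
    using thfg_sum_squares[OF s_pos, of "of_real a"] thfg_diff_squares[OF s_pos, of "of_real a"]
    unfolding real_double R_of_real thfg_a c_of_real
    by simp_all
  then show "ga\<^sup>2 + fa\<^sup>2 = c2\<^sup>2 * c4 * R4 (2 * a)" "ga\<^sup>2 - fa\<^sup>2 = c4\<^sup>2 * c2 * R2 (2 * a)"
    by (simp_all only: of_real_eq_iff)
qed

lemma cn_2a: "cn (2 * a) = (ga\<^sup>2 - fa\<^sup>2) / (ga\<^sup>2 + fa\<^sup>2)"
  unfolding R_fg_squares cn_def using c_pos c4_pos R34_pos[of "2 * a"] by (simp add: field_simps power2_eq_square)

lemma sn_2a: "sn (2 * a) * (fa / ga) = 1 - cn (2 * a)"
proof -
  have "complex_of_real (R1 (2 * a) * c2 * c3 * c4) = of_real (2 * (fa * ga))"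
    using th1_duplication[OF s_pos, of "of_real a"] unfolding real_double R_of_real c_of_real
    by (simp add: fa_def ga_def mult_ac)
  then have 2: "R1 (2 * a) = 2 * (fa * ga) / (c2 * c3 * c4)" using c_pos c4_pos by (simp only: of_real_eq_iff) (simp add: field_simps)
  have R4: "R4 (2 * a) = (ga\<^sup>2 + fa\<^sup>2) / (c2\<^sup>2 * c4)" using R_fg_squares c_pos c4_pos by simp
  have p: "ga\<^sup>2 + fa\<^sup>2 > 0" using fga_pos by (simp add: add_pos_pos)
  have "sn (2 * a) * (fa / ga) = 2 * fa\<^sup>2 / (ga\<^sup>2 + fa\<^sup>2)"
  proof -
    have "c3 / c2 * (2 * (fa * ga) / (c2 * c3 * c4) / (P / (c2\<^sup>2 * c4))) * (fa / ga) = 2 * fa\<^sup>2 / P" if "P > 0" for P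
      using fga_pos c_pos c4_pos that by (simp add: field_simps power2_eq_square)
    from this[OF p] show ?thesis unfolding sn_def 2 R4 .
  qed
  also have "\<dots> = 1 - cn (2 * a)" 
  proof -
    have "1 - (X - Y) / (X + Y) = 2 * Y / (X + Y)" if "X + Y > 0" for X Y :: real
      using that by (simp add: field_simps)
    from this[OF p] show ?thesis unfolding cn_2a by simp
  qed
  finally show ?thesis .
qed

text \<open>The zeta function enters here: the Wronskian of \<open>th2\<close> and
  \<open>th4\<close> trades D2 / R2 for Z a and a multiple of fa / ga, and \<open>g2\<close>
  contains D4 / R4 = Z a once more.\<close>

lemma g2_eq: "g2 = 2 * Z a - kap * (fa / ga)"
proof -
  have nz: "th2 s (of_real a) \<noteq> 0" using R_a_pos by (simp add: R_of_real)
  have "complex_of_real (c4\<^sup>2 * (D2 a * R4 a - R2 a * D4 a)) = of_real (- (c3\<^sup>2 * mu) * (R1 a * R3 a))"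
    using th_wronskian_more(2)[OF nz] unfolding R_of_real D_of_real by simp
  then have "c4\<^sup>2 * (D2 a * R4 a - R2 a * D4 a) = - (c3\<^sup>2 * mu) * (R1 a * R3 a)" by (simp only: of_real_eq_iff)
  then have "D2 a * R4 a - R2 a * D4 a = - kap * fa"
    using c4_pos by (simp add: kap_def fa_def field_simps)
  then have "(D2 a * R4 a - R2 a * D4 a) / (R2 a * R4 a) = - kap * (fa / ga)" by (simp add: ga_def)
  moreover have "(D2 a * R4 a - R2 a * D4 a) / (R2 a * R4 a) = D2 a / R2 a - D4 a / R4 a"
    using R_a_pos R34_pos[of a] by (simp add: field_simps)
  ultimately show ?thesis by (simp add: g2_def Z_def)
qed

text \<open>The left side is the zero of \<open>om\<close> as a function of v; \<open>sn_2a\<close>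
  converts the remaining fa / ga into cn(2 a), which gives the shape of
  \<open>z_star\<close>.\<close>

lemma critical_point_eq:
  "(g1 + g2) / (g1 - g2) = 1 + 1 / dn (2 * a) * (cn (2 * a) - 1 + 2 * sn (2 * a) * (Z a / kap))"
proof -
  have sn: "sn (2 * a) > 0" using R_a_pos R34_pos[of "2 * a"] c_pos by (simp add: sn_def)
  have dn: "dn (2 * a) > 0" by (rule dn_pos)
  have "(g1 + g2) / (g1 - g2) = 1 + 2 * g2 / (g1 - g2)" using g_diff_pos by (simp add: field_simps)
  also have "2 * g2 / (g1 - g2) = sn (2 * a) * g2 / (kap * dn (2 * a))"
    unfolding g_diff using sn dn kap_pos by simp
  also have "\<dots> = 1 / dn (2 * a) * (- (sn (2 * a) * (fa / ga)) + 2 * sn (2 * a) * (Z a / kap))"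
    unfolding g2_eq using kap_pos dn by (simp add: field_simps)
  finally show ?thesis unfolding sn_2a by simp
qed

end

section \<open>Counting extremal points\<close>

lemma order_linear_eq: "order r [:-a, 1:] = (if r = a then 1 else 0 :: nat)"
  using order_power_n_n[of a 1] by (auto intro: order_0I)

lemma infinite_roots_imp_0:
  fixes p :: "complex poly"
  assumes "infinite X" "\<And>x. x \<in> X \<Longrightarrow> poly p x = 0"
  shows "p = 0"
  using assms poly_roots_finite[of p] by (metis (mono_tags, lifting) finite_subset mem_Collect_eq subsetI)

lemma unit_segment_iff: "z \<in> unit_segment \<longleftrightarrow> Im z = 0 \<and> -1 \<le> Re z \<and> Re z \<le> 1"
  by (auto simp: complex_eq_iff image_iff intro!: bexI[of _ "Re z"])

text \<open>The phase \<open>ph\<close> at the right end is only given modulo \<open>2 * pi\<close>, which is why the integer \<open>j\<close> appears.\<close>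

locale extremal_param =
  fixes T :: "complex poly" and m n :: nat and \<tau> A M pa nu zs :: real
    and v dv ph :: "real \<Rightarrow> real" and j :: int
  assumes mn: "0 < m" "2 * m < n" and deg: "degree T = n"
    and tau: "\<tau> > 0"
    and v_cont: "continuous_on {0..\<tau>} v" and v_ends: "v 0 = -1" "v \<tau> = 1"
    and v_deriv: "\<And>t. 0 < t \<Longrightarrow> t < \<tau> \<Longrightarrow> (v has_real_derivative dv t) (at t)"
    and dv_pos: "\<And>t. 0 < t \<Longrightarrow> t < \<tau> \<Longrightarrow> dv t > 0"
    and ph_cont: "continuous_on {0..\<tau>} ph" and ph_0: "ph 0 = pi" and ph_end: "ph \<tau> = 2 * pi * (m / n) + 2 * pi * j"
    and ph_deriv: "\<And>t. 0 < t \<Longrightarrow> t < \<tau> \<Longrightarrow> (ph has_real_derivative A * (v t - zs)) (at t)"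
    and T_v: "\<And>t. 0 \<le> t \<Longrightarrow> t \<le> \<tau> \<Longrightarrow> poly T (of_real (v t)) = of_real (cos (n * ph t))"
    and dv_sq: "\<And>t. 0 < t \<Longrightarrow> t < \<tau> \<Longrightarrow>
       (dv t)\<^sup>2 = M * (1 - (v t)\<^sup>2) * ((v t - 1 + pa * (v t + 1))\<^sup>2 + nu * (v t - 1 - pa * (v t + 1))\<^sup>2)"
    and params: "A \<noteq> 0" "M > 0" "pa > 0" "nu > 0"
begin

lemma v_strict: "0 \<le> x \<Longrightarrow> x < y \<Longrightarrow> y \<le> \<tau> \<Longrightarrow> v x < v y"
  by (rule DERIV_pos_imp_increasing_open)
     (auto intro!: exI[of _ "dv _"] v_deriv dv_pos intro: continuous_on_subset[OF v_cont])

lemma v_inj: "inj_on v {0..\<tau>}"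
  by (rule linorder_inj_onI) (use v_strict in fastforce)+

lemma v_image: "v ` {0..\<tau>} = {-1..1}"
proof -
  have "v t \<in> {-1..1}" if "t \<in> {0..\<tau>}" for t
    using v_strict[of 0 t] v_strict[of t \<tau>] v_ends that by (cases "t = 0"; cases "t = \<tau>") auto
  moreover have "\<exists>t\<ge>0. t \<le> \<tau> \<and> v t = y" if "y \<in> {-1..1}" for y
    using IVT'[of v 0 y \<tau>] v_ends that tau v_cont by auto
  ultimately show ?thesis by (auto simp: image_iff Bex_def eq_commute[of _ "v _"])
qed

definition "P = T * T - 1"
text \<open>The linear factors X + i sqrt nu Y and, in \<open>l2\<close>, X - i sqrt nu Y of the
  quadratic X^2 + nu Y^2 in \<open>dv_sq\<close>, where X = z - 1 + pa (z + 1) and Y = z - 1 - pa (z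
  + 1).\<close>

definition "l1 = [:of_real (pa - 1) - \<i> * of_real (sqrt nu * (1 + pa)), of_real (pa + 1) + \<i> * of_real (sqrt nu * (1 - pa)):]"
definition "l2 = [:of_real (pa - 1) + \<i> * of_real (sqrt nu * (1 + pa)), of_real (pa + 1) - \<i> * of_real (sqrt nu * (1 - pa)):]"
definition "B = [:-1, 1:] * [:1, 1:] * (l1 * l2)"
definition "c = of_nat n ^ 2 * complex_of_real A ^ 2"

lemma poly_P: "poly P z = (poly T z)\<^sup>2 - 1" by (simp add: P_def power2_eq_square)

lemma poly_l12: "poly (l1 * l2) z = (z - 1 + of_real pa * (z + 1))\<^sup>2 + of_real nu * (z - 1 - of_real pa * (z + 1))\<^sup>2"
proof -
  define u where "u = \<i> * complex_of_real (sqrt nu)"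
  have "(sqrt nu)\<^sup>2 = nu" using params by simp
  then have u: "u\<^sup>2 = - of_real nu" unfolding u_def by (metis i_squared mult_minus1 of_real_power power_mult_distrib power2_i)
  have A1: "poly l1 z = (z - 1 + of_real pa * (z + 1)) + u * (z - 1 - of_real pa * (z + 1))"
    by (simp add: l1_def u_def algebra_simps)
  have A2: "poly l2 z = (z - 1 + of_real pa * (z + 1)) - u * (z - 1 - of_real pa * (z + 1))"
    by (simp add: l2_def u_def algebra_simps)
  have ring: "(X + u * Y) * (X - u * Y) = X\<^sup>2 - u\<^sup>2 * Y\<^sup>2" for X Y :: complex
    by (simp add: power2_eq_square algebra_simps)
  have "poly (l1 * l2) z = (z - 1 + of_real pa * (z + 1))\<^sup>2 - u\<^sup>2 * (z - 1 - of_real pa * (z + 1))\<^sup>2"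
    unfolding poly_mult A1 A2 by (rule ring)
  then show ?thesis by (simp add: u)
qed

lemma poly_B: "poly B z = (z\<^sup>2 - 1) * ((z - 1 + of_real pa * (z + 1))\<^sup>2 + of_real nu * (z - 1 - of_real pa * (z + 1))\<^sup>2)"
  unfolding B_def poly_mult[of _ "l1 * l2"] poly_l12 by (simp add: power2_eq_square algebra_simps)

lemma T_deriv_v:
  assumes t: "0 < t" "t < \<tau>"
  shows "poly (pderiv T) (of_real (v t)) * of_real (dv t) = - of_real (n * sin (n * ph t) * (A * (v t - zs)))"
proof -
  have "((\<lambda>t. complex_of_real (v t)) has_vector_derivative of_real (dv t)) (at t)"
    using v_deriv[OF t] by (simp add: has_real_derivative_iff_has_vector_derivative has_vector_derivative_of_real)
  from field_vector_diff_chain_at[OF this poly_DERIV[of T]]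
  have 1: "((\<lambda>t. poly T (of_real (v t))) has_vector_derivative of_real (dv t) * poly (pderiv T) (of_real (v t))) (at t)"
    by (simp add: o_def)
  have "((\<lambda>t. cos (n * ph t)) has_real_derivative - sin (n * ph t) * (n * (A * (v t - zs)))) (at t)"
    by (rule derivative_eq_intros ph_deriv[OF t] refl)+ simp
  then have 2: "((\<lambda>t. complex_of_real (cos (n * ph t))) has_vector_derivative of_real (- sin (n * ph t) * (n * (A * (v t - zs))))) (at t)"
    by (simp only: has_real_derivative_iff_has_vector_derivative has_vector_derivative_of_real)
  have "((\<lambda>t. poly T (of_real (v t))) has_vector_derivative of_real (- sin (n * ph t) * (n * (A * (v t - zs))))) (at t)"
    by (rule has_vector_derivative_transform_within_open[OF 2, of "{0<..<\<tau>}"]) (use t T_v in auto)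
  from vector_derivative_unique_at[OF 1 this] show ?thesis by (simp add: mult_ac)
qed

lemma infinite_v: "infinite ((\<lambda>t. complex_of_real (v t)) ` {0<..<\<tau>})"
proof
  assume "finite ((\<lambda>t. complex_of_real (v t)) ` {0<..<\<tau>})"
  moreover have "inj_on (\<lambda>t. complex_of_real (v t)) {0<..<\<tau>}"
    using inj_on_subset[OF v_inj, of "{0<..<\<tau>}"] by (simp add: inj_on_def subset_iff)
  ultimately have "finite {0<..<\<tau>}" by (rule finite_imageD)
  then show False using tau infinite_Ioo[of 0 \<tau>] by simp
qed

text \<open>Squaring \<open>T_deriv_v\<close> replaces the sine by - P and the square of dv by - M
  B, both polynomials in v. Agreement at the infinitely many values v t is agreement of
  polynomials.\<close>

lemma differential_identity: "smult (of_real M) (B * (pderiv T)\<^sup>2) = smult c ([:- of_real zs, 1:]\<^sup>2 * P)"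
proof -
  define X where "X = (\<lambda>t. complex_of_real (v t)) ` {0<..<\<tau>}"
  have X: "infinite X" unfolding X_def by (rule infinite_v)
  have "poly (smult (of_real M) (B * (pderiv T)\<^sup>2) - smult c ([:- of_real zs, 1:]\<^sup>2 * P)) x = 0" if x: "x \<in> X" for x
  proof -
    obtain t where t: "0 < t" "t < \<tau>" and x: "x = of_real (v t)" using x unfolding X_def by auto
    define d where "d = poly (pderiv T) x"
    have dv: "(complex_of_real (dv t))\<^sup>2 = of_real M * - poly B x"
      unfolding poly_B x of_real_power [symmetric] dv_sq[OF t] by (simp add: algebra_simps)
    have "(d * of_real (dv t))\<^sup>2 = (of_nat n)\<^sup>2 * (of_real (sin (n * ph t)))\<^sup>2 * ((of_real A)\<^sup>2 * (x - of_real zs)\<^sup>2)"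
      unfolding d_def x T_deriv_v[OF t] by (simp add: power_mult_distrib)
    also have "(complex_of_real (sin (n * ph t)))\<^sup>2 = - poly P x"
      using T_v[of t] t unfolding poly_P x by (simp flip: of_real_power add: sin_squared_eq)
    finally have "d\<^sup>2 * (of_real M * - poly B x) = - (c * ((x - of_real zs)\<^sup>2 * poly P x))"
      by (simp add: power_mult_distrib dv c_def mult_ac)
    then show ?thesis by (simp add: d_def poly_power algebra_simps)
  qed
  from infinite_roots_imp_0[OF X this] show ?thesis by simp
qed

lemma poly_identity: "of_real M * poly B z * (poly (pderiv T) z)\<^sup>2 = c * (z - of_real zs)\<^sup>2 * poly P z"
  using arg_cong[OF differential_identity, of "\<lambda>p. poly p z"] by (simp add: poly_power mult_ac)

lemma T_nonzero: "T \<noteq> 0" using deg mn by auto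

lemma degree_P: "degree P = 2 * n"
proof -
  have "degree (T * T) = 2 * n" using T_nonzero deg by (simp add: degree_mult_eq)
  then show ?thesis unfolding P_def using mn degree_add_eq_left[of "-1" "T * T"] by simp
qed

lemma P_nonzero: "P \<noteq> 0" using degree_P mn by auto

lemma pderiv_P: "pderiv P = smult 2 (T * pderiv T)"
  by (simp add: P_def pderiv_diff pderiv_mult mult.commute flip: mult_2) (simp add: numeral_poly)

lemma pderiv_T_nonzero: "pderiv T \<noteq> 0"
  using deg mn by (simp add: pderiv_eq_0_iff)

lemma c_nonzero: "c \<noteq> 0" using params mn by (auto simp: c_def)

text \<open>T takes real values at infinitely many real points and so coincides with its conjugate
  polynomial.\<close>

lemma coeff_T_real: "coeff T i \<in> \<real>"
proof -
  have "poly (T - map_poly cnj T) x = 0" if "x \<in> (\<lambda>t. complex_of_real (v t)) ` {0<..<\<tau>}" for x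
    using that T_v by auto
  from infinite_roots_imp_0[OF infinite_v this] have "T = map_poly cnj T" by simp
  then have "coeff T i = cnj (coeff T i)" by (metis coeff_map_poly complex_cnj_zero)
  then show ?thesis by (metis Reals_cnj_iff)
qed

lemma T_cnj: "poly T (cnj z) = cnj (poly T z)" and dT_cnj: "poly (pderiv T) (cnj z) = cnj (poly (pderiv T) z)"
  using poly_cnj_real[of T z] poly_cnj_real[of "pderiv T" z] coeff_T_real by (auto simp: coeff_pderiv)

lemma P_cnj: "poly P (cnj z) = cnj (poly P z)"
  by (simp add: poly_P T_cnj)

lemma T_real: "Im (poly T (of_real x)) = 0" and dT_real: "Im (poly (pderiv T) (of_real x)) = 0"
  using T_cnj[of "of_real x"] dT_cnj[of "of_real x"] by (auto simp: complex_eq_iff)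

lemma extremal_eq_roots: "extremal_points T = {z. poly P z = 0}"
proof -
  have "poly T z \<in> {-1, 1} \<longleftrightarrow> poly P z = 0" for z by (auto simp: poly_P power2_eq_1_iff)
  moreover have "poly T z \<in> {-1, 1} \<Longrightarrow> z \<in> inverse_image T" for z
    by (auto simp: inverse_image_def unit_segment_iff)
  ultimately show ?thesis by (auto simp: extremal_points_def)
qed

lemma finite_extremal: "finite (extremal_points T)"
  unfolding extremal_eq_roots by (rule poly_roots_finite[OF P_nonzero])

lemma extremal_segment: "extremal_points T \<inter> unit_segment = (\<lambda>t. of_real (v t)) ` {t\<in>{0..\<tau>}. \<exists>i::int. n * ph t = i * pi}"
proof -
  have "poly P (of_real (v t)) = 0 \<longleftrightarrow> (\<exists>i::int. n * ph t = i * pi)" if "t \<in> {0..\<tau>}" for t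
  proof -
    have "poly P (of_real (v t)) = of_real ((cos (n * ph t))\<^sup>2 - 1)" using that T_v[of t] by (simp add: poly_P)
    also have "(cos (n * ph t))\<^sup>2 - 1 = - (sin (n * ph t))\<^sup>2" by (simp add: cos_squared_eq)
    finally show ?thesis by (simp add: sin_zero_iff_int2)
  qed
  then show ?thesis unfolding extremal_eq_roots unfolding v_image[symmetric] image_image by auto
qed

definition "a = int n"
definition "b = 2 * int m + 2 * int n * j"

lemma ends: "n * ph 0 = a * pi" "n * ph \<tau> = b * pi"
  using mn by (auto simp: a_def b_def ph_0 ph_end field_simps)

text \<open>a - b = n - 2 m - 2 n j, so j = 0 gives n - 2 m. For j >= 1 the distance is at least n +
  2 m, and for j <= -1 it is at least 3 n - 2 m, which exceeds n + 2 m because 2 m < n.\<close>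

lemma ab_dist: "\<bar>a - b\<bar> \<ge> n - 2 * m" "j = 0 \<or> \<bar>a - b\<bar> \<ge> n + 2 * m"
proof -
  consider "j = 0" | "j \<ge> 1" | "j \<le> -1" by linarith
  then have "(j = 0 \<and> \<bar>a - b\<bar> = n - 2 * m) \<or> \<bar>a - b\<bar> \<ge> n + 2 * m"
  proof cases
    case 2
    then have "int n * 1 \<le> int n * j" by (intro mult_left_mono) auto
    then show ?thesis by (auto simp: a_def b_def)
  next
    case 3
    then have "int n * j \<le> int n * (-1)" by (intro mult_left_mono) auto
    moreover have "a - b = int n - 2 * int m - 2 * (int n * j)" by (simp add: a_def b_def)
    ultimately show ?thesis using mn by linarith
  next
    case 1
    then show ?thesis using mn unfolding a_def b_def by simp
  qed
  then show "\<bar>a - b\<bar> \<ge> n - 2 * m" "j = 0 \<or> \<bar>a - b\<bar> \<ge> n + 2 * m" by auto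
qed

lemma crossing: "i \<in> {min a b..max a b} \<Longrightarrow> \<exists>t\<in>{0..\<tau>}. n * ph t = of_int i * pi"
proof -
  assume i: "i \<in> {min a b..max a b}"
  have cont: "continuous_on {0..\<tau>} (\<lambda>t. n * ph t)" by (intro continuous_intros ph_cont)
  have "of_int (min a b) * pi \<le> of_int i * pi" "of_int i * pi \<le> of_int (max a b) * pi"
    using i by (auto intro!: mult_right_mono simp del: of_int_min of_int_max)
  then consider "n * ph 0 \<le> of_int i * pi" "of_int i * pi \<le> n * ph \<tau>" | "n * ph \<tau> \<le> of_int i * pi" "of_int i * pi \<le> n * ph 0"
    unfolding ends by (cases "a \<le> b") (auto simp: min_def max_def)
  then show ?thesis
    using IVT'[of "\<lambda>t. n * ph t" 0 "of_int i * pi" \<tau>] IVT2'[of "\<lambda>t. n * ph t" \<tau> "of_int i * pi" 0] tau cont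
    by cases auto
qed

lemma card_ab: "card {min a b..max a b} = nat \<bar>a - b\<bar> + 1"
  by (auto simp: min_def max_def)

lemma card_segment_lower: "card (extremal_points T \<inter> unit_segment) \<ge> n - 2 * m + 1"
proof -
  obtain f where f: "\<And>i. i \<in> {min a b..max a b} \<Longrightarrow> f i \<in> {0..\<tau>} \<and> n * ph (f i) = of_int i * pi"
    using crossing by metis
  have "inj_on (\<lambda>i. complex_of_real (v (f i))) {min a b..max a b}"
  proof (rule inj_onI)
    fix i k assume i: "i \<in> {min a b..max a b}" and k: "k \<in> {min a b..max a b}"
      and "complex_of_real (v (f i)) = complex_of_real (v (f k))"
    then have "f i = f k" using v_inj f[OF i] f[OF k] by (auto dest: inj_onD)
    then have "of_int i * pi = of_int k * pi" using f[OF i] f[OF k] by metis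
    then show "i = k" by simp
  qed
  moreover have "(\<lambda>i. complex_of_real (v (f i))) ` {min a b..max a b} \<subseteq> extremal_points T \<inter> unit_segment"
    unfolding extremal_segment using f by auto
  ultimately have "card {min a b..max a b} \<le> card (extremal_points T \<inter> unit_segment)"
    using finite_extremal by (intro card_inj_on_le[of "\<lambda>i. complex_of_real (v (f i))"]) auto
  then show ?thesis using ab_dist(1) mn unfolding card_ab by linarith
qed

end

lemma order_linear: "c1 \<noteq> 0 \<Longrightarrow> order r [:c0, c1:] = (if poly [:c0, c1:] r = 0 then 1 else (0::nat))" for c0 c1 r :: complex
proof -
  assume c1: "c1 \<noteq> 0"
  have eq: "[:c0, c1:] = smult c1 [:- (- c0 / c1), 1:]" using c1 by simp
  have "order r [:c0, c1:] = (if r = - c0 / c1 then 1 else 0)"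
    unfolding eq order_smult[OF c1] by (rule order_linear_eq)
  moreover have "poly [:c0, c1:] r = 0 \<longleftrightarrow> r = - c0 / c1" using c1 by (auto simp: field_simps add_eq_0_iff)
  ultimately show ?thesis by simp
qed

text \<open>At a point with a real value, z and its conjugate have the same image; near z0 the
  function is injective, so the two coincide.\<close>

lemma isolated_real_preimage:
  fixes f :: "complex \<Rightarrow> complex"
  assumes "f holomorphic_on ball z0 r" "r > 0" "deriv f z0 \<noteq> 0" "Im z0 = 0"
    and "\<And>z. z \<in> ball z0 r \<Longrightarrow> f (cnj z) = cnj (f z)"
  obtains e where "e > 0" "e \<le> r" "\<And>z. z \<in> ball z0 e \<Longrightarrow> Im (f z) = 0 \<Longrightarrow> Im z = 0"
proof -
  obtain e where e: "e > 0" "ball z0 e \<subseteq> ball z0 r" "inj_on f (ball z0 e)"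
    using has_complex_derivative_locally_injective[OF assms(1) _ open_ball assms(3)] assms(2) by auto
  have cz0: "cnj z0 = z0" using assms(4) by (simp add: complex_eq_iff)
  have "Im z = 0" if z: "z \<in> ball z0 (min e r)" "Im (f z) = 0" for z
  proof -
    have "dist z0 (cnj z) = dist z0 z" by (metis cz0 dist_complex_def complex_cnj_diff complex_mod_cnj)
    then have "cnj z \<in> ball z0 e" "z \<in> ball z0 e" "z \<in> ball z0 r" using z by auto
    moreover have "f (cnj z) = f z" using assms(5)[of z] z(2) \<open>z \<in> ball z0 r\<close> by (simp add: complex_eq_iff)
    ultimately have "cnj z = z" using e(3) by (auto dest: inj_onD)
    then show ?thesis by (simp add: complex_eq_iff)
  qed
  then show ?thesis using that[of "min e r"] e assms(2) by auto
qed

section \<open>The roots of \<open>B\<close> and orders of vanishing of \<open>P\<close>\<close>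

context extremal_param begin

text \<open>At a real root both squares would vanish, forcing x = 1 and x = -1 at once.\<close>

lemma l12_no_real_root: "Im r = 0 \<Longrightarrow> poly l1 r \<noteq> 0 \<and> poly l2 r \<noteq> 0"
proof -
  assume r: "Im r = 0"
  define x where "x = Re r"
  have rx: "r = of_real x" using r by (simp add: x_def complex_eq_iff)
  have "(x - 1 + pa * (x + 1))\<^sup>2 + nu * (x - 1 - pa * (x + 1))\<^sup>2 \<noteq> 0"
  proof
    assume "(x - 1 + pa * (x + 1))\<^sup>2 + nu * (x - 1 - pa * (x + 1))\<^sup>2 = 0"
    moreover have "0 \<le> (x - 1 + pa * (x + 1))\<^sup>2" "0 \<le> nu * (x - 1 - pa * (x + 1))\<^sup>2"
      using params by simp_all
    ultimately have "(x - 1 + pa * (x + 1))\<^sup>2 = 0" "nu * (x - 1 - pa * (x + 1))\<^sup>2 = 0"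
      by linarith+
    then have "x - 1 + pa * (x + 1) = 0" "x - 1 - pa * (x + 1) = 0" using params by (simp_all only: power_eq_0_iff mult_eq_0_iff) auto
    then have "x = 1" "pa * (x + 1) = 0" by linarith+
    then show False using params by simp
  qed
  moreover have "poly (l1 * l2) r = of_real ((x - 1 + pa * (x + 1))\<^sup>2 + nu * (x - 1 - pa * (x + 1))\<^sup>2)"
    unfolding poly_l12 rx by simp
  ultimately have "poly (l1 * l2) r \<noteq> 0" by (metis of_real_eq_0_iff)
  then show ?thesis by simp
qed

lemma real_B_pos:
  assumes "x\<^sup>2 > 1"
  obtains q where "q > 0" "poly B (of_real x) = of_real q"
proof -
  define q where "q = (x - 1 + pa * (x + 1))\<^sup>2 + nu * (x - 1 - pa * (x + 1))\<^sup>2"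
  have e: "poly (l1 * l2) (of_real x) = of_real q" unfolding poly_l12 q_def by simp
  have "poly (l1 * l2) (of_real x) \<noteq> 0" using l12_no_real_root[of "of_real x"] by simp
  then have "q \<noteq> 0" unfolding e by simp
  moreover have "q \<ge> 0" using params by (simp add: q_def)
  ultimately have "q > 0" by simp
  moreover have "poly B (of_real x) = of_real ((x\<^sup>2 - 1) * q)"
    unfolding poly_B q_def by simp
  ultimately show ?thesis using that[of "(x\<^sup>2 - 1) * q"] assms by simp
qed

text \<open>In the application these two roots are the endpoints a3 and a4 of the arc.\<close>

definition "r3 = - coeff l1 0 / coeff l1 1"
definition "r4 = - coeff l2 0 / coeff l2 1"

lemma l12_lead: "coeff l1 1 \<noteq> 0" "coeff l2 1 \<noteq> 0"
  using params by (auto simp: l1_def l2_def complex_eq_iff)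

lemma l12_roots: "poly l1 r = 0 \<longleftrightarrow> r = r3" "poly l2 r = 0 \<longleftrightarrow> r = r4"
  using l12_lead unfolding r3_def r4_def by (auto simp: l1_def l2_def field_simps add_eq_0_iff)

lemma r34: "Im r3 \<noteq> 0" "Im r4 \<noteq> 0" "r3 \<noteq> r4"
proof -
  show 1: "Im r3 \<noteq> 0" "Im r4 \<noteq> 0" using l12_no_real_root l12_roots by blast+
  have "r4 = cnj r3" unfolding r3_def r4_def by (simp add: l1_def l2_def)
  then show "r3 \<noteq> r4" using 1 by (auto simp: complex_eq_iff)
qed

definition "S4 = {1, -1, r3, r4}"

lemma order_B: "order r B = (if r \<in> S4 then 1 else 0)"
proof -
  have o: "order r l1 = (if r = r3 then 1 else 0)" "order r l2 = (if r = r4 then 1 else 0)"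
    using order_linear[of "coeff l1 1" r "coeff l1 0"] order_linear[of "coeff l2 1" r "coeff l2 0"] l12_lead l12_roots
    by (auto simp: l1_def l2_def)
  have nz: "l1 \<noteq> 0" "l2 \<noteq> 0" using l12_lead by auto
  have 1: "order r [:-1, 1:] = (if r = 1 then 1 else 0)" "order r [:1, 1:] = (if r = -1 then 1 else 0)"
    using order_linear_eq[of r 1] order_linear_eq[of r "-1"] by simp_all
  have "order r B = order r [:-1, 1:] + order r [:1, 1:] + (order r l1 + order r l2)"
    unfolding B_def using nz by (simp add: order_mult del: mult_pCons_left mult_pCons_right)
  moreover have "r3 \<noteq> 1" "r3 \<noteq> -1" "r4 \<noteq> 1" "r4 \<noteq> -1" using r34 by (auto simp: complex_eq_iff)
  ultimately show ?thesis unfolding o 1 S4_def using r34(3) by auto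
qed

lemma B_nonzero: "B \<noteq> 0"
proof -
  have "l1 \<noteq> 0" "l2 \<noteq> 0" using l12_lead by auto
  then show ?thesis unfolding B_def by (simp del: mult_pCons_left mult_pCons_right)
qed

text \<open>Let o be the order of P at r. As the derivative of P is 2 T T' and T is nonzero at r, T'
  vanishes to order o - 1. The differential identity gives ord B + 2 (o - 1) = o away from zs, hence
  o = 2 - ord B.\<close>

lemma order_P:
  assumes "poly P r = 0" "r \<noteq> of_real zs"
  shows "order r P = (if r \<in> S4 then 1 else 2)"
proof -
  have T: "poly T r \<noteq> 0" using assms(1) by (auto simp: poly_P)
  have "order r P = Suc (order r (pderiv P))" using order_pderiv[OF P_nonzero assms(1)] .
  also have "order r (pderiv P) = order r T + order r (pderiv T)"
    unfolding pderiv_P using T_nonzero pderiv_T_nonzero by (simp add: order_smult order_mult)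
  also have "order r T = 0" using T by (rule order_0I)
  finally have 1: "order r P = Suc (order r (pderiv T))" by simp
  have zs: "order r [:- of_real zs, 1:] = 0" using assms(2) by (simp add: order_linear_eq)
  have "order r (smult (of_real M) (B * (pderiv T)\<^sup>2)) = order r B + 2 * order r (pderiv T)"
    using params B_nonzero pderiv_T_nonzero by (simp add: order_smult order_mult power2_eq_square)
  moreover have "order r (smult c ([:- of_real zs, 1:]\<^sup>2 * P)) = order r P"
    using c_nonzero P_nonzero zs by (simp add: order_smult order_mult power2_eq_square del: mult_pCons_left mult_pCons_right)
  ultimately have "order r B + 2 * order r (pderiv T) = order r P"
    using differential_identity by simp
  then show ?thesis using 1 unfolding order_B by (auto split: if_splits)
qed

end

section \<open>The case \<open>zs > 1\<close>: total count and monotone phase\<close>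

locale extremal_param_disjoint = extremal_param +
  assumes zs: "zs > 1"
begin

lemma S4_ne_zs: "r \<in> S4 \<Longrightarrow> r \<noteq> of_real zs"
  using zs r34 by (auto simp: S4_def complex_eq_iff)

lemma S4_roots: "r \<in> S4 \<Longrightarrow> poly P r = 0"
proof -
  assume r: "r \<in> S4"
  have "poly B r = 0" using order_B[of r] r B_nonzero by (simp add: order_root)
  then show ?thesis using poly_identity[of r] c_nonzero S4_ne_zs[OF r] by simp
qed

lemma real_identity:
  fixes x :: real
  shows "poly P (of_real x) = of_real (Re (poly P (of_real x)))" "poly (pderiv T) (of_real x) = of_real (Re (poly (pderiv T) (of_real x)))"
  using T_real[of x] dT_real[of x] by (auto simp: complex_eq_iff poly_P power2_eq_square)

text \<open>B is positive outside [-1, 1], so the differential identity makes P a positive multiple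
  of T'^2 at such real points other than zs.\<close>

lemma P_outside:
  fixes x :: real
  assumes "x\<^sup>2 > 1" "x \<noteq> zs"
  shows "Re (poly P (of_real x)) \<ge> 0" "Re (poly P (of_real x)) = 0 \<Longrightarrow> poly (pderiv T) (of_real x) = 0"
proof -
  obtain q where q: "q > 0" "poly B (of_real x) = of_real q" using real_B_pos[OF assms(1)] .
  define p d where "p = Re (poly P (of_real x))" and "d = Re (poly (pderiv T) (of_real x))"
  have "complex_of_real (M * q * d\<^sup>2) = of_real ((real n)\<^sup>2 * A\<^sup>2 * (x - zs)\<^sup>2 * p)"
    using poly_identity[of "of_real x"] real_identity[of x] unfolding q(2) p_def[symmetric] d_def[symmetric]
    by (simp add: c_def)
  then have eq: "M * q * d\<^sup>2 = (real n)\<^sup>2 * A\<^sup>2 * (x - zs)\<^sup>2 * p" by (simp only: of_real_eq_iff)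
  have C: "(real n)\<^sup>2 * A\<^sup>2 * (x - zs)\<^sup>2 > 0" using assms mn params by simp
  have "0 \<le> M * q * d\<^sup>2" using params q by simp
  then show "Re (poly P (of_real x)) \<ge> 0" unfolding eq using C by (simp add: zero_le_mult_iff p_def)
  show "poly (pderiv T) (of_real x) = 0" if "Re (poly P (of_real x)) = 0"
  proof -
    have "M * q * d\<^sup>2 = 0" unfolding eq using that by (simp add: p_def)
    then have "d = 0" using params q by simp
    then show ?thesis using real_identity(2)[of x] by (simp add: d_def)
  qed
qed

text \<open>Otherwise P has a smallest zero x0 in (1, zs], and P 1 = 0 as well. Rolle's theorem
  gives c between 1 and x0 with T T' = 0 there: T c = 0 would make P negative, against
  \<open>P_outside\<close>, and T' c = 0 would make c a smaller zero of P.\<close>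

lemma P_zs_nonzero: "poly P (of_real zs) \<noteq> 0"
proof
  assume 0: "poly P (of_real zs) = 0"
  define p where "p x = Re (poly P (of_real x))" for x
  define dp where "dp x = Re (poly (pderiv P) (of_real x))" for x
  have p0: "p x = 0 \<longleftrightarrow> poly P (of_real x) = 0" for x using real_identity(1)[of x] by (auto simp: p_def)
  have dp: "(p has_real_derivative dp x) (at x)" for x
    unfolding p_def dp_def using has_vector_derivative_real_field[OF poly_DERIV[of P "of_real x"]]
    by (auto simp: has_real_derivative_iff_has_vector_derivative intro: bounded_linear.has_vector_derivative[OF bounded_linear_Re])
  define Z where "Z = {x. 1 < x \<and> x \<le> zs \<and> p x = 0}"
  have "finite (complex_of_real ` Z)"
    by (rule finite_subset[OF _ poly_roots_finite[OF P_nonzero]]) (auto simp: Z_def p0)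
  then have fZ: "finite Z" by (rule finite_imageD) (auto simp: inj_on_def)
  have "zs \<in> Z" using 0 zs by (simp add: Z_def p0)
  then have "Min Z \<in> Z" using fZ by (intro Min_in) auto
  define x0 where "x0 = Min Z"
  have x0: "1 < x0" "x0 \<le> zs" "p x0 = 0" using \<open>Min Z \<in> Z\<close> by (auto simp: Z_def x0_def)
  have p1: "p 1 = 0" using S4_roots[of 1] by (simp add: p0 S4_def)
  have "\<exists>c>1. c < x0 \<and> dp c = 0"
    using Rolle_deriv[of 1 x0 p "\<lambda>c h. h * dp c"] x0 p1 dp
    by (metis (no_types, lifting) DERIV_isCont Rolle atLeastAtMost_iff DERIV_unique continuous_at_imp_continuous_on real_differentiable_def)
  then obtain c where c: "1 < c" "c < x0" "dp c = 0" by blast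
  have c1: "c\<^sup>2 > 1" "c \<noteq> zs" using c x0 by auto
  have "poly (pderiv P) (of_real c) = 0"
    using c(3) T_real[of c] dT_real[of c] by (auto simp: dp_def pderiv_P complex_eq_iff)
  then consider "poly T (of_real c) = 0" | "poly (pderiv T) (of_real c) = 0" by (auto simp: pderiv_P)
  then show False
  proof cases
    case 1
    then show ?thesis using P_outside(1)[OF c1] by (simp add: poly_P)
  next
    case 2
    then have "poly P (of_real c) = 0" using poly_identity[of "of_real c"] c1 c_nonzero by simp
    then have "c \<in> Z" using c x0 by (simp add: Z_def p0)
    then have "x0 \<le> c" using fZ by (simp add: x0_def)
    then show ?thesis using c by simp
  qed
qed

text \<open>With zs excluded as a root, \<open>order_P\<close> applies to all N distinct roots;
  summing orders gives 2 n = 4 + 2 (N - 4).\<close>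

lemma card_extremal: "card (extremal_points T) = n + 2"
proof -
  define R where "R = {z. poly P z = 0}"
  have fR: "finite R" unfolding R_def by (rule poly_roots_finite[OF P_nonzero])
  have sub: "S4 \<subseteq> R" using S4_roots by (auto simp: R_def)
  have c4: "card S4 = 4" using r34 unfolding S4_def by (auto simp: card_insert_if complex_eq_iff)
  have "2 * n = size (proots P)" by (simp add: size_proots_complex degree_P)
  also have "\<dots> = (\<Sum>r\<in>R. order r P)"
    using P_nonzero by (simp add: size_multiset_overloaded_eq R_def)
  also have "\<dots> = (\<Sum>r\<in>R. if r \<in> S4 then 1 else 2)"
    by (intro sum.cong refl order_P) (use P_zs_nonzero in \<open>auto simp: R_def\<close>)
  also have "\<dots> = (\<Sum>r\<in>S4. 1) + (\<Sum>r\<in>R - S4. 2)"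
    using sum.subset_diff[OF sub fR, of "\<lambda>r. if r \<in> S4 then 1 else 2 :: nat"] by simp
  also have "\<dots> = 4 + 2 * card (R - S4)" using c4 by simp
  also have "card (R - S4) = card R - 4" using card_Diff_subset[OF finite_subset[OF sub fR] sub] c4 by simp
  finally have "2 * n = 4 + 2 * (card R - 4)" .
  moreover have "4 \<le> card R" using card_mono[OF fR sub] c4 by simp
  ultimately have "card R = n + 2" by linarith
  then show ?thesis unfolding extremal_eq_roots R_def .
qed

lemma ph_inj: "inj_on ph {0..\<tau>}" and ph_between: "t \<in> {0..\<tau>} \<Longrightarrow> n * ph t \<in> {min (n * ph 0) (n * ph \<tau>)..max (n * ph 0) (n * ph \<tau>)}"
proof -
  \<comment> \<open>As v t < 1 < zs in the interior, the derivative of \<open>ph\<close> has the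
    sign opposite to that of A; the factor makes f increasing for either sign.\<close>
  define f where "f t = - sgn A * ph t" for t
  have f: "f x < f y" if "0 \<le> x" "x < y" "y \<le> \<tau>" for x y
  proof (rule DERIV_pos_imp_increasing_open[OF that(2)])
    show "continuous_on {x..y} f"
      unfolding f_def by (intro continuous_intros continuous_on_subset[OF ph_cont]) (use that in auto)
    fix t assume t: "x < t" "t < y"
    have "v t < 1" using v_strict[of t \<tau>] v_ends t that by simp
    then have "\<bar>A\<bar> * (zs - v t) > 0" using params zs by simp
    moreover have "(f has_real_derivative - sgn A * (A * (v t - zs))) (at t)"
      unfolding f_def by (intro DERIV_cmult ph_deriv) (use t that in auto)
    moreover have "- sgn A * (A * (v t - zs)) = \<bar>A\<bar> * (zs - v t)"
      by (simp add: abs_sgn algebra_simps)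
    ultimately show "\<exists>d. (f has_real_derivative d) (at t) \<and> d > 0" by auto
  qed
  show "inj_on ph {0..\<tau>}"
  proof (rule inj_onI, rule ccontr)
    fix x y assume x: "x \<in> {0..\<tau>}" and y: "y \<in> {0..\<tau>}" and eq: "ph x = ph y" and "x \<noteq> y"
    then consider "x < y" | "y < x" by linarith
    then have "f x < f y \<or> f y < f x" using f x y by cases auto
    then show False using eq by (simp add: f_def)
  qed
  assume t: "t \<in> {0..\<tau>}"
  have "f 0 \<le> f t" using f[of 0 t] t by (cases "t = 0") auto
  moreover have "f t \<le> f \<tau>" using f[of t \<tau>] t by (cases "t = \<tau>") auto
  ultimately have "min (ph 0) (ph \<tau>) \<le> ph t \<and> ph t \<le> max (ph 0) (ph \<tau>)"
    using params by (auto simp: f_def sgn_if min_def max_def split: if_splits)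
  then have "n * min (ph 0) (ph \<tau>) \<le> n * ph t" "n * ph t \<le> n * max (ph 0) (ph \<tau>)"
    by (auto intro!: mult_left_mono)
  then show "n * ph t \<in> {min (n * ph 0) (n * ph \<tau>)..max (n * ph 0) (n * ph \<tau>)}"
    by (simp add: min_mult_distrib_left max_mult_distrib_left)
qed

lemma card_segment_ab: "card (extremal_points T \<inter> unit_segment) = nat \<bar>a - b\<bar> + 1"
proof -
  define X where "X = {t\<in>{0..\<tau>}. \<exists>i::int. n * ph t = i * pi}"
  \<comment> \<open>At an extremal parameter the floor recovers the integer i with n ph t = i pi, so
    that parameters can be counted by integers.\<close>
  define g where "g t = \<lfloor>n * ph t / pi\<rfloor>" for t
  have g: "g t = i" if "n * ph t = of_int i * pi" for t i using that by (simp add: g_def)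
  have "card (extremal_points T \<inter> unit_segment) = card X"
    unfolding extremal_segment X_def[symmetric]
  proof (rule card_image, rule inj_onI)
    fix x y assume "x \<in> X" "y \<in> X" "complex_of_real (v x) = complex_of_real (v y)"
    then show "x = y" using inj_onD[OF v_inj, of x y] by (simp add: X_def)
  qed
  also have "\<dots> = card (g ` X)"
  proof (rule card_image[symmetric], rule inj_onI)
    fix t u assume t: "t \<in> X" and u: "u \<in> X" and eq: "g t = g u"
    from t obtain i where i: "n * ph t = of_int i * pi" by (auto simp: X_def)
    from u obtain k where k: "n * ph u = of_int k * pi" by (auto simp: X_def)
    have "i = k" using g[OF i] g[OF k] eq by simp
    then have "n * ph t = n * ph u" using i k by simp
    then have "ph t = ph u" using mn by simp
    then show "t = u" using ph_inj t u by (auto simp: X_def dest: inj_onD)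
  qed
  also have "g ` X = {min a b..max a b}"
  proof (intro equalityI subsetI)
    fix i assume "i \<in> g ` X"
    then obtain t where t: "t \<in> {0..\<tau>}" "n * ph t = of_int i * pi" using g by (auto simp: X_def)
    have "min (of_int a * pi) (of_int b * pi) \<le> of_int i * pi \<and> of_int i * pi \<le> max (of_int a * pi) (of_int b * pi)"
      using ph_between[OF t(1)] unfolding ends t(2) by simp
    then show "i \<in> {min a b..max a b}" by (auto simp: min_def max_def split: if_splits)
  next
    fix i assume "i \<in> {min a b..max a b}"
    from crossing[OF this] obtain t where t: "t \<in> {0..\<tau>}" "n * ph t = of_int i * pi" by blast
    then show "i \<in> g ` X" by (intro image_eqI[of _ _ t]) (auto simp: X_def g)
  qed
  finally show ?thesis unfolding card_ab .
qed

text \<open>Any \<open>j \<noteq> 0\<close> would produce more than \<open>n\<close> extremal points on the segment, but two of the \<open>n + 2\<close> are not real.\<close>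

lemma card_segment: "card (extremal_points T \<inter> unit_segment) = n - 2 * m + 1"
proof -
  have "extremal_points T \<inter> unit_segment \<subseteq> extremal_points T - {r3, r4}"
    using r34 unit_segment_iff by blast
  then have "card (extremal_points T \<inter> unit_segment) \<le> card (extremal_points T - {r3, r4})"
    using finite_extremal by (intro card_mono) auto
  also have "\<dots> = n"
    using S4_roots[of r3] S4_roots[of r4] r34 card_extremal finite_extremal
    by (subst card_Diff_subset) (auto simp: extremal_eq_roots S4_def)
  finally have "nat \<bar>a - b\<bar> + 1 \<le> n" unfolding card_segment_ab .
  then have "j = 0" using ab_dist(2) by linarith
  then have "\<bar>a - b\<bar> = int n - 2 * int m" using mn unfolding a_def b_def by simp
  then show ?thesis unfolding card_segment_ab using mn by linarith
qed

end

section \<open>Separation of the arc from the segment\<close>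

context extremal_param_disjoint begin

lemma order_1_deriv: "poly P z = 0 \<Longrightarrow> order z P = 1 \<Longrightarrow> poly (pderiv T) z \<noteq> 0"
proof
  assume P: "poly P z = 0" and o: "order z P = 1" and T: "poly (pderiv T) z = 0"
  have "order z P = Suc (order z (pderiv P))" using order_pderiv[OF P_nonzero P] .
  then have "order z (pderiv P) = 0" using o by simp
  moreover have "poly (pderiv P) z = 0" using T by (simp add: pderiv_P)
  moreover have "pderiv P \<noteq> 0" unfolding pderiv_P using T_nonzero pderiv_T_nonzero by simp
  ultimately show False by (simp add: order_root)
qed

lemma P_nonpos: "poly T z \<in> unit_segment \<Longrightarrow> Im (poly P z) = 0 \<and> Re (poly P z) \<le> 0"
  by (auto simp: poly_P unit_segment_iff power2_eq_square complex_eq_iff abs_square_le_1[unfolded power2_eq_square] abs_le_iff mult_le_one)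

lemma T_segment: "x \<in> {-1..1} \<Longrightarrow> poly T (of_real x) \<in> unit_segment"
proof -
  assume "x \<in> {-1..1}"
  then obtain t where "t \<in> {0..\<tau>}" "x = v t" unfolding v_image[symmetric] by blast
  then show ?thesis unfolding unit_segment_iff using T_v[of t] by simp
qed

text \<open>Near a double root \<open>x0\<close> of \<open>P\<close>, which is nonpositive on the segment, \<open>P / \<sigma>\<close> is the square of a
  locally injective function commuting with conjugation; where \<open>P\<close> is real and nonpositive that function is real.\<close>

lemma near_double_root:
  assumes x0: "-1 < x0" "x0 < 1" and P0: "poly P (of_real x0) = 0"
  obtains e where "e > 0" "\<And>z. z \<in> ball (of_real x0) e \<Longrightarrow> poly T z \<in> unit_segment \<Longrightarrow> Im z = 0"
proof -
  define z0 where "z0 = complex_of_real x0"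
  have "z0 \<notin> S4" using x0 r34 by (auto simp: S4_def z0_def complex_eq_iff)
  moreover have "z0 \<noteq> of_real zs" using x0 zs by (auto simp: z0_def)
  ultimately have o: "order z0 P = 2" using order_P[of z0] P0 by (simp add: z0_def)
  obtain S where S: "P = [:- z0, 1:] ^ 2 * S" "\<not> [:- z0, 1:] dvd S"
    using order_decomp[OF P_nonzero, of z0] unfolding o by blast
  have PS: "poly P z = (z - z0)\<^sup>2 * poly S z" for z
    unfolding S(1) by (simp add: poly_power)
  have S0: "poly S z0 \<noteq> 0" using S(2) by (simp add: poly_eq_0_iff_dvd)
  have S_cnj: "poly S (cnj z) = cnj (poly S z)" if "z \<noteq> z0" for z
  proof -
    have "cnj z \<noteq> z0" using that by (auto simp: z0_def complex_eq_iff)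
    moreover have "(cnj z - z0)\<^sup>2 * poly S (cnj z) = (cnj z - z0)\<^sup>2 * cnj (poly S z)"
      using P_cnj[of z] unfolding PS by (simp add: z0_def)
    ultimately show ?thesis by simp
  qed
  \<comment> \<open>Half the second derivative of P at x0. Its sign is a limit from neighbouring
    real x, since the square (x - x0)^2 can be divided out only for x different from x0.\<close>
  define \<sigma> where "\<sigma> = Re (poly S z0)"
  have S_real: "Im (poly S (of_real x)) = 0 \<and> Re (poly S (of_real x)) \<le> 0" if "x \<in> {-1<..<1}" "x \<noteq> x0" for x
  proof -
    have "of_real x \<noteq> z0" using that by (simp add: z0_def)
    from S_cnj[OF this] have 1: "Im (poly S (of_real x)) = 0" by (simp add: complex_eq_iff)
    have "Re (poly P (of_real x)) = (x - x0)\<^sup>2 * Re (poly S (of_real x))"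
      unfolding PS z0_def by (simp flip: of_real_diff of_real_power)
    moreover have "Re (poly P (of_real x)) \<le> 0" using P_nonpos[OF T_segment[of x]] that by simp
    ultimately show ?thesis using 1 that by (simp add: mult_le_0_iff)
  qed
  have ev: "eventually (\<lambda>x. x \<in> {-1<..<1} \<and> x \<noteq> x0) (at x0)"
    using x0 by (auto simp: eventually_at_filter intro!: eventually_mono[OF eventually_nhds_in_open[of "{-1<..<1}" x0]])
  have lim: "((\<lambda>x. poly S (of_real x)) \<longlongrightarrow> poly S z0) (at x0)"
    unfolding z0_def by (intro tendsto_intros)
  have "Im (poly S z0) = 0"
    by (rule tendsto_unique[OF _ tendsto_Im[OF lim]])
       (auto intro!: tendsto_eventually eventually_mono[OF ev] simp: S_real)
  then have S0\<sigma>: "poly S z0 = of_real \<sigma>" by (simp add: \<sigma>_def complex_eq_iff)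
  have "\<sigma> \<le> 0" unfolding \<sigma>_def
    by (rule tendsto_upperbound[OF tendsto_Re[OF lim]]) (auto intro!: eventually_mono[OF ev] simp: S_real)
  then have \<sigma>: "\<sigma> < 0" using S0 S0\<sigma> by auto
  define h where "h z = poly S z / of_real \<sigma>" for z
  have h0: "h z0 = 1" using \<sigma> by (simp add: h_def S0\<sigma>)
  have "isCont h z0" unfolding h_def using \<sigma> by (intro continuous_intros) auto
  then obtain r where r: "r > 0" "\<And>z. dist z z0 < r \<Longrightarrow> dist (h z) 1 < 1"
    unfolding continuous_at_eps_delta h0 by (metis zero_less_one)
  have hpos: "h z \<notin> \<real>\<^sub>\<le>\<^sub>0" if "z \<in> ball z0 r" for z
  proof -
    have "dist (h z) 1 < 1" using r(2) that by (simp add: dist_commute)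
    then have "\<bar>Re (h z) - 1\<bar> < 1" using abs_Re_le_cmod[of "h z - 1"] by (simp add: dist_complex_def)
    then show ?thesis by (auto simp: complex_nonpos_Reals_iff)
  qed
  define \<psi> where "\<psi> z = (z - z0) * csqrt (h z)" for z
  have hh: "h holomorphic_on ball z0 r" unfolding h_def by (intro holomorphic_intros) (use \<sigma> in auto)
  have ch: "(\<lambda>z. csqrt (h z)) holomorphic_on ball z0 r"
    using hpos by (intro holomorphic_on_csqrt' hh) auto
  have hol: "\<psi> holomorphic_on ball z0 r" unfolding \<psi>_def by (intro holomorphic_intros ch)
  have "((\<lambda>z. csqrt (h z)) has_field_derivative deriv (\<lambda>z. csqrt (h z)) z0) (at z0)"
    using ch r(1) by (intro holomorphic_derivI[of _ "ball z0 r"]) auto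
  from DERIV_mult[OF DERIV_diff[OF DERIV_ident DERIV_const[of z0]] this]
  have "(\<psi> has_field_derivative 1) (at z0)" by (simp add: \<psi>_def[abs_def] h0)
  then have d: "deriv \<psi> z0 \<noteq> 0" by (simp add: DERIV_imp_deriv)
  have \<psi>_cnj: "\<psi> (cnj z) = cnj (\<psi> z)" if "z \<in> ball z0 r" for z
  proof (cases "z = z0")
    case True
    then show ?thesis by (simp add: \<psi>_def z0_def)
  next
    case False
    have "csqrt (h (cnj z)) = cnj (csqrt (h z))"
      using cnj_csqrt[OF hpos[OF that]] S_cnj[OF False] by (simp add: h_def)
    then show ?thesis by (simp add: \<psi>_def z0_def)
  qed
  obtain e where e: "e > 0" "e \<le> r" "\<And>z. z \<in> ball z0 e \<Longrightarrow> Im (\<psi> z) = 0 \<Longrightarrow> Im z = 0"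
    using isolated_real_preimage[OF hol r(1) d _ \<psi>_cnj] by (auto simp: z0_def)
  have "Im z = 0" if "z \<in> ball z0 e" "poly T z \<in> unit_segment" for z
  proof -
    have "(\<psi> z)\<^sup>2 = poly P z / of_real \<sigma>"
      unfolding \<psi>_def PS h_def by (simp add: power_mult_distrib)
    then have "Im ((\<psi> z)\<^sup>2) = 0" "Re ((\<psi> z)\<^sup>2) \<ge> 0"
      using P_nonpos[OF that(2)] \<sigma> by (auto simp: divide_nonpos_neg)
    then have "Im (\<psi> z) = 0"
      by (auto simp: power2_eq_square zero_le_mult_iff)
         (metis add_0 diff_0 less_eq_real_def linorder_not_less mult_eq_0_iff neg_le_0_iff_le not_square_less_zero zero_less_mult_iff)
    then show ?thesis using e(3)[OF that(1)] by simp
  qed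
  then show ?thesis using that[OF e(1)] by (simp add: z0_def)
qed

lemma near_regular:
  assumes "poly (pderiv T) (of_real x0) \<noteq> 0"
  obtains e where "e > 0" "\<And>z. z \<in> ball (of_real x0) e \<Longrightarrow> poly T z \<in> unit_segment \<Longrightarrow> Im z = 0"
proof -
  have "deriv (poly T) (of_real x0) \<noteq> 0" using assms by (simp add: DERIV_imp_deriv[OF poly_DERIV])
  moreover have "poly T holomorphic_on ball (of_real x0) 1" by (intro holomorphic_intros)
  ultimately obtain e where "e > 0" "\<And>z. z \<in> ball (of_real x0) e \<Longrightarrow> Im (poly T z) = 0 \<Longrightarrow> Im z = 0"
    using isolated_real_preimage[of "poly T" "of_real x0" 1, OF _ _ _ _ T_cnj] by (metis Im_complex_of_real zero_less_one)
  then show ?thesis using that by (metis unit_segment_iff)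
qed

text \<open>At an interior point the differential identity leaves two cases: T' is nonzero, or P has
  a double root. Both make nearby preimages real, and staying within [-1, 1] is a matter of the
  radius. At 1 and -1 the root of P is simple, so T' is nonzero nearby; real points beyond the
  segment then have P > 0 and are no preimages.\<close>

lemma near_segment:
  assumes "z0 \<in> unit_segment"
  obtains e where "e > 0" "\<And>z. z \<in> ball z0 e \<Longrightarrow> z \<in> inverse_image T \<Longrightarrow> z \<in> unit_segment"
proof -
  obtain x0 where x0: "z0 = of_real x0" "x0 \<in> {-1..1}" using assms by auto
  show ?thesis
  proof (cases "x0 \<in> {-1, 1}")
    case False
    then have x: "-1 < x0" "x0 < 1" using x0 by auto
    have "poly (pderiv T) (of_real x0) = 0 \<Longrightarrow> poly P (of_real x0) = 0"
      using poly_identity[of "of_real x0"] c_nonzero x zs by auto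
    then obtain e where e: "e > 0" "\<And>z. z \<in> ball (of_real x0) e \<Longrightarrow> poly T z \<in> unit_segment \<Longrightarrow> Im z = 0"
      using near_double_root[OF x] near_regular[of x0] by blast
    define d where "d = min e (1 - \<bar>x0\<bar>)"
    have "z \<in> unit_segment" if z: "z \<in> ball z0 d" "z \<in> inverse_image T" for z
    proof -
      have "Im z = 0" using e(2) z by (auto simp: d_def x0 inverse_image_def)
      moreover have "\<bar>Re z - x0\<bar> < 1 - \<bar>x0\<bar>"
        using z abs_Re_le_cmod[of "z - z0"] by (simp add: d_def x0 dist_commute dist_complex_def)
      ultimately show ?thesis by (auto simp: unit_segment_iff)
    qed
    then show ?thesis using that[of d] e x by (auto simp: d_def)
  next
    case True
    then have "z0 \<in> S4" by (auto simp: S4_def x0)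
    then have "poly (pderiv T) z0 \<noteq> 0" using order_1_deriv order_P[of z0] S4_roots[of z0] S4_ne_zs[of z0] by simp
    then have T: "poly (pderiv T) (of_real x0) \<noteq> 0" by (simp add: x0)
    from near_regular[OF T] obtain e where e: "e > 0" "\<And>z. z \<in> ball (of_real x0) e \<Longrightarrow> poly T z \<in> unit_segment \<Longrightarrow> Im z = 0"
      by blast
    have "isCont (poly (pderiv T)) z0" by simp
    then obtain r where r: "r > 0" "\<And>z. dist z z0 < r \<Longrightarrow> poly (pderiv T) z \<noteq> 0"
      using continuous_at_avoid[of z0 "poly (pderiv T)" 0] T x0 by (metis dist_commute)
    \<comment> \<open>The bound zs - 1 keeps the real part away from zs, where
      \<open>P_outside\<close> does not apply.\<close>
    define d where "d = min (min e r) (zs - 1)"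
    have "z \<in> unit_segment" if z: "z \<in> ball z0 d" "z \<in> inverse_image T" for z
    proof -
      have Im: "Im z = 0" using e(2) z by (auto simp: d_def x0 inverse_image_def)
      then have zr: "z = of_real (Re z)" by (simp add: complex_eq_iff)
      have "\<bar>Re z - x0\<bar> < zs - 1"
        using z abs_Re_le_cmod[of "z - z0"] by (simp add: d_def x0 dist_commute dist_complex_def)
      then have ne: "Re z \<noteq> zs" using True zs by auto
      have "poly (pderiv T) z \<noteq> 0" using r(2) z by (simp add: d_def dist_commute)
      then have T': "poly (pderiv T) (of_real (Re z)) \<noteq> 0" using zr by simp
      have "\<not> (Re z)\<^sup>2 > 1"
      proof
        assume gt: "(Re z)\<^sup>2 > 1"
        have "Re (poly P (of_real (Re z))) > 0" using P_outside[OF gt ne] T' by linarith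
        moreover have "Re (poly P z) \<le> 0" using P_nonpos z(2) by (simp add: inverse_image_def)
        ultimately show False using zr by simp
      qed
      then have "\<bar>Re z\<bar> \<le> 1" using abs_square_le_1[of "Re z"] by simp
      then show ?thesis unfolding unit_segment_iff using Im by (simp add: abs_le_iff)
    qed
    then show ?thesis using that[of d] e r zs by (auto simp: d_def)
  qed
qed

text \<open>U is an open neighbourhood of the segment whose intersection with the preimage is the
  segment itself. U and the complement of the segment cover the connected path and are disjoint on
  it; the starting point decides which one contains the path.\<close>

lemma path_disjoint_segment:
  assumes g: "path g" "pathstart g \<notin> unit_segment" "inverse_image T = unit_segment \<union> path_image g"
  shows "path_image g \<inter> unit_segment = {}"
proof -
  define U where "U = {z. \<exists>z0\<in>unit_segment. \<exists>e>0. z \<in> ball z0 e \<and> (\<forall>w\<in>ball z0 e. w \<in> inverse_image T \<longrightarrow> w \<in> unit_segment)}"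
  have oU: "open U"
  proof (rule openI)
    fix z assume "z \<in> U"
    then obtain z0 e where ze: "z0 \<in> unit_segment" "e > 0" "z \<in> ball z0 e" "\<forall>w\<in>ball z0 e. w \<in> inverse_image T \<longrightarrow> w \<in> unit_segment"
      unfolding U_def by blast
    then have "ball z0 e \<subseteq> U" unfolding U_def by blast
    then show "\<exists>d>0. ball z d \<subseteq> U" using ze(3) open_contains_ball[of "ball z0 e"] by (meson open_ball order_trans)
  qed
  have "closed unit_segment" by (intro compact_imp_closed compact_continuous_image continuous_intros) auto
  then have oV: "open (- unit_segment)" by (simp add: open_Compl)
  have sub: "unit_segment \<subseteq> U"
  proof
    fix z0 assume z0: "z0 \<in> unit_segment"
    obtain e where e: "e > 0" "\<And>z. z \<in> ball z0 e \<Longrightarrow> z \<in> inverse_image T \<Longrightarrow> z \<in> unit_segment"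
      using near_segment[OF z0] by blast
    then have "z0 \<in> ball z0 e" "\<forall>w\<in>ball z0 e. w \<in> inverse_image T \<longrightarrow> w \<in> unit_segment" by auto
    then show "z0 \<in> U" unfolding U_def using z0 e(1) by blast
  qed
  have int: "U \<inter> path_image g \<subseteq> unit_segment"
    unfolding U_def g(3) by blast
  have "connected (path_image g)" using g(1) by (rule connected_path_image)
  then have "U \<inter> path_image g = {} \<or> - unit_segment \<inter> path_image g = {}"
    by (rule connectedD[OF _ oU oV]) (use int sub in blast)+
  moreover have "pathstart g \<in> - unit_segment \<inter> path_image g" using g(2) by (simp add: pathstart_in_path_image)
  ultimately show ?thesis using sub by blast
qed

lemma card_arc:
  assumes "path g" "pathstart g \<notin> unit_segment" "inverse_image T = unit_segment \<union> path_image g"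
  shows "card (extremal_points T \<inter> path_image g) = 2 * m + 1"
proof -
  have sub: "extremal_points T \<subseteq> unit_segment \<union> path_image g"
    using assms(3) by (auto simp: extremal_points_def)
  have "card (extremal_points T) = card (extremal_points T \<inter> unit_segment \<union> extremal_points T \<inter> path_image g)"
    using sub by (intro arg_cong[of _ _ card]) blast
  also have "\<dots> = card (extremal_points T \<inter> unit_segment) + card (extremal_points T \<inter> path_image g)"
    using finite_extremal path_disjoint_segment[OF assms] by (intro card_Un_disjoint) auto
  finally show ?thesis using card_extremal card_segment mn by linarith
qed

end

section \<open>The Jacobi functions\<close>

locale jacobi_modulus =
  fixes k :: real
  assumes k: "0 < k" "k < 1"
begin

definition "sk = pi * ellK (compl_modulus k) / ellK k"

sublocale theta_nome sk
  using modulus_of_nome(1)[OF k] by unfold_locales (simp add: sk_def)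

lemma nome_eq: "nome k = exp (- sk)" and kk_eq: "kk = k"
  using modulus_of_nome(2,3)[OF k] by (simp_all add: sk_def)

lemma ellK_eq: "ellK k = kap * (pi / 2)"
  using ellK_kk by (simp add: kk_eq)

lemma scale: "pi / (2 * ellK k) = 1 / kap"
  by (simp add: ellK_eq)

lemma jacobi_complex:
  fixes x :: complex
  shows "jacobi_H k (of_real kap * x) = th1 sk x" "jacobi_H1 k (of_real kap * x) = th2 sk x"
    "jacobi_Theta1 k (of_real kap * x) = th3 sk x" "jacobi_Theta k (of_real kap * x) = th4 sk x"
  using kap_pos s_pos
  by (simp_all add: jacobi_H_def jacobi_H1_def jacobi_Theta1_def jacobi_Theta_def scale nome_eq
      theta1_eq_th1 theta2_eq_th2 theta3_eq_th3 theta4_eq_th4)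

lemma real_theta_eq: "theta1 x (exp (- sk)) = R1 x" "theta2 x (exp (- sk)) = R2 x"
    "theta3 x (exp (- sk)) = R3 x" "theta4 x (exp (- sk)) = R4 x"
  using real_theta1_eq[OF s_pos, of x] real_theta2_eq[OF s_pos, of x] real_theta3_eq[OF s_pos, of x] real_theta4_eq[OF s_pos, of x]
  unfolding R_of_real of_real_eq_iff by simp_all

lemma jacobi_real:
  fixes x :: real
  shows "jacobi_H k (kap * x) = R1 x" "jacobi_H1 k (kap * x) = R2 x"
    "jacobi_Theta1 k (kap * x) = R3 x" "jacobi_Theta k (kap * x) = R4 x"
  using kap_pos
  by (simp_all add: jacobi_H_def jacobi_H1_def jacobi_Theta1_def jacobi_Theta_def scale nome_eq real_theta_eq)

lemma jacobi_0:
  "jacobi_H1 k 0 = c2" "jacobi_Theta1 k 0 = c3" "jacobi_Theta k 0 = c4"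
  "jacobi_H1 k 0 = complex_of_real c2" "jacobi_Theta1 k 0 = complex_of_real c3" "jacobi_Theta k 0 = complex_of_real c4"
  using jacobi_real[of 0] jacobi_complex[of 0] by (simp_all add: c_of_real)

lemma jacobi_real_functions:
  "jacobi_sn k (kap * x) = sn x" "jacobi_cn k (kap * x) = cn x" "jacobi_dn k (kap * x) = dn x"
  by (simp_all add: jacobi_sn_def jacobi_cn_def jacobi_dn_def jacobi_real jacobi_0 sn_def cn_def dn_def)

lemma jacobi_zn_eq: "jacobi_zn k (kap * x) = Z x / kap"
proof -
  \<comment> \<open>The antiderivative of dn^2 suggested by \<open>Z_DERIV_E\<close>, transported
    from the theta variable t / kap to t.\<close>
  define H where "H t = Z (t / kap) / kap + ellE k / ellK k * t" for t
  have H: "(H has_real_derivative (jacobi_dn k t)\<^sup>2) (at t)" for t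
  proof -
    have "((\<lambda>t. Z (t / kap)) has_real_derivative kap\<^sup>2 * ((dn (t / kap))\<^sup>2 - ellE kk / ellK kk) * (1 / kap)) (at t)"
      by (rule DERIV_chain2[OF Z_DERIV_E]) (intro DERIV_cdivide DERIV_ident)
    then have "(H has_real_derivative kap\<^sup>2 * ((dn (t / kap))\<^sup>2 - ellE kk / ellK kk) * (1 / kap) / kap + ellE k / ellK k * 1) (at t)"
      unfolding H_def by (intro DERIV_add DERIV_cdivide DERIV_cmult DERIV_ident)
    moreover have "dn (t / kap) = jacobi_dn k t"
      using jacobi_real_functions(3)[of "t / kap"] kap_pos by simp
    ultimately show ?thesis using kap_pos by (simp add: kk_eq power2_eq_square)
  qed
  have dn_cont: "continuous_on S (jacobi_dn k :: real \<Rightarrow> real)" for S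
  proof -
    have "jacobi_dn k = (\<lambda>t. dn (t / kap))" using jacobi_real_functions(3)[of "_ / kap"] kap_pos by auto
    moreover have "continuous_on UNIV dn"
      unfolding dn_def[abs_def] using R34_pos by (intro continuous_intros R_cont) (metis less_irrefl)
    moreover have "kap \<noteq> 0" using kap_pos by simp
    ultimately show ?thesis
      by (auto intro!: continuous_on_compose2[of UNIV dn] continuous_intros)
  qed
  have "(LBINT t=ereal 0..ereal (kap * x). (jacobi_dn k t)\<^sup>2) = H (kap * x) - H 0"
    by (rule interval_integral_FTC_finite)
       (use H in \<open>auto intro!: continuous_intros dn_cont simp flip: has_real_derivative_iff_has_vector_derivative intro: has_field_derivative_at_within\<close>)
  moreover have "H 0 = 0" by (simp add: H_def Z_def D4_0)
  moreover have "H (kap * x) = Z x / kap + ellE k / ellK k * (kap * x)" using kap_pos by (simp add: H_def)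
  ultimately show ?thesis by (simp add: jacobi_zn_def zero_ereal_def)
qed

end

section \<open>Omega and z in terms of Jacobi functions\<close>

locale jacobi_point = jacobi_modulus +
  fixes l :: real
  assumes l: "0 < l" "l < 1 / 2"
begin

sublocale theta_point sk "pi * l / 2"
  by unfold_locales (use l in auto)

abbreviation "a \<equiv> pi * l / 2"

lemma lK: "l * ellK k = kap * a" "2 * l * ellK k = kap * (2 * a)"
  by (simp_all add: ellK_eq)

lemma z_star_eq: "z_star k l = (g1 + g2) / (g1 - g2)"
  unfolding z_star_def lK jacobi_real_functions jacobi_zn_eq critical_point_eq ..

lemma om_eq_z_star: "om t = (g1 - g2) * (v t - z_star k l)"
  unfolding om_def z_star_eq using g_diff_pos by (simp add: right_diff_distrib)

lemma arc_beta_pos: "arc_beta k l > 0"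
proof -
  have "sn (2 * a) > 0" using R_a_pos R34_pos[of "2 * a"] c_pos by (simp add: sn_def)
  then show ?thesis unfolding arc_beta_def lK jacobi_real_functions
    using dn_pos[of "2 * a"] k compl_modulus_bounds[OF k] by simp
qed

definition "imag_pt t = of_real kap * (\<i> * complex_of_real t)"

text \<open>By \<open>FG_sum_squares\<close> the condition \<open>ne\<close> says that cn(2 u) has
  no pole at the point. Writing the two values of cn as Y / X and x / y turns z into a quotient of
  bilinear forms, which are twice the numerator of v and twice \<open>NN\<close>.\<close>

lemma axis_point:
  assumes t: "0 \<le> t" "t \<le> sk / 2" and ne: "(G t)\<^sup>2 \<noteq> (F t)\<^sup>2"
  shows "imag_pt t \<in> regular_points k l" "z_map k l (imag_pt t) = of_real (v t)" "Omega k l (imag_pt t) = Om t"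
proof -
  have N: "NN t \<noteq> 0" using NN_pos[OF t] by simp
  note nz = thf_shift_nonzero[OF N]
  have shift: "imag_pt t - of_real (l * ellK k) = of_real kap * (\<i> * of_real t - of_real a)"
    "imag_pt t + of_real (l * ellK k) = of_real kap * (\<i> * of_real t + of_real a)"
    unfolding lK imag_pt_def by (simp_all add: algebra_simps)
  have dbl: "2 * imag_pt t = of_real kap * (\<i> * of_real (2 * t))" by (simp add: imag_pt_def)
  have HT: "jacobi_H k (imag_pt t - of_real (l * ellK k)) * jacobi_Theta1 k (imag_pt t - of_real (l * ellK k)) = thf sk (\<i> * of_real t - of_real a)"
    "jacobi_H k (imag_pt t + of_real (l * ellK k)) * jacobi_Theta1 k (imag_pt t + of_real (l * ellK k)) = thf sk (\<i> * of_real t + of_real a)"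
    unfolding shift jacobi_complex thf_def by simp_all
  show "Omega k l (imag_pt t) = Om t" unfolding Omega_def HT Om_def ..
  define X Y where "X = (G t)\<^sup>2 - (F t)\<^sup>2" and "Y = (G t)\<^sup>2 + (F t)\<^sup>2"
  have X: "X \<noteq> 0" using ne by (simp add: X_def)
  have J4: "J4 (2 * t) = X / (c2\<^sup>2 * c4)" "J2 (2 * t) = Y / (c4\<^sup>2 * c2)"
    using FG_sum_squares[of t] c_pos c4_pos by (simp_all add: X_def Y_def)
  have Th: "jacobi_Theta k (2 * imag_pt t) = of_real (J4 (2 * t))"
    unfolding dbl jacobi_complex J_eq ..
  have cn: "jacobi_cn k (2 * imag_pt t) = of_real (Y / X)"
  proof -
    have "jacobi_cn k (2 * imag_pt t) = of_real (c4 / c2 * (J2 (2 * t) / J4 (2 * t)))"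
      unfolding jacobi_cn_def dbl jacobi_complex J_eq jacobi_0 by simp
    also have "c4 / c2 * (J2 (2 * t) / J4 (2 * t)) = Y / X"
      unfolding J4 using c_pos c4_pos X by (simp add: field_simps power2_eq_square)
    finally show ?thesis .
  qed
  define x y where "x = ga\<^sup>2 - fa\<^sup>2" and "y = ga\<^sup>2 + fa\<^sup>2"
  have cna: "jacobi_cn k (2 * l * ellK k) = x / y" unfolding lK jacobi_real_functions cn_2a x_def y_def ..
  have y: "y > 0" using fga_pos by (simp add: y_def add_pos_pos)
  have den: "Y * y - x * X = 2 * NN t" and num: "Y * x - X * y = 2 * ((F t)\<^sup>2 * ga\<^sup>2 - (G t)\<^sup>2 * fa\<^sup>2)"
    by (simp_all add: X_def Y_def x_def y_def NN_def algebra_simps)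
  have d: "Y / X - x / y = 2 * NN t / (X * y)" and nm: "Y / X * (x / y) - 1 = 2 * ((F t)\<^sup>2 * ga\<^sup>2 - (G t)\<^sup>2 * fa\<^sup>2) / (X * y)"
    unfolding den[symmetric] num[symmetric] using X y by (simp_all add: field_simps)
  have dne: "Y / X - x / y \<noteq> 0" unfolding d using X y N by simp
  show "imag_pt t \<in> regular_points k l"
    unfolding regular_points_def HT Th cn cna mem_Collect_eq of_real_eq_iff of_real_eq_0_iff
    using nz dne X c_pos c4_pos by (simp add: J4)
  have "z_map k l (imag_pt t) = of_real ((Y / X * (x / y) - 1) / (Y / X - x / y))"
    unfolding z_map_def cn cna by simp
  also have "(Y / X * (x / y) - 1) / (Y / X - x / y) = v t"
  proof -
    have "2 * p / (X * y) / (2 * q / (X * y)) = p / q" for p q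
      using X y by (cases "q = 0") (simp_all add: field_simps)
    then show ?thesis unfolding nm d v_def .
  qed
  finally show "z_map k l (imag_pt t) = of_real (v t)" .
qed

lemma v_exceptional:
  assumes "0 \<le> t" "t \<le> sk / 2" "(G t)\<^sup>2 = (F t)\<^sup>2"
  shows "0 < t" "t < sk / 2" "v t = (ga\<^sup>2 - fa\<^sup>2) / (ga\<^sup>2 + fa\<^sup>2)"
proof -
  have "t \<noteq> 0" using assms G_pos[of 0] s_pos F_0 by auto
  moreover have "t \<noteq> sk / 2"
  proof
    assume t: "t = sk / 2"
    show False using assms(3) F_pos[of "sk / 2"] G_end s_pos unfolding t by simp
  qed
  ultimately show t: "0 < t" "t < sk / 2" using assms by auto
  show "v t = (ga\<^sup>2 - fa\<^sup>2) / (ga\<^sup>2 + fa\<^sup>2)"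
    unfolding v_def NN_def assms(3) using F_pos[of t] t by (simp flip: right_diff_distrib distrib_left)
qed

text \<open>At the pole of cn(2 u) the defining property of T gives no information. There v takes
  the value cn(2 a), so by strict monotonicity the pole occurs at only one parameter t, and both
  sides are continuous there.\<close>

lemma T_on_axis:
  assumes T: "is_T_poly k m n T" and mn: "l = real m / real n" and t: "0 \<le> t" "t \<le> sk / 2"
  shows "poly T (of_real (v t)) = of_real (cos (n * ph t))"
proof -
  define h where "h t = poly T (of_real (v t)) - of_real (cos (n * ph t))" for t
  have reg: "h u = 0" if u: "0 \<le> u" "u \<le> sk / 2" "(G u)\<^sup>2 \<noteq> (F u)\<^sup>2" for u
  proof -
    note ax = axis_point[OF u]
    have "poly T (of_real (v u)) = (Om u ^ n + 1 / Om u ^ n) / 2"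
      using T ax unfolding is_T_poly_def mn[symmetric] by metis
    also have "Om u = exp (\<i> * of_real (ph u))" using Om_eq_exp u by simp
    also have "exp (\<i> * of_real (ph u)) ^ n = exp (\<i> * of_real (n * ph u))"
      by (simp add: mult_ac flip: exp_of_nat_mult)
    also have "(exp (\<i> * of_real (n * ph u)) + 1 / exp (\<i> * of_real (n * ph u))) / 2 = cos (complex_of_real (n * ph u))"
      unfolding cos_exp_eq by (simp add: exp_minus inverse_eq_divide)
    finally show ?thesis unfolding h_def cos_of_real by simp
  qed
  show ?thesis
  proof (cases "(G t)\<^sup>2 = (F t)\<^sup>2")
    case False
    then show ?thesis using reg[OF t] by (simp add: h_def)
  next
    case True
    note ex = v_exceptional[OF t True]
    have other: "h u = 0" if u: "0 < u" "u < sk / 2" "u \<noteq> t" for u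
    proof (rule reg)
      show "(G u)\<^sup>2 \<noteq> (F u)\<^sup>2"
      proof
        assume "(G u)\<^sup>2 = (F u)\<^sup>2"
        then have "v u = v t" using v_exceptional(3)[of u] ex u by simp
        moreover have "u < t \<or> t < u" using u by linarith
        ultimately show False using v_strict[of u t] v_strict[of t u] u ex by auto
      qed
    qed (use u in auto)
    have "continuous_on {0<..<sk / 2} h"
      unfolding h_def by (intro continuous_intros continuous_on_subset[OF v_cont] continuous_on_subset[OF ph_cont]) auto
    then have "isCont h t" using ex by (auto simp: continuous_on_eq_continuous_at)
    then have "(h \<longlongrightarrow> h t) (at t)" by (simp add: isCont_def)
    moreover have "(h \<longlongrightarrow> 0) (at t)"
      using ex other
      by (intro tendsto_eventually) (auto simp: eventually_at_filter intro!: eventually_mono[OF eventually_nhds_in_open[of "{0<..<sk / 2}" t]])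
    ultimately have "h t = 0" using tendsto_unique[of "at t"] by auto
    then show ?thesis by (simp add: h_def)
  qed
qed

end

theorem theorem4:
  fixes k :: real and m n :: nat and T :: "complex poly" and g :: "real \<Rightarrow> complex"
  assumes "0 < k" and "k < 1"
    and "0 < m" and "2 * m < n"
    and "is_T_poly k m n T"
    and "arc g"
    and "pathstart g = Complex (arc_alpha k (real m / real n)) (arc_beta k (real m / real n))"
    and "pathfinish g = cnj (pathstart g)"
    and "cnj ` path_image g = path_image g"
    and "inverse_image T = unit_segment \<union> path_image g"
  shows "(z_star k (real m / real n) \<le> 1 \<longrightarrow>
            card (extremal_points T \<inter> unit_segment) \<ge> n - 2 * m + 1) \<and>
         (z_star k (real m / real n) > 1 \<longrightarrow>
            card (extremal_points T \<inter> unit_segment) = n - 2 * m + 1 \<and>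
            card (extremal_points T \<inter> path_image g) = 2 * m + 1)"
proof -
  define l where "l = real m / real n"
  interpret jp: jacobi_point k l
    by unfold_locales (use assms in \<open>auto simp: l_def field_simps\<close>)
  obtain j :: int where "jp.ph (jp.sk / 2) = 4 * (pi * l / 2) + 2 * pi * j" using jp.ph_end by blast
  then have j: "jp.ph (jp.sk / 2) = 2 * pi * (m / n) + 2 * pi * j" by (simp add: l_def)
  \<comment> \<open>The constants M, pa and nu are those of \<open>dv_square\<close>, and A and zs
    come from factoring \<open>om\<close> in \<open>om_eq_z_star\<close>.\<close>
  interpret ep: extremal_param T m n "jp.sk / 2" "jp.g1 - jp.g2" "jp.mu\<^sup>2 * jp.ga\<^sup>2 / jp.fa\<^sup>2" "jp.fa\<^sup>2 / jp.ga\<^sup>2"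
    "(jp.R2 0 / jp.R4 0) ^ 4" "z_star k l" jp.v jp.dv jp.ph j
  proof
    show "0 < m" "2 * m < n" by fact+
    show "degree T = n" using assms(5) by (simp add: is_T_poly_def)
    show "0 < jp.sk / 2" using jp.s_pos by simp
    show "continuous_on {0..jp.sk / 2} jp.v" "jp.v 0 = - 1" "jp.v (jp.sk / 2) = 1"
      by (rule jp.v_cont jp.v_ends)+
    show "continuous_on {0..jp.sk / 2} jp.ph" "jp.ph 0 = pi" by (rule jp.ph_cont jp.ph_0)+
    show "jp.ph (jp.sk / 2) = 2 * pi * (m / n) + 2 * pi * j" by (rule j)
    show "poly T (of_real (jp.v t)) = of_real (cos (n * jp.ph t))" if "0 \<le> t" "t \<le> jp.sk / 2" for t
      using jp.T_on_axis[OF assms(5) _ that] by (simp add: l_def)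
    show "jp.g1 - jp.g2 \<noteq> 0" using jp.g_diff_pos by simp
    show "0 < jp.mu\<^sup>2 * jp.ga\<^sup>2 / jp.fa\<^sup>2" "0 < jp.fa\<^sup>2 / jp.ga\<^sup>2" "0 < (jp.R2 0 / jp.R4 0) ^ 4"
      using jp.mu_pos jp.fga_pos jp.c_pos jp.c4_pos by simp_all
    fix t assume t: "0 < t" "t < jp.sk / 2"
    then have N: "jp.NN t \<noteq> 0" using jp.NN_pos[of t] by simp
    show "(jp.v has_real_derivative jp.dv t) (at t)" by (rule jp.v_DERIV[OF N])
    show "0 < jp.dv t" by (rule jp.dv_pos[OF t])
    show "(jp.ph has_real_derivative (jp.g1 - jp.g2) * (jp.v t - z_star k l)) (at t)"
      using jp.ph_DERIV[OF t] by (simp add: jp.om_eq_z_star)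
    show "(jp.dv t)\<^sup>2 = jp.mu\<^sup>2 * jp.ga\<^sup>2 / jp.fa\<^sup>2 * (1 - (jp.v t)\<^sup>2) *
        ((jp.v t - 1 + jp.fa\<^sup>2 / jp.ga\<^sup>2 * (jp.v t + 1))\<^sup>2 + (jp.R2 0 / jp.R4 0) ^ 4 * (jp.v t - 1 - jp.fa\<^sup>2 / jp.ga\<^sup>2 * (jp.v t + 1))\<^sup>2)"
      by (rule jp.dv_square[OF N])
  qed
  \<comment> \<open>The imaginary part of the starting point is \<open>arc_beta\<close>, which is
    positive; this anchors the connectedness argument off the segment.\<close>
  have start: "pathstart g \<notin> unit_segment"
    using assms(7) jp.arc_beta_pos unfolding unit_segment_iff by (simp add: l_def)
  have "card (extremal_points T \<inter> unit_segment) = n - 2 * m + 1 \<and> card (extremal_points T \<inter> path_image g) = 2 * m + 1"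
    if "z_star k l > 1"
  proof -
    interpret ed: extremal_param_disjoint T m n "jp.sk / 2" "jp.g1 - jp.g2" "jp.mu\<^sup>2 * jp.ga\<^sup>2 / jp.fa\<^sup>2" "jp.fa\<^sup>2 / jp.ga\<^sup>2"
      "(jp.R2 0 / jp.R4 0) ^ 4" "z_star k l" jp.v jp.dv jp.ph j
      by unfold_locales (rule that)
    show ?thesis using ed.card_segment ed.card_arc[OF arc_imp_path[OF assms(6)] start assms(10)] by blast
  qed
  then show ?thesis using ep.card_segment_lower unfolding l_def by blast
qed

end
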